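(* Let $\Omega=\mathbb{R}^d$ or $\mathbb{T}^d$ ($d\ge 1$), $0<t_*\le\infty$, $\Gamma=\Omega\times(0,t_* )$. Let $u,\varrho\in L^\infty(\Gamma;\mathbb{R})$, $\mathbf{v}\in L^\infty(\Gamma;\mathbb{R}^d)$ be any weak (distributional) solution on $\Gamma$ of the compressible Euler system $$\partial_t\varrho+\nabla_x\cdot(\varrho\mathbf{v})=0,\quad \partial_t(\varrho\mathbf{v})+\nabla_x\cdot(\varrho\mathbf{v}\otimes\mathbf{v}+p\mathbf{I})=0,\quad \partial_tE+\nabla_x\cdot((p+E)\mathbf{v})=0,$$ where $E=\tfrac12\varrho|\mathbf{v}|^2+u$ and $p=p(u,\varrho)$, satisfying $\varrho\ge\varrho_0$ a.e. for some constant $\varrho_0>0$ and the smoothness assumption on thermodynamic functions stated in the context. Let $Q_\ell^{\rm flux}$ and $\Sigma_\ell^{\rm inert*}$ be the quantities defined in the context from a space-time mollifier $\mathcal{G}$. Assume that the distributional limit $$Q_{\rm flux}=\lim_{\ell\to0}Q_\ell^{\rm flux}\quad\text{in }\mathcal{D}'(\Gamma)$$ exists (independently of the mollifier $\mathcal{G}$). Then the distributional limits $$\Sigma_{\rm inert}=\lim_{\ell\to0}\Sigma_\ell^{\rm inert*},\qquad p\circ\Theta=\lim_{\ell\to0}(p*\mathcal{G}_\ell)(\Theta*\mathcal{G}_\ell)\quad\text{in }\mathcal{D}'(\Gamma)$$ (with $\Theta=\nabla_x\cdot\mathbf{v}$) necessarily exist, independently of the mollifier $\mathcal{G}$, and the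 following local balance equations hold in the sense of distributions on $\Gamma$: $$\partial_t\left(\tfrac12\varrho|\mathbf{v}|^2\right)+\nabla_x\cdot\left(\left(p+\tfrac12\varrho|\mathbf{v}|^2\right)\mathbf{v}\right)=p\circ\Theta-Q_{\rm flux},$$ $$\partial_tu+\nabla_x\cdot(u\mathbf{v})=Q_{\rm flux}-p\circ\Theta,$$ $$\partial_ts+\nabla_x\cdot(s\mathbf{v})=\Sigma_{\rm inert},$$ where $s=s(u,\varrho)$ is the entropy density.
   Context: Thermodynamics. The entropy density $s=s(u,\varrho)$ is a given concave function of internal energy density $u$ and mass density $\varrho$. Temperature $T(u,\varrho)>0$, chemical potential $\mu(u,\varrho)$ and pressure $p(u,\varrho)$ are determined by the first law $T\,ds=du-\mu\,d\varrho$ and the Gibbs relation $Ts=u+p-\mu\varrho$. Put $\beta=1/T$, $\lambda=\mu/T$. Smoothness assumption. Let $\mathcal{R}\subset\mathbb{R}^2$ be the essential range of $(u,\varrho)$ over $\Gamma$ (a compact set). There are a compact $K$ and an open $U\subset\mathbb{R}^2$ with $\mathrm{conv}(\mathcal{R})\subseteq K\subset U$ (closed convex hull) such that all thermodynamic functions $h=p,T,\mu,s$ belong to $C^M(U)$ for some $M\ge2$. Coarse-graining. A mollifier is $\mathcal{G}\in C_c^\infty(\mathbb{R}^d\times\mathbb{R})$, $\mathcal{G}\ge0$, $\int\mathcal{G}=1$, supported in the Euclidean unit ball; $\mathcal{G}_\ell(\mathbf{r},\tau)=\ell^{-(d+1)}\mathcal{G}(\mathbf{r}/\ell,\tau/\ell)$.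 For a function or distribution $f$, $\bar f_\ell(\mathbf{x},t)=\int \mathcal{G}_\ell(\mathbf{r},\tau)f(\mathbf{x}+\mathbf{r},t+\tau)\,d\mathbf{r}\,d\tau$ (in the distributional sense if necessary). These are defined at points whose distance to $\partial\Gamma$ exceeds $\ell$, hence on any compact subset of $\Gamma$ for $\ell$ small; limits in $\mathcal{D}'(\Gamma)$ are understood accordingly. Set $\bar\tau_\ell(f,g)=\overline{(fg)}_\ell-\bar f_\ell\bar g_\ell$ (componentwise for vectors). The Favre average is $\tilde f_\ell=\overline{(\varrho f)}_\ell/\bar\varrho_\ell$, and its second and third cumulants are $\tilde\tau_\ell(f,g)=\widetilde{(fg)}_\ell-\tilde f_\ell\tilde g_\ell$ and $\tilde\tau_\ell(f,g,h)=\widetilde{(fgh)}_\ell-\tilde f_\ell\tilde\tau_\ell(g,h)-\tilde g_\ell\tilde\tau_\ell(f,h)-\tilde h_\ell\tilde\tau_\ell(f,g)-\tilde f_\ell\tilde g_\ell\tilde h_\ell$. For a thermodynamic function $h$, $\underline h_\ell=h(\bar u_\ell,\bar\varrho_\ell)$, whereas $\bar h_\ell=\overline{h(u,\varrho)}_\ell$. Repeated indices $i$ are summed from $1$ to $d$. Definitions: $$Q_\ell^{\rm flux}=\frac{\nabla_x\bar p_\ell}{\bar\varrho_\ell}\cdot\bar\tau_\ell(\varrho,\mathbf{v})-\bar\varrho_\ell\nabla_x\tilde{\mathbf{v}}_\ell:\tilde\tau_\ell(\mathbf{v},\mathbf{v}),$$ $$k_\ell=\tfrac12\bar\varrho_\ell\tilde\tau_\ell(v_i,v_i),\qquad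 \mathbf{J}_\ell^k=\tfrac12\bar\varrho_\ell\tilde\tau_\ell(v_i,v_i)\tilde{\mathbf{v}}_\ell+\bar\tau_\ell(p,\mathbf{v})+\tfrac12\bar\varrho_\ell\tilde\tau_\ell(v_i,v_i,\mathbf{v}),$$ $$I_\ell^{\rm flux}=\underline\beta_\ell(\bar p_\ell-\underline p_\ell)\bar\Theta_\ell,\qquad \Sigma_\ell^{\rm flux}=\nabla_x\underline\beta_\ell\cdot\bar\tau_\ell(u,\mathbf{v})-\nabla_x\underline\lambda_\ell\cdot\bar\tau_\ell(\varrho,\mathbf{v}),$$ $$\Sigma_\ell^{\rm flux*}=\Sigma_\ell^{\rm flux}+\underline\beta_\ell Q_\ell^{\rm flux}+(\partial_t\underline\beta_\ell)k_\ell+\nabla_x\underline\beta_\ell\cdot\mathbf{J}_\ell^k,\qquad \Sigma_\ell^{\rm inert*}=-I_\ell^{\rm flux}+\Sigma_\ell^{\rm flux*}.$$ *)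

theory Defs
  imports "HOL-Analysis.Analysis"
begin

definition pd :: "'a::euclidean_space \<Rightarrow> ('a \<Rightarrow> real) \<Rightarrow> 'a \<Rightarrow> real"
  where "pd b f z = frechet_derivative f (at z) b"

primrec pds :: "'a::euclidean_space list \<Rightarrow> ('a \<Rightarrow> real) \<Rightarrow> 'a \<Rightarrow> real"
  where "pds [] f = f"
  | "pds (b # bs) f = pd b (pds bs f)"

text \<open>\<open>Ck_on k U f\<close> is meant for open \<open>U\<close>. The order \<open>k\<close> is finite, and the differentiability
  clause ensures that the partial derivatives occurring in the second clause are genuine.\<close>

definition Ck_on :: "nat \<Rightarrow> 'a::euclidean_space set \<Rightarrow> ('a \<Rightarrow> real) \<Rightarrow> bool"
  where "Ck_on k U f \<longleftrightarrow>
    (\<forall>bs. set bs \<subseteq> Basis \<and> length bs < k \<longrightarrow> (\<forall>z\<in>U. pds bs f differentiable (at z))) \<and>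
    (\<forall>bs. set bs \<subseteq> Basis \<and> length bs \<le> k \<longrightarrow> continuous_on U (pds bs f))"

definition smooth :: "('a::euclidean_space \<Rightarrow> real) \<Rightarrow> bool"
  where "smooth f \<longleftrightarrow> (\<forall>k. Ck_on k UNIV f)"

definition ess_range :: "'a measure \<Rightarrow> ('a \<Rightarrow> 'b::metric_space) \<Rightarrow> 'b set"
  where "ess_range M f = {y. \<forall>e>0. emeasure M {z \<in> space M. f z \<in> ball y e} \<noteq> 0}"

text \<open>Functions on the torus, which is \<open>\<real>\<^sup>d\<close> modulo the integer lattice, are represented by
  lattice-periodic functions on \<open>\<real>\<^sup>d\<close>; the torus as a measure space is represented by the unit cell.
  The whole space is the case of the trivial lattice.\<close>

datatype space_kind = Whole | Torus

definition periods :: "space_kind \<Rightarrow> (real^'n) set"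
  where "periods \<Omega> = (case \<Omega> of Whole \<Rightarrow> {0} | Torus \<Rightarrow> {k. \<forall>i. k $ i \<in> \<int>})"

definition cell :: "space_kind \<Rightarrow> (real^'n) set"
  where "cell \<Omega> = (case \<Omega> of Whole \<Rightarrow> UNIV | Torus \<Rightarrow> {x. \<forall>i. 0 \<le> x $ i \<and> x $ i < 1})"

definition time_interval :: "ereal \<Rightarrow> real set"
  where "time_interval ts = {t. 0 < t \<and> ereal t < ts}"

definition Gam :: "space_kind \<Rightarrow> ereal \<Rightarrow> ((real^'n) \<times> real) measure"
  where "Gam \<Omega> ts = lebesgue_on (cell \<Omega> \<times> time_interval ts)"

definition periodic :: "space_kind \<Rightarrow> ((real^'n) \<times> real \<Rightarrow> 'b) \<Rightarrow> bool"
  where "periodic \<Omega> f \<longleftrightarrow> (\<forall>k\<in>periods \<Omega>. \<forall>z. f (z + (k, 0)) = f z)"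

text \<open>Values at times outside \<open>(0, ts)\<close> are irrelevant.\<close>

definition Linf :: "space_kind \<Rightarrow> ereal \<Rightarrow> ((real^'n) \<times> real \<Rightarrow> 'b::euclidean_space) \<Rightarrow> bool"
  where "Linf \<Omega> ts f \<longleftrightarrow> periodic \<Omega> f \<and> f \<in> borel_measurable (Gam \<Omega> ts) \<and>
    (\<exists>C. AE z in Gam \<Omega> ts. norm (f z) \<le> C)"

definition dt :: "((real^'n) \<times> real \<Rightarrow> real) \<Rightarrow> (real^'n) \<times> real \<Rightarrow> real"
  where "dt = pd (0, 1)"

definition dx :: "'n \<Rightarrow> ((real^'n) \<times> real \<Rightarrow> real) \<Rightarrow> (real^'n) \<times> real \<Rightarrow> real"
  where "dx i = pd (axis i 1, 0)"

definition supp_in :: "space_kind \<Rightarrow> ((real^'n) \<times> real) set \<Rightarrow> ((real^'n) \<times> real \<Rightarrow> real) \<Rightarrow> bool"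
  where "supp_in \<Omega> K \<phi> \<longleftrightarrow> (\<forall>z. \<phi> z \<noteq> 0 \<longrightarrow> (\<exists>k\<in>periods \<Omega>. z + (k, 0) \<in> K))"

definition test_fun :: "space_kind \<Rightarrow> ereal \<Rightarrow> ((real^'n) \<times> real \<Rightarrow> real) \<Rightarrow> bool"
  where "test_fun \<Omega> ts \<phi> \<longleftrightarrow> smooth \<phi> \<and> periodic \<Omega> \<phi> \<and>
    (\<exists>K. compact K \<and> K \<subseteq> UNIV \<times> time_interval ts \<and> supp_in \<Omega> K \<phi>)"

type_synonym 'n functional = "((real^'n) \<times> real \<Rightarrow> real) \<Rightarrow> real"

text \<open>In the continuity clause \<open>B\<close> ranges over the bounds of the \<open>C\<^sup>N\<close> norm of \<open>\<phi>\<close>.\<close>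

definition distribution :: "space_kind \<Rightarrow> ereal \<Rightarrow> 'n::finite functional \<Rightarrow> bool"
  where "distribution \<Omega> ts D \<longleftrightarrow>
    (\<forall>\<phi> \<psi>. test_fun \<Omega> ts \<phi> \<longrightarrow> test_fun \<Omega> ts \<psi> \<longrightarrow> D (\<lambda>z. \<phi> z + \<psi> z) = D \<phi> + D \<psi>) \<and>
    (\<forall>c \<phi>. test_fun \<Omega> ts \<phi> \<longrightarrow> D (\<lambda>z. c * \<phi> z) = c * D \<phi>) \<and>
    (\<forall>K. compact K \<and> K \<subseteq> UNIV \<times> time_interval ts \<longrightarrow>
      (\<exists>C N. \<forall>\<phi> B. test_fun \<Omega> ts \<phi> \<longrightarrow> supp_in \<Omega> K \<phi> \<longrightarrow>
        (\<forall>bs z. set bs \<subseteq> Basis \<longrightarrow> length bs \<le> N \<longrightarrow> \<bar>pds bs \<phi> z\<bar> \<le> B) \<longrightarrow> \<bar>D \<phi>\<bar> \<le> C * B))"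

definition reg :: "space_kind \<Rightarrow> ereal \<Rightarrow> ((real^'n) \<times> real \<Rightarrow> real) \<Rightarrow> 'n::finite functional"
  where "reg \<Omega> ts f \<phi> = (\<integral>z. f z * \<phi> z \<partial>Gam \<Omega> ts)"

definition ddt :: "'n::finite functional \<Rightarrow> 'n functional"
  where "ddt D \<phi> = - D (dt \<phi>)"

definition ddx :: "'n \<Rightarrow> 'n::finite functional \<Rightarrow> 'n functional"
  where "ddx i D \<phi> = - D (dx i \<phi>)"

definition ddiv :: "space_kind \<Rightarrow> ereal \<Rightarrow> ((real^'n) \<times> real \<Rightarrow> real^'n) \<Rightarrow> 'n::finite functional"
  where "ddiv \<Omega> ts F \<phi> = (\<Sum>i\<in>UNIV. ddx i (reg \<Omega> ts (\<lambda>z. F z $ i)) \<phi>)"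

text \<open>Convergence in the sense of distributions as the parameter tends to \<open>0\<close> from the right.
  The functions \<open>F l\<close> need only be meaningful, for small \<open>l\<close>, on the support of the test function.\<close>

definition dlim :: "space_kind \<Rightarrow> ereal \<Rightarrow> (real \<Rightarrow> (real^'n) \<times> real \<Rightarrow> real) \<Rightarrow> 'n::finite functional \<Rightarrow> bool"
  where "dlim \<Omega> ts F D \<longleftrightarrow>
    (\<forall>\<phi>. test_fun \<Omega> ts \<phi> \<longrightarrow> ((\<lambda>l. reg \<Omega> ts (F l) \<phi>) \<longlongrightarrow> D \<phi>) (at_right 0))"

definition mollifier :: "((real^'n) \<times> real \<Rightarrow> real) \<Rightarrow> bool"
  where "mollifier G \<longleftrightarrow> smooth G \<and> (\<forall>z. 0 \<le> G z) \<and> (\<integral>z. G z \<partial>lebesgue) = 1 \<and>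
    (\<forall>z. G z \<noteq> 0 \<longrightarrow> norm z \<le> 1)"

definition scaled :: "((real^'n) \<times> real \<Rightarrow> real) \<Rightarrow> real \<Rightarrow> (real^'n) \<times> real \<Rightarrow> real"
  where "scaled G l w = G (w /\<^sub>R l) / l ^ (CARD('n) + 1)"

text \<open>At distance more than \<open>l\<close> from the boundary of space-time, only values of \<open>f\<close> inside
  space-time enter.\<close>

definition avg :: "((real^'n) \<times> real \<Rightarrow> real) \<Rightarrow> real \<Rightarrow> ((real^'n) \<times> real \<Rightarrow> real) \<Rightarrow> (real^'n) \<times> real \<Rightarrow> real"
  where "avg G l f z = (\<integral>w. scaled G l w * f (z + w) \<partial>lebesgue)"

text \<open>Average of a distribution: it is applied to the translated kernel, which on the torus has to
  be made periodic. All but finitely many terms of the sum vanish.\<close>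

definition distr_avg :: "space_kind \<Rightarrow> ((real^'n) \<times> real \<Rightarrow> real) \<Rightarrow> real \<Rightarrow> 'n::finite functional \<Rightarrow>
    (real^'n) \<times> real \<Rightarrow> real"
  where "distr_avg \<Omega> G l D z = D (\<lambda>w. \<Sum>\<^sub>\<infinity>k\<in>periods \<Omega>. scaled G l (w + (k, 0) - z))"

definition tau :: "((real^'n) \<times> real \<Rightarrow> real) \<Rightarrow> real \<Rightarrow>
    ((real^'n) \<times> real \<Rightarrow> real) \<Rightarrow> ((real^'n) \<times> real \<Rightarrow> real) \<Rightarrow> (real^'n) \<times> real \<Rightarrow> real"
  where "tau G l f g z = avg G l (\<lambda>w. f w * g w) z - avg G l f z * avg G l g z"

definition favre :: "((real^'n) \<times> real \<Rightarrow> real) \<Rightarrow> real \<Rightarrow> ((real^'n) \<times> real \<Rightarrow> real) \<Rightarrow>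
    ((real^'n) \<times> real \<Rightarrow> real) \<Rightarrow> (real^'n) \<times> real \<Rightarrow> real"
  where "favre G l \<rho> f z = avg G l (\<lambda>w. \<rho> w * f w) z / avg G l \<rho> z"

definition ftau2 :: "((real^'n) \<times> real \<Rightarrow> real) \<Rightarrow> real \<Rightarrow> ((real^'n) \<times> real \<Rightarrow> real) \<Rightarrow>
    ((real^'n) \<times> real \<Rightarrow> real) \<Rightarrow> ((real^'n) \<times> real \<Rightarrow> real) \<Rightarrow> (real^'n) \<times> real \<Rightarrow> real"
  where "ftau2 G l \<rho> f g z =
    favre G l \<rho> (\<lambda>w. f w * g w) z - favre G l \<rho> f z * favre G l \<rho> g z"

definition ftau3 :: "((real^'n) \<times> real \<Rightarrow> real) \<Rightarrow> real \<Rightarrow> ((real^'n) \<times> real \<Rightarrow> real) \<Rightarrow>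
    ((real^'n) \<times> real \<Rightarrow> real) \<Rightarrow> ((real^'n) \<times> real \<Rightarrow> real) \<Rightarrow> ((real^'n) \<times> real \<Rightarrow> real) \<Rightarrow>
    (real^'n) \<times> real \<Rightarrow> real"
  where "ftau3 G l \<rho> f g h z =
    favre G l \<rho> (\<lambda>w. f w * g w * h w) z
    - favre G l \<rho> f z * ftau2 G l \<rho> g h z
    - favre G l \<rho> g z * ftau2 G l \<rho> f h z
    - favre G l \<rho> h z * ftau2 G l \<rho> f g z
    - favre G l \<rho> f z * favre G l \<rho> g z * favre G l \<rho> h z"

text \<open>Thermodynamic functions take the pair (internal energy density, mass density). The derivative
  in the first law is the total differential of the entropy density.\<close>

definition thermo :: "(real \<times> real) set \<Rightarrow> (real \<times> real \<Rightarrow> real) \<Rightarrow> (real \<times> real \<Rightarrow> real) \<Rightarrow>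
    (real \<times> real \<Rightarrow> real) \<Rightarrow> (real \<times> real \<Rightarrow> real) \<Rightarrow> bool"
  where "thermo U s T \<mu> p \<longleftrightarrow> (\<forall>y\<in>U. T y > 0 \<and>
    (\<exists>ds. (s has_derivative ds) (at y) \<and> (\<forall>h. T y * ds h = fst h - \<mu> y * snd h)) \<and>
    T y * s y = fst y + p y - \<mu> y * snd y)"

definition thermo_field :: "(real \<times> real \<Rightarrow> real) \<Rightarrow> ((real^'n) \<times> real \<Rightarrow> real) \<Rightarrow>
    ((real^'n) \<times> real \<Rightarrow> real) \<Rightarrow> (real^'n) \<times> real \<Rightarrow> real"
  where "thermo_field h u \<rho> z = h (u z, \<rho> z)"

definition resolved :: "((real^'n) \<times> real \<Rightarrow> real) \<Rightarrow> real \<Rightarrow> (real \<times> real \<Rightarrow> real) \<Rightarrow>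
    ((real^'n) \<times> real \<Rightarrow> real) \<Rightarrow> ((real^'n) \<times> real \<Rightarrow> real) \<Rightarrow> (real^'n) \<times> real \<Rightarrow> real"
  where "resolved G l h u \<rho> z = h (avg G l u z, avg G l \<rho> z)"

definition beta :: "(real \<times> real \<Rightarrow> real) \<Rightarrow> real \<times> real \<Rightarrow> real"
  where "beta T y = 1 / T y"

definition lam :: "(real \<times> real \<Rightarrow> real) \<Rightarrow> (real \<times> real \<Rightarrow> real) \<Rightarrow> real \<times> real \<Rightarrow> real"
  where "lam T \<mu> y = \<mu> y / T y"

definition kinetic :: "((real^'n) \<times> real \<Rightarrow> real) \<Rightarrow> ((real^'n) \<times> real \<Rightarrow> real^'n) \<Rightarrow>
    (real^'n) \<times> real \<Rightarrow> real"
  where "kinetic \<rho> v z = 1/2 * \<rho> z * (norm (v z))\<^sup>2"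

definition euler_weak :: "space_kind \<Rightarrow> ereal \<Rightarrow> (real \<times> real \<Rightarrow> real) \<Rightarrow> ((real^'n) \<times> real \<Rightarrow> real) \<Rightarrow>
    ((real^'n) \<times> real \<Rightarrow> real) \<Rightarrow> ((real^'n::finite) \<times> real \<Rightarrow> real^'n) \<Rightarrow> bool"
  where "euler_weak \<Omega> ts p u \<rho> v \<longleftrightarrow>
    (let P = thermo_field p u \<rho>; E = (\<lambda>z. kinetic \<rho> v z + u z) in
     \<forall>\<phi>. test_fun \<Omega> ts \<phi> \<longrightarrow>
      ddt (reg \<Omega> ts \<rho>) \<phi> + ddiv \<Omega> ts (\<lambda>z. \<rho> z *\<^sub>R v z) \<phi> = 0 \<and>
      (\<forall>i. ddt (reg \<Omega> ts (\<lambda>z. \<rho> z * v z $ i)) \<phi>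
        + (\<Sum>j\<in>UNIV. ddx j (reg \<Omega> ts
            (\<lambda>z. \<rho> z * v z $ i * v z $ j + (if i = j then P z else 0))) \<phi>) = 0) \<and>
      ddt (reg \<Omega> ts E) \<phi> + ddiv \<Omega> ts (\<lambda>z. (P z + E z) *\<^sub>R v z) \<phi> = 0)"

definition Qflux :: "((real^'n) \<times> real \<Rightarrow> real) \<Rightarrow> real \<Rightarrow> (real \<times> real \<Rightarrow> real) \<Rightarrow>
    ((real^'n) \<times> real \<Rightarrow> real) \<Rightarrow> ((real^'n) \<times> real \<Rightarrow> real) \<Rightarrow> ((real^'n::finite) \<times> real \<Rightarrow> real^'n) \<Rightarrow>
    (real^'n) \<times> real \<Rightarrow> real"
  where "Qflux G l p u \<rho> v z =
    (\<Sum>i\<in>UNIV. dx i (avg G l (thermo_field p u \<rho>)) z / avg G l \<rho> z * tau G l \<rho> (\<lambda>w. v w $ i) z)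
    - avg G l \<rho> z * (\<Sum>i\<in>UNIV. \<Sum>j\<in>UNIV. dx i (favre G l \<rho> (\<lambda>w. v w $ j)) z
        * ftau2 G l \<rho> (\<lambda>w. v w $ i) (\<lambda>w. v w $ j) z)"

definition kflux :: "((real^'n) \<times> real \<Rightarrow> real) \<Rightarrow> real \<Rightarrow>
    ((real^'n) \<times> real \<Rightarrow> real) \<Rightarrow> ((real^'n::finite) \<times> real \<Rightarrow> real^'n) \<Rightarrow> (real^'n) \<times> real \<Rightarrow> real"
  where "kflux G l \<rho> v z =
    1/2 * avg G l \<rho> z * (\<Sum>i\<in>UNIV. ftau2 G l \<rho> (\<lambda>w. v w $ i) (\<lambda>w. v w $ i) z)"

definition Jk :: "((real^'n) \<times> real \<Rightarrow> real) \<Rightarrow> real \<Rightarrow> (real \<times> real \<Rightarrow> real) \<Rightarrow>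
    ((real^'n) \<times> real \<Rightarrow> real) \<Rightarrow> ((real^'n) \<times> real \<Rightarrow> real) \<Rightarrow> ((real^'n::finite) \<times> real \<Rightarrow> real^'n) \<Rightarrow>
    (real^'n) \<times> real \<Rightarrow> real^'n"
  where "Jk G l p u \<rho> v z = (\<chi> j.
    1/2 * avg G l \<rho> z * (\<Sum>i\<in>UNIV. ftau2 G l \<rho> (\<lambda>w. v w $ i) (\<lambda>w. v w $ i) z)
      * favre G l \<rho> (\<lambda>w. v w $ j) z
    + tau G l (thermo_field p u \<rho>) (\<lambda>w. v w $ j) z
    + 1/2 * avg G l \<rho> z
      * (\<Sum>i\<in>UNIV. ftau3 G l \<rho> (\<lambda>w. v w $ i) (\<lambda>w. v w $ i) (\<lambda>w. v w $ j) z))"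

definition Iflux :: "space_kind \<Rightarrow> ereal \<Rightarrow> ((real^'n) \<times> real \<Rightarrow> real) \<Rightarrow> real \<Rightarrow>
    (real \<times> real \<Rightarrow> real) \<Rightarrow> (real \<times> real \<Rightarrow> real) \<Rightarrow>
    ((real^'n) \<times> real \<Rightarrow> real) \<Rightarrow> ((real^'n) \<times> real \<Rightarrow> real) \<Rightarrow> ((real^'n::finite) \<times> real \<Rightarrow> real^'n) \<Rightarrow>
    (real^'n) \<times> real \<Rightarrow> real"
  where "Iflux \<Omega> ts G l T p u \<rho> v z =
    resolved G l (beta T) u \<rho> z * (avg G l (thermo_field p u \<rho>) z - resolved G l p u \<rho> z)
      * distr_avg \<Omega> G l (ddiv \<Omega> ts v) z"

definition Sflux :: "((real^'n) \<times> real \<Rightarrow> real) \<Rightarrow> real \<Rightarrow>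
    (real \<times> real \<Rightarrow> real) \<Rightarrow> (real \<times> real \<Rightarrow> real) \<Rightarrow>
    ((real^'n) \<times> real \<Rightarrow> real) \<Rightarrow> ((real^'n) \<times> real \<Rightarrow> real) \<Rightarrow> ((real^'n::finite) \<times> real \<Rightarrow> real^'n) \<Rightarrow>
    (real^'n) \<times> real \<Rightarrow> real"
  where "Sflux G l T \<mu> u \<rho> v z =
    (\<Sum>i\<in>UNIV. dx i (resolved G l (beta T) u \<rho>) z * tau G l u (\<lambda>w. v w $ i) z)
    - (\<Sum>i\<in>UNIV. dx i (resolved G l (lam T \<mu>) u \<rho>) z * tau G l \<rho> (\<lambda>w. v w $ i) z)"

definition Sflux_star :: "((real^'n) \<times> real \<Rightarrow> real) \<Rightarrow> real \<Rightarrow>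
    (real \<times> real \<Rightarrow> real) \<Rightarrow> (real \<times> real \<Rightarrow> real) \<Rightarrow> (real \<times> real \<Rightarrow> real) \<Rightarrow>
    ((real^'n) \<times> real \<Rightarrow> real) \<Rightarrow> ((real^'n) \<times> real \<Rightarrow> real) \<Rightarrow> ((real^'n::finite) \<times> real \<Rightarrow> real^'n) \<Rightarrow>
    (real^'n) \<times> real \<Rightarrow> real"
  where "Sflux_star G l T \<mu> p u \<rho> v z =
    Sflux G l T \<mu> u \<rho> v z + resolved G l (beta T) u \<rho> z * Qflux G l p u \<rho> v z
    + dt (resolved G l (beta T) u \<rho>) z * kflux G l \<rho> v z
    + (\<Sum>i\<in>UNIV. dx i (resolved G l (beta T) u \<rho>) z * Jk G l p u \<rho> v z $ i)"

definition Sinert_star :: "space_kind \<Rightarrow> ereal \<Rightarrow> ((real^'n) \<times> real \<Rightarrow> real) \<Rightarrow> real \<Rightarrow>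
    (real \<times> real \<Rightarrow> real) \<Rightarrow> (real \<times> real \<Rightarrow> real) \<Rightarrow> (real \<times> real \<Rightarrow> real) \<Rightarrow>
    ((real^'n) \<times> real \<Rightarrow> real) \<Rightarrow> ((real^'n) \<times> real \<Rightarrow> real) \<Rightarrow> ((real^'n::finite) \<times> real \<Rightarrow> real^'n) \<Rightarrow>
    (real^'n) \<times> real \<Rightarrow> real"
  where "Sinert_star \<Omega> ts G l T \<mu> p u \<rho> v z =
    - Iflux \<Omega> ts G l T p u \<rho> v z + Sflux_star G l T \<mu> p u \<rho> v z"

end

theory Submission
  imports Defs
begin

text \<open>Testing the weak equations with translated kernels gives pointwise equations for the averages.
  They imply that the average of \<open>p\<close> times the average of \<open>\<Theta>\<close>, minus \<^const>\<open>Qflux\<close>, is the space-time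
  divergence of the kinetic energy of the Favre averaged flow and its flux, and that \<^const>\<open>Sinert_star\<close>
  is the space-time divergence of the resolved entropy plus \<open>1 / T\<close> times the subscale kinetic energy and
  of a flux. Integrating by parts against a test function leaves only locally Lipschitz functions of
  averages. Averages are uniformly bounded, stay in the closed convex hull of the essential range, and
  converge locally in \<open>L\<^sup>1\<close>, so these functions converge too, and the subscale terms tend to zero. The
  limits are the left-hand sides of the balance equations, which do not involve the mollifier.\<close>

section \<open>Partial derivatives\<close>

text \<open>\<open>Qflux\<close> and \<open>Sinert_star\<close> contain derivatives of averages,
  which for bounded fields may grow like 1/l, multiplied by subscale terms that tend to zero at no
  known rate. The products cannot be estimated, so everything rests on exact identities that pull
  the derivatives to the outside. For the entropy this means replacing 1/T times the difference of
  \<open>Qflux\<close> and the mean pressure work by means of the balance of subscale kinetic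
  energy, which is averaged total energy minus resolved kinetic energy. The identities hold only at
  times farther than l from the ends of the time interval; compact support of the test function
  makes this enough for small l. Test functions on the torus are periodic while kernels have compact
  support in the covering space, so pairings over one cell are unfolded into integrals over the
  whole space. The fields are given only up to null sets: they are replaced by bounded Borel
  functions before Fubini and differentiation under the integral are applied, and completeness of
  Lebesgue measure carries measurability back.\<close>

lemma pd_eqI: "(f has_derivative f') (at z) \<Longrightarrow> pd b f z = f' b"
  unfolding pd_def by (metis frechet_derivative_at)

lemma pd_has_derivative: "f differentiable (at z) \<Longrightarrow> (f has_derivative (\<lambda>b. pd b f z)) (at z)"
  unfolding pd_def using frechet_derivative_works by (metis (no_types, lifting) ext)

lemma pd_const [simp]: "pd b (\<lambda>_. c) z = 0"
  by (rule pd_eqI[where f' = "\<lambda>_. 0"]) simp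

lemma pd_add: "f differentiable (at z) \<Longrightarrow> g differentiable (at z) \<Longrightarrow>
    pd b (\<lambda>x. f x + g x) z = pd b f z + pd b g z"
  by (rule pd_eqI) (intro has_derivative_add pd_has_derivative)

lemma pd_diff: "f differentiable (at z) \<Longrightarrow> g differentiable (at z) \<Longrightarrow>
    pd b (\<lambda>x. f x - g x) z = pd b f z - pd b g z"
  by (rule pd_eqI) (intro has_derivative_diff pd_has_derivative)

lemma pd_mult: "f differentiable (at z) \<Longrightarrow> g differentiable (at z) \<Longrightarrow>
    pd b (\<lambda>x. f x * g x) z = f z * pd b g z + pd b f z * g z"
  by (rule pd_eqI[where f' = "\<lambda>b. f z * pd b g z + pd b f z * g z"])
    (intro has_derivative_mult pd_has_derivative)

lemma pd_cmult: "f differentiable (at z) \<Longrightarrow> pd b (\<lambda>x. c * f x) z = c * pd b f z"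
  by (simp add: pd_mult)

lemma pd_sum: "finite I \<Longrightarrow> (\<And>i. i \<in> I \<Longrightarrow> f i differentiable (at z)) \<Longrightarrow>
    pd b (\<lambda>x. \<Sum>i\<in>I. f i x) z = (\<Sum>i\<in>I. pd b (f i) z)"
  by (rule pd_eqI) (intro has_derivative_sum pd_has_derivative)

text \<open>\<open>frechet_derivative\<close> chooses among the derivatives at z, and functions that
  agree near z have the same ones; so even the value at a point of non-differentiability is the
  same.\<close>

lemma pd_cong_open:
  assumes "open V" "z \<in> V" "\<And>x. x \<in> V \<Longrightarrow> f x = g x"
  shows "pd b f z = pd b g z"
proof -
  have "(f has_derivative f') (at z) = (g has_derivative f') (at z)" for f'
    using has_derivative_transform_within_open[of f f' z UNIV V g]
      has_derivative_transform_within_open[of g f' z UNIV V f] assms by auto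
  thus ?thesis unfolding pd_def frechet_derivative_def by presburger
qed

lemma differentiable_cong_open:
  assumes "open V" "z \<in> V" "\<And>x. x \<in> V \<Longrightarrow> f x = g x" "g differentiable (at z)"
  shows "f differentiable (at z)"
  using assms has_derivative_transform_within_open[of g _ z UNIV V f]
  unfolding differentiable_def by metis

lemma pds_single: "pds [b] f = pd b f"
  by (rule ext) simp

section \<open>Continuously differentiable functions\<close>

text \<open>Continuity of f, the clause for the empty list, follows from differentiability; what
  remains are the empty list for differentiability and the one-element lists for continuity.\<close>

lemma Ck_on_1: "Ck_on (Suc 0) V f \<longleftrightarrow>
    (\<forall>z\<in>V. f differentiable (at z)) \<and> (\<forall>b\<in>Basis. continuous_on V (pd b f))"
proof
  assume *: "Ck_on (Suc 0) V f"
  have "\<forall>z\<in>V. pds [] f differentiable (at z)"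
    using * unfolding Ck_on_def by fastforce
  moreover have "continuous_on V (pds [b] f)" if "b \<in> Basis" for b
    using * that unfolding Ck_on_def by (metis One_nat_def empty_set empty_subsetI insert_subset
       le_refl length_Cons list.size(3) list.simps(15))
  ultimately show "(\<forall>z\<in>V. f differentiable (at z)) \<and> (\<forall>b\<in>Basis. continuous_on V (pd b f))"
    by (simp add: pds_single)
next
  assume *: "(\<forall>z\<in>V. f differentiable (at z)) \<and> (\<forall>b\<in>Basis. continuous_on V (pd b f))"
  hence c: "continuous_on V f"
    by (simp add: continuous_at_imp_continuous_on differentiable_imp_continuous_within)
  thus "Ck_on (Suc 0) V f" unfolding Ck_on_def using * c
    by (auto simp: less_Suc_eq le_Suc_eq length_Suc_conv pds_single simp del: pds.simps(2))
qed

lemma Ck_on_1D: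
  assumes "Ck_on (Suc 0) V f"
  shows "z \<in> V \<Longrightarrow> f differentiable (at z)" "b \<in> Basis \<Longrightarrow> continuous_on V (pd b f)"
    "continuous_on V f"
  using assms unfolding Ck_on_1
  by (auto simp: continuous_at_imp_continuous_on differentiable_imp_continuous_within)

lemma Ck_on_le: "Ck_on n V f \<Longrightarrow> m \<le> n \<Longrightarrow> Ck_on m V f"
  unfolding Ck_on_def by (meson order_less_le_trans order_trans)

lemma Ck_on_subset: "Ck_on n V f \<Longrightarrow> W \<subseteq> V \<Longrightarrow> Ck_on n W f"
  unfolding Ck_on_def by (meson continuous_on_subset subsetD)

lemma C1_cong:
  assumes "open V" "\<And>z. z \<in> V \<Longrightarrow> f z = g z" "Ck_on (Suc 0) V g"
  shows "Ck_on (Suc 0) V f"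
  unfolding Ck_on_1
proof (intro conjI ballI)
  show "f differentiable (at z)" if "z \<in> V" for z
    using assms that Ck_on_1D(1)[OF assms(3) that] by (metis differentiable_cong_open)
  show "continuous_on V (pd b f)" if "b \<in> Basis" for b
    using Ck_on_1D(2)[OF assms(3) that] pd_cong_open[OF assms(1)] assms(2)
    by (metis (mono_tags, lifting) continuous_on_cong)
qed

lemma C1_const: "Ck_on (Suc 0) V (\<lambda>_. c)"
  unfolding Ck_on_1 by (auto simp: pd_const[abs_def])

lemma C1_add: assumes "Ck_on (Suc 0) V f" "Ck_on (Suc 0) V g" shows "Ck_on (Suc 0) V (\<lambda>z. f z + g z)"
  unfolding Ck_on_1
proof (intro conjI ballI)
  show "continuous_on V (pd b (\<lambda>z. f z + g z))" if "b \<in> Basis" for b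
    using continuous_on_add[OF Ck_on_1D(2)[OF assms(1) that] Ck_on_1D(2)[OF assms(2) that]]
    by (rule continuous_on_eq) (simp add: pd_add Ck_on_1D(1)[OF assms(1)] Ck_on_1D(1)[OF assms(2)])
qed (intro derivative_intros Ck_on_1D[OF assms(1)] Ck_on_1D[OF assms(2)])

lemma C1_mult: assumes "Ck_on (Suc 0) V f" "Ck_on (Suc 0) V g" shows "Ck_on (Suc 0) V (\<lambda>z. f z * g z)"
  unfolding Ck_on_1
proof (intro conjI ballI)
  show "continuous_on V (pd b (\<lambda>z. f z * g z))" if b: "b \<in> Basis" for b
  proof (rule continuous_on_eq)
    show "continuous_on V (\<lambda>z. f z * pd b g z + pd b f z * g z)"
      using b assms by (intro continuous_intros Ck_on_1D)
  qed (simp add: pd_mult Ck_on_1D(1)[OF assms(1)] Ck_on_1D(1)[OF assms(2)])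
qed (intro derivative_intros Ck_on_1D[OF assms(1)] Ck_on_1D[OF assms(2)])

lemma C1_diff: assumes "Ck_on (Suc 0) V f" "Ck_on (Suc 0) V g" shows "Ck_on (Suc 0) V (\<lambda>z. f z - g z)"
  using C1_add[OF assms(1) C1_mult[OF C1_const[of _ "-1"] assms(2)]] by simp

lemma C1_sum: "(\<And>i. i \<in> I \<Longrightarrow> Ck_on (Suc 0) V (f i)) \<Longrightarrow> Ck_on (Suc 0) V (\<lambda>z. \<Sum>i\<in>I. f i z)"
  by (induction I rule: infinite_finite_induct) (auto intro: C1_add C1_const)

lemma C1_inverse:
  assumes f: "Ck_on (Suc 0) V f" and nz: "\<And>z. z \<in> V \<Longrightarrow> f z \<noteq> 0"
  shows "Ck_on (Suc 0) V (\<lambda>z. 1 / f z)"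
  unfolding Ck_on_1
proof (intro conjI ballI)
  have *: "((\<lambda>z. 1 / f z) has_derivative (\<lambda>b. - pd b f z / (f z)\<^sup>2)) (at z)" if "z \<in> V" for z
    using pd_has_derivative[OF Ck_on_1D(1)[OF f that]] nz[OF that]
    by (auto intro!: derivative_eq_intros simp: power2_eq_square field_simps)
  show "(\<lambda>z. 1 / f z) differentiable (at z)" if "z \<in> V" for z
    using *[OF that] differentiable_def by blast
  show "continuous_on V (pd b (\<lambda>z. 1 / f z))" if b: "b \<in> Basis" for b
  proof (rule continuous_on_eq)
    show "continuous_on V (\<lambda>z. - pd b f z / (f z)\<^sup>2)"
      using b f nz by (intro continuous_intros Ck_on_1D) auto
    show "- pd b f z / (f z)\<^sup>2 = pd b (\<lambda>z. 1 / f z) z" if "z \<in> V" for z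
      using pd_eqI[OF *[OF that], of b] by simp
  qed
qed

lemma C1_divide:
  assumes "Ck_on (Suc 0) V f" "Ck_on (Suc 0) V g" "\<And>z. z \<in> V \<Longrightarrow> g z \<noteq> 0"
  shows "Ck_on (Suc 0) V (\<lambda>z. f z / g z)"
  using C1_mult[OF assms(1) C1_inverse[OF assms(2,3)]] by simp

lemma has_derivative_compose_pair:
  fixes h :: "real \<times> real \<Rightarrow> real"
  assumes f: "f differentiable (at z)" and g: "g differentiable (at z)"
    and h: "(h has_derivative h') (at (f z, g z))"
  shows "((\<lambda>z. h (f z, g z)) has_derivative (\<lambda>b. h' (pd b f z, pd b g z))) (at z)"
  using has_derivative_compose[OF has_derivative_Pair[OF pd_has_derivative[OF f] pd_has_derivative[OF g]] h]
  by simp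

text \<open>Linearity of the derivative of h expands the direction
  \<open>(pd b f z, pd b g z)\<close> in the two coordinate directions, the only ones for which
  continuity of the derivatives of h is given.\<close>

lemma C1_compose_pair:
  fixes h :: "real \<times> real \<Rightarrow> real"
  assumes h: "Ck_on (Suc 0) U h" and f: "Ck_on (Suc 0) V f" and g: "Ck_on (Suc 0) V g"
    and U: "\<And>z. z \<in> V \<Longrightarrow> (f z, g z) \<in> U"
  shows "Ck_on (Suc 0) V (\<lambda>z. h (f z, g z))"
  unfolding Ck_on_1
proof (intro conjI ballI)
  have *: "((\<lambda>z. h (f z, g z)) has_derivative
      (\<lambda>b. pd b f z * pd (1,0) h (f z, g z) + pd b g z * pd (0,1) h (f z, g z))) (at z)"
    if "z \<in> V" for z
  proof -
    have d: "(h has_derivative (\<lambda>b. pd b h (f z, g z))) (at (f z, g z))"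
      using pd_has_derivative Ck_on_1D(1)[OF h U[OF that]] by blast
    interpret bounded_linear "\<lambda>b. pd b h (f z, g z)"
      using has_derivative_bounded_linear[OF d] .
    have lin: "pd (x, y) h (f z, g z) = x * pd (1,0) h (f z, g z) + y * pd (0,1) h (f z, g z)" for x y
      using add[of "x *\<^sub>R (1,0)" "y *\<^sub>R (0,1)"] scaleR[of x "(1,0)"] scaleR[of y "(0,1)"] by simp
    show ?thesis
      using has_derivative_compose_pair[OF Ck_on_1D(1)[OF f that] Ck_on_1D(1)[OF g that] d]
      by (subst (asm) lin)
  qed
  show "(\<lambda>z. h (f z, g z)) differentiable (at z)" if "z \<in> V" for z
    using *[OF that] differentiable_def by blast
  show "continuous_on V (pd b (\<lambda>z. h (f z, g z)))" if b: "b \<in> Basis" for b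
  proof (rule continuous_on_eq)
    have p: "continuous_on V (\<lambda>z. (f z, g z))"
      by (intro continuous_on_Pair Ck_on_1D(3)[OF f] Ck_on_1D(3)[OF g])
    have c: "continuous_on V (\<lambda>z. pd c h (f z, g z))" if "c \<in> Basis" for c
      by (rule continuous_on_compose2[OF Ck_on_1D(2)[OF h that] p]) (use U in blast)
    show "continuous_on V (\<lambda>z. pd b f z * pd (1,0) h (f z, g z) + pd b g z * pd (0,1) h (f z, g z))"
      by (intro continuous_on_add continuous_on_mult Ck_on_1D(2)[OF f b] Ck_on_1D(2)[OF g b] c)
        (auto simp: Basis_prod_def)
    show "pd b f z * pd (1,0) h (f z, g z) + pd b g z * pd (0,1) h (f z, g z)
        = pd b (\<lambda>z. h (f z, g z)) z" if "z \<in> V" for z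
      using pd_eqI[OF *[OF that], of b] by simp
  qed
qed

section \<open>Smooth functions\<close>

text \<open>Continuity of an iterated derivative follows from its own differentiability, which is
  always available because no order is the last one.\<close>

lemma smooth_iff: "smooth f \<longleftrightarrow> (\<forall>bs z. set bs \<subseteq> Basis \<longrightarrow> pds bs f differentiable (at z))"
proof
  assume "smooth f"
  thus "\<forall>bs z. set bs \<subseteq> Basis \<longrightarrow> pds bs f differentiable (at z)"
    unfolding smooth_def Ck_on_def by (metis UNIV_I lessI)
next
  assume *: "\<forall>bs z. set bs \<subseteq> Basis \<longrightarrow> pds bs f differentiable (at z)"
  hence "continuous_on UNIV (pds bs f)" if "set bs \<subseteq> Basis" for bs
    using that by (auto simp: continuous_at_imp_continuous_on differentiable_imp_continuous_within)
  with * show "smooth f" unfolding smooth_def Ck_on_def by auto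
qed

lemma pds_append: "pds (bs @ cs) f = pds bs (pds cs f)"
  by (induction bs) auto

lemma smooth_pd: "smooth f \<Longrightarrow> b \<in> Basis \<Longrightarrow> smooth (pd b f)"
  unfolding smooth_iff pds_single[symmetric] pds_append[symmetric] by auto

lemma smooth_C1: "smooth f \<Longrightarrow> Ck_on (Suc 0) V f"
  unfolding smooth_def using Ck_on_subset by blast

lemma smooth_continuous: "smooth f \<Longrightarrow> continuous_on V f"
  using smooth_C1 Ck_on_1D(3) by blast

lemma smooth_differentiable: "smooth f \<Longrightarrow> f differentiable (at z)"
  using smooth_C1 Ck_on_1D(1) by blast

text \<open>Each derivative of the composition with a dilation brings out one more factor a, which
  accounts for the power \<open>length bs\<close>.\<close>

lemma pds_affine:
  assumes "smooth f" "set bs \<subseteq> Basis"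
  shows "pds bs (\<lambda>z. c * f (a *\<^sub>R z + y)) = (\<lambda>z. (a ^ length bs * c) * pds bs f (a *\<^sub>R z + y))"
  using assms(2)
proof (induction bs)
  case (Cons b bs)
  have d: "pds bs f differentiable (at w)" for w
    using assms(1) Cons.prems by (auto simp: smooth_iff)
  have "((\<lambda>z. (a ^ length bs * c) * pds bs f (a *\<^sub>R z + y)) has_derivative
      (\<lambda>b. (a ^ length bs * c) * pd (a *\<^sub>R b) (pds bs f) (a *\<^sub>R z + y))) (at z)" for z
    by (intro has_derivative_mult_right has_derivative_compose[OF _ pd_has_derivative[OF d]])
      (auto intro!: derivative_eq_intros)
  moreover have "pd (a *\<^sub>R b) (pds bs f) w = a * pd b (pds bs f) w" for w
    using linear_scale[OF has_derivative_linear[OF pd_has_derivative[OF d[of w]]], of a b] by simp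
  ultimately show ?case using Cons
    by (intro ext) (auto intro!: pd_eqI[THEN trans])
qed simp

lemma smooth_affine:
  assumes "smooth f" shows "smooth (\<lambda>z. c * f (a *\<^sub>R z + y))"
  unfolding smooth_iff
proof (intro allI impI)
  fix bs :: "'a list" and z assume bs: "set bs \<subseteq> Basis"
  have d: "((\<lambda>z. a *\<^sub>R z + y) has_derivative (\<lambda>b. a *\<^sub>R b)) (at z)"
    by (auto intro!: derivative_eq_intros)
  have "pds bs f differentiable (at (a *\<^sub>R z + y))"
    using assms bs unfolding smooth_iff by blast
  from has_derivative_mult_right[OF has_derivative_compose[OF d pd_has_derivative[OF this]]]
  show "pds bs (\<lambda>z. c * f (a *\<^sub>R z + y)) differentiable (at z)"
    unfolding pds_affine[OF assms bs] differentiable_def by blast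
qed

lemma smooth_translate: "smooth f \<Longrightarrow> smooth (\<lambda>z. f (z + y))"
  using smooth_affine[of f 1 1 y] by simp

lemma pd_translate:
  assumes "f differentiable (at (z + y))" shows "pd b (\<lambda>z. f (z + y)) z = pd b f (z + y)"
proof (rule pd_eqI)
  have "((\<lambda>z. z + y) has_derivative (\<lambda>b. b)) (at z)"
    by (auto intro!: derivative_eq_intros)
  from has_derivative_compose[OF this pd_has_derivative[OF assms]]
  show "((\<lambda>z. f (z + y)) has_derivative (\<lambda>b. pd b f (z + y))) (at z)" .
qed

lemma pds_cong_open:
  assumes "open V" "\<And>x. x \<in> V \<Longrightarrow> f x = g x"
  shows "z \<in> V \<Longrightarrow> pds bs f z = pds bs g z"
proof (induction bs arbitrary: z)
  case (Cons b bs)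
  show ?case unfolding pds.simps
    by (rule pd_cong_open[OF assms(1) Cons.prems Cons.IH])
qed (use assms in auto)

text \<open>Differentiability of all iterated derivatives is a local property. This serves the
  periodized kernel, which only near each point is given by a fixed finite sum.\<close>

lemma smooth_local:
  assumes "\<And>z. \<exists>V g. open V \<and> z \<in> V \<and> smooth g \<and> (\<forall>x\<in>V. f x = g x)"
  shows "smooth f"
  unfolding smooth_iff
proof (intro allI impI)
  fix bs :: "'a list" and z assume bs: "set bs \<subseteq> Basis"
  from assms[of z] obtain V g
    where "open V \<and> z \<in> V \<and> smooth g \<and> (\<forall>x\<in>V. f x = g x)" by (elim exE)
  hence V: "open V" "z \<in> V" "smooth g" "\<And>x. x \<in> V \<Longrightarrow> f x = g x" by simp_all
  have *: "pds bs g differentiable (at z)" using V(3) bs by (simp add: smooth_iff)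
  show "pds bs f differentiable (at z)"
    by (rule differentiable_cong_open[OF V(1,2) _ *]) (rule pds_cong_open[OF V(1,4)])
qed

lemma smooth_sum:
  fixes f :: "'i \<Rightarrow> 'a::euclidean_space \<Rightarrow> real"
  assumes "finite I" "\<And>i. i \<in> I \<Longrightarrow> smooth (f i)"
  shows "smooth (\<lambda>z. \<Sum>i\<in>I. f i z)"
proof -
  have *: "pds bs (\<lambda>z. \<Sum>i\<in>I. f i z) = (\<lambda>z. \<Sum>i\<in>I. pds bs (f i) z)" if "set bs \<subseteq> Basis" for bs
    using that
  proof (induction bs)
    case (Cons b bs)
    have "pds bs (f i) differentiable (at z)" if "i \<in> I" for i z
      using assms(2)[OF that] Cons.prems unfolding smooth_iff by simp
    thus ?case using Cons assms(1) by (intro ext) (simp add: pd_sum)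
  qed simp
  show ?thesis unfolding smooth_iff
  proof (intro allI impI)
    fix bs :: "'a list" and z assume bs: "set bs \<subseteq> Basis"
    have "pds bs (f i) differentiable (at z)" if "i \<in> I" for i
      using assms(2)[OF that] bs unfolding smooth_iff by simp
    thus "pds bs (\<lambda>z. \<Sum>i\<in>I. f i z) differentiable (at z)"
      unfolding *[OF bs] using assms(1) by (intro differentiable_sum) auto
  qed
qed

lemma pd_zero_open:
  assumes "closed S" "\<And>z. z \<notin> S \<Longrightarrow> f z = 0" "z \<notin> S"
  shows "pd b f z = 0"
  using pd_cong_open[of "- S" z f "\<lambda>_. 0" b] assms by auto

section \<open>Mollification of bounded Borel functions\<close>

lemma pd_linear:
  fixes g :: "'a::euclidean_space \<Rightarrow> real"
  assumes "g differentiable (at y)"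
  shows "pd h g y = (\<Sum>b\<in>Basis. (h \<bullet> b) * pd b g y)"
proof -
  interpret L: linear "\<lambda>h. pd h g y"
    using has_derivative_linear[OF pd_has_derivative[OF assms]] .
  have "pd h g y = pd (\<Sum>b\<in>Basis. (h \<bullet> b) *\<^sub>R b) g y"
    by (simp add: euclidean_representation)
  also have "\<dots> = (\<Sum>b\<in>Basis. (h \<bullet> b) * pd b g y)"
    by (simp add: L.sum L.scale)
  finally show ?thesis .
qed

lemma compact_support_bounded:
  fixes g :: "'a::euclidean_space \<Rightarrow> real"
  assumes "continuous_on UNIV g" "\<And>w. norm w > r \<Longrightarrow> g w = 0"
  obtains M where "M > 0" "\<And>w. \<bar>g w\<bar> \<le> M"
proof -
  have "bounded (g ` cball 0 r)"
    using assms(1) by (intro compact_imp_bounded compact_continuous_image) (auto intro: continuous_on_subset)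
  then obtain M where M: "M > 0" "\<And>w. w \<in> cball 0 r \<Longrightarrow> \<bar>g w\<bar> \<le> M"
    by (auto simp: bounded_pos)
  have "\<bar>g w\<bar> \<le> M" for w
    using M assms(2)[of w] by (cases "norm w \<le> r") auto
  with M(1) show ?thesis using that by blast
qed

text \<open>Heine-Cantor on the ball of radius r + 1: since d is at most 1, as soon as one point is
  within distance r of the origin both lie in the larger ball; otherwise both values are
  zero.\<close>

lemma compact_support_uniformly_continuous:
  fixes g :: "'a::euclidean_space \<Rightarrow> real"
  assumes "continuous_on UNIV g" "\<And>w. norm w > r \<Longrightarrow> g w = 0" "e > 0"
  obtains d where "0 < d" "d \<le> 1" "\<And>x y. norm (x - y) < d \<Longrightarrow> \<bar>g x - g y\<bar> < e"
proof -
  have "uniformly_continuous_on (cball 0 (r + 1)) g"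
    using assms(1) by (intro compact_uniformly_continuous) (auto intro: continuous_on_subset)
  then obtain d where d: "d > 0" "\<And>x y. x \<in> cball 0 (r + 1) \<Longrightarrow> y \<in> cball 0 (r + 1) \<Longrightarrow>
      norm (x - y) < d \<Longrightarrow> \<bar>g x - g y\<bar> < e"
    using \<open>e > 0\<close> unfolding uniformly_continuous_on_def dist_norm real_norm_def by (metis norm_minus_commute)
  have "\<bar>g x - g y\<bar> < e" if "norm (x - y) < min d 1" for x y
  proof (cases "norm x \<le> r \<or> norm y \<le> r")
    case True
    hence "norm x \<le> r + 1 \<and> norm y \<le> r + 1"
      using that norm_triangle_ineq2[of x y] norm_triangle_ineq2[of y x]
      by (auto simp: norm_minus_commute)
    thus ?thesis using d(2)[of x y] that by auto
  next
    case False
    thus ?thesis using assms by auto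
  qed
  thus ?thesis using that[of "min d 1"] d(1) by auto
qed

section \<open>Regularity of mollified functions\<close>

text \<open>The point z occurs in the kernel alone, so derivatives fall on g and f needs no
  regularity. The integral is over \<open>lborel\<close>, where Fubini is at hand.\<close>

definition mavg :: "('a::euclidean_space \<Rightarrow> real) \<Rightarrow> ('a \<Rightarrow> real) \<Rightarrow> 'a \<Rightarrow> real"
  where "mavg g f z = (\<integral>w. g (w - z) * f w \<partial>lborel)"

definition bounded_borel :: "('a::euclidean_space \<Rightarrow> real) \<Rightarrow> bool"
  where "bounded_borel f \<longleftrightarrow> f \<in> borel_measurable borel \<and> (\<exists>B. \<forall>w. \<bar>f w\<bar> \<le> B)"

lemma bounded_borelE:
  assumes "bounded_borel f"
  obtains B where "f \<in> borel_measurable borel" "B > 0" "\<And>w. \<bar>f w\<bar> \<le> B"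
proof -
  from assms obtain B where "f \<in> borel_measurable borel" and B: "\<And>w. \<bar>f w\<bar> \<le> B"
    unfolding bounded_borel_def by blast
  moreover have "\<bar>f w\<bar> \<le> \<bar>B\<bar> + 1" for w
    using B[of w] by linarith
  moreover have "\<bar>B\<bar> + 1 > 0" by simp
  ultimately show ?thesis using that by metis
qed

text \<open>The crude bound by sup times sup times volume is all that continuity and
  differentiability of \<open>mavg\<close> require: there h is a difference of translates or a
  Taylor remainder of the kernel, uniformly small and supported in a fixed ball.\<close>

lemma support_integrable:
  fixes h :: "'a::euclidean_space \<Rightarrow> real"
  assumes h: "continuous_on UNIV h" "\<And>w. w \<notin> cball z R \<Longrightarrow> h w = 0"
    and c: "\<And>w. \<bar>h w\<bar> \<le> c" and f: "f \<in> borel_measurable borel" "\<And>w. \<bar>f w\<bar> \<le> B"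
  shows "integrable lborel (\<lambda>w. h w * f w)"
    "\<bar>\<integral>w. h w * f w \<partial>lborel\<bar> \<le> c * B * measure lborel (cball z R)"
proof -
  have [measurable]: "h \<in> borel_measurable borel" "f \<in> borel_measurable borel"
    using h(1) f(1) by (auto intro: borel_measurable_continuous_onI)
  have fin: "emeasure lborel (cball z R) < \<infinity>"
    using emeasure_bounded_finite[OF bounded_cball] by auto
  have i: "integrable lborel (\<lambda>w. c * B * indicator (cball z R) w)"
    using fin by (intro integrable_mult_right) (auto intro!: integrable_real_indicator)
  have le: "\<bar>h w * f w\<bar> \<le> c * B * indicator (cball z R) w" for w
  proof (cases "w \<in> cball z R")
    case True
    have "\<bar>h w\<bar> * \<bar>f w\<bar> \<le> c * B"
      using c[of w] f(2)[of w] by (intro mult_mono) auto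
    with True show ?thesis by (simp add: abs_mult)
  qed (simp add: h(2))
  show int: "integrable lborel (\<lambda>w. h w * f w)"
    by (rule Bochner_Integration.integrable_bound[OF i]) (use le in \<open>auto intro: order_trans[OF _ abs_ge_self]\<close>)
  have "\<bar>\<integral>w. h w * f w \<partial>lborel\<bar> \<le> (\<integral>w. \<bar>h w * f w\<bar> \<partial>lborel)"
    by (rule integral_abs_bound)
  also have "\<dots> \<le> (\<integral>w. c * B * indicator (cball z R) w \<partial>lborel)"
    using int i le by (intro integral_mono) auto
  also have "\<dots> = c * B * measure lborel (cball z R)"
    using fin by simp
  finally show "\<bar>\<integral>w. h w * f w \<partial>lborel\<bar> \<le> c * B * measure lborel (cball z R)" .
qed

lemma mavg_integrable:
  assumes g: "continuous_on UNIV g" "\<And>w. norm w > r \<Longrightarrow> g w = 0" and f: "bounded_borel f"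
  shows "integrable lborel (\<lambda>w. g (w - z) * f w)"
proof -
  obtain M where M: "\<And>w. \<bar>g w\<bar> \<le> M" using compact_support_bounded[OF g] by metis
  obtain B where B: "f \<in> borel_measurable borel" "\<And>w. \<bar>f w\<bar> \<le> B" using bounded_borelE[OF f] by metis
  have "continuous_on UNIV (\<lambda>w. g (w - z))"
    by (intro continuous_on_compose2[OF g(1)] continuous_intros) auto
  from support_integrable(1)[OF this _ M B, of z r] show ?thesis
    using g(2) by (auto simp: dist_norm norm_minus_commute)
qed

lemma mavg_continuous:
  fixes g :: "'a::euclidean_space \<Rightarrow> real"
  assumes g: "continuous_on UNIV g" "\<And>w. norm w > r \<Longrightarrow> g w = 0" and f: "bounded_borel f"
  shows "continuous_on UNIV (mavg g f)"
  unfolding continuous_on_iff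
proof (intro ballI allI impI)
  fix z :: 'a and e :: real assume e: "0 < e"
  obtain B where B: "f \<in> borel_measurable borel" "B > 0" "\<And>w. \<bar>f w\<bar> \<le> B" using bounded_borelE[OF f] by metis
  define V where "V = measure lborel (cball z (r + 1))"
  have V: "V \<ge> 0" unfolding V_def by simp
  \<comment> \<open>The factor 2 and the added 1 make \<open>e' * B * V\<close> strictly smaller
    than e and keep the denominator positive.\<close>
  define e' where "e' = e / (2 * (B * V + 1))"
  have e': "e' > 0" unfolding e'_def using e B V by (auto intro!: divide_pos_pos add_nonneg_pos)
  obtain d where d: "0 < d" "d \<le> 1" "\<And>x y. norm (x - y) < d \<Longrightarrow> \<bar>g x - g y\<bar> < e'"
    using compact_support_uniformly_continuous[OF g e'] by metis
  have "dist (mavg g f z') (mavg g f z) < e" if z': "dist z' z < d" for z'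
  proof -
    have c: "continuous_on UNIV (\<lambda>w. g (w - z') - g (w - z))"
      by (intro continuous_intros continuous_on_compose2[OF g(1)]) auto
    have s: "g (w - z') - g (w - z) = 0" if "w \<notin> cball z (r + 1)" for w
    proof -
      have "norm (w - z) > r + 1" using that by (auto simp: dist_norm norm_minus_commute)
      moreover have "norm (w - z) \<le> norm (w - z') + norm (z' - z)"
        using norm_triangle_ineq[of "w - z'" "z' - z"] by simp
      ultimately show ?thesis using z' d(2) g(2)[of "w - z"] g(2)[of "w - z'"] by (auto simp: dist_norm)
    qed
    have b: "\<bar>g (w - z') - g (w - z)\<bar> \<le> e'" for w
      using d(3)[of "w - z'" "w - z"] z' by (auto simp: dist_norm norm_minus_commute)
    have "mavg g f z' - mavg g f z = (\<integral>w. (g (w - z') - g (w - z)) * f w \<partial>lborel)"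
      unfolding mavg_def left_diff_distrib
      by (intro Bochner_Integration.integral_diff[symmetric] mavg_integrable[OF g f])
    hence "\<bar>mavg g f z' - mavg g f z\<bar> \<le> e' * B * V"
      using support_integrable(2)[OF c s b B(1,3)] unfolding V_def by simp
    also have "\<dots> = e * (B * V / (2 * (B * V + 1)))" unfolding e'_def by simp
    also have "\<dots> < e * 1"
    proof (rule mult_strict_left_mono[OF _ e])
      have "0 \<le> B * V" using B(2) V by simp
      moreover have "x / (2 * (x + 1)) < 1" if "0 \<le> x" for x :: real
        using that by (simp add: divide_less_eq)
      ultimately show "B * V / (2 * (B * V + 1)) < 1" by blast
    qed
    finally show ?thesis by (simp add: dist_norm)
  qed
  with d(1) show "\<exists>d>0. \<forall>x'\<in>UNIV. dist x' z < d \<longrightarrow> dist (mavg g f x') (mavg g f z) < e" by blast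
qed

lemma smooth_pd_support:
  assumes "\<And>w. norm w > r \<Longrightarrow> g w = 0" "norm w > r"
  shows "pd b g w = 0"
  using pd_zero_open[of "cball 0 r" g w b] assms by auto

text \<open>Differentiation under the integral: the Taylor remainder of the kernel is small compared
  with \<open>norm (y - z)\<close>, uniformly in the integration variable, because the partial
  derivatives of g are uniformly continuous. The minus sign arises because z enters as w -
  z.\<close>

lemma mavg_has_derivative:
  fixes g :: "'a::euclidean_space \<Rightarrow> real"
  assumes g: "smooth g" "\<And>w. norm w > r \<Longrightarrow> g w = 0" and f: "bounded_borel f"
  shows "(mavg g f has_derivative (\<lambda>h. \<Sum>b\<in>Basis. (h \<bullet> b) * (- mavg (pd b g) f z))) (at z)"
  unfolding has_derivative_at_alt
proof (intro conjI allI impI)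
  show "bounded_linear (\<lambda>h. \<Sum>b\<in>Basis. (h \<bullet> b) * (- mavg (pd b g) f z))"
    by (intro bounded_linear_sum bounded_linear_mult_const bounded_linear_inner_left)
  fix e :: real assume e: "0 < e"
  obtain B where B: "f \<in> borel_measurable borel" "B > 0" "\<And>w. \<bar>f w\<bar> \<le> B" using bounded_borelE[OF f] by metis
  have dg: "continuous_on UNIV (pd b g)" "\<And>w. norm w > r \<Longrightarrow> pd b g w = 0" if "b \<in> Basis" for b
    using smooth_continuous[OF smooth_pd[OF g(1) that]] smooth_pd_support[OF g(2)] by auto
  have gc: "continuous_on UNIV g" by (rule smooth_continuous[OF g(1)])
  define V where "V = measure lborel (cball z (r + 1))"
  have V: "V \<ge> 0" unfolding V_def by simp
  \<comment> \<open>The dimension enters because the remainder is estimated separately in each basis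
    direction.\<close>
  define e' where "e' = e / (real DIM('a) * B * V + 1)"
  have e': "e' > 0" unfolding e'_def using e B V by (auto intro!: divide_pos_pos add_nonneg_pos)
  have "\<exists>d. \<forall>b\<in>Basis. 0 < d b \<and> d b \<le> 1 \<and> (\<forall>x y. norm (x - y) < d b \<longrightarrow> \<bar>pd b g x - pd b g y\<bar> < e')"
    by (rule bchoice) (metis dg compact_support_uniformly_continuous[OF _ _ e'])
  then obtain d where d: "\<And>b. b \<in> Basis \<Longrightarrow> 0 < d b" "\<And>b. b \<in> Basis \<Longrightarrow> d b \<le> 1"
    "\<And>b x y. b \<in> Basis \<Longrightarrow> norm (x - y) < d b \<Longrightarrow> \<bar>pd b g x - pd b g y\<bar> < e'" by metis
  define D where "D = Min (d ` Basis)"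
  have D: "0 < D" "\<And>b. b \<in> Basis \<Longrightarrow> D \<le> d b" unfolding D_def using d(1) by auto
  obtain b0 :: 'a where "b0 \<in> Basis" using nonempty_Basis by blast
  hence D1: "D \<le> 1" using D(2)[of b0] d(2)[of b0] by simp
  have "norm (mavg g f y - mavg g f z - (\<Sum>b\<in>Basis. ((y - z) \<bullet> b) * (- mavg (pd b g) f z)))
      \<le> e * norm (y - z)" if y: "norm (y - z) < D" for y
  proof -
    define h where "h = y - z"
    \<comment> \<open>First-order Taylor remainder of the kernel. The linear term carries a plus
      sign because the argument w - z moves by - h.\<close>
    define k where "k = (\<lambda>w. g (w - y) - g (w - z) + (\<Sum>b\<in>Basis. (h \<bullet> b) * pd b g (w - z)))"
    have kc: "continuous_on UNIV k" unfolding k_def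
      by (intro continuous_intros continuous_on_compose2[OF gc] continuous_on_compose2[OF dg(1)]) auto
    have ks: "k w = 0" if "w \<notin> cball z (r + 1)" for w
    proof -
      have "norm (w - z) > r + 1" using that by (auto simp: dist_norm norm_minus_commute)
      moreover have "norm (w - z) \<le> norm (w - y) + norm (y - z)"
        using norm_triangle_ineq[of "w - y" "y - z"] by simp
      ultimately show ?thesis using y D1 g(2)[of "w - z"] g(2)[of "w - y"] dg(2)[of _ "w - z"]
        unfolding k_def by auto
    qed
    have kb: "\<bar>k w\<bar> \<le> real DIM('a) * (norm h * e')" for w
    proof -
      have der: "((\<lambda>t. g (w - z - t *\<^sub>R h)) has_derivative
          (\<lambda>s. - s * pd h g (w - z - t *\<^sub>R h))) (at t)" for t :: real
      proof -
        have l: "pd (- (s *\<^sub>R h)) g x = - s * pd h g x" for s x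
          using linear_scale[OF has_derivative_linear[OF pd_has_derivative[OF smooth_differentiable[OF g(1)]]], of "- s" h x]
          by simp
        have a: "((\<lambda>t. w - z - t *\<^sub>R h) has_derivative (\<lambda>s. - (s *\<^sub>R h))) (at t)"
          by (auto intro!: derivative_eq_intros)
        show ?thesis
          using has_derivative_compose[OF a pd_has_derivative[OF smooth_differentiable[OF g(1)]]] unfolding l .
      qed
      obtain t where t: "0 < t" "t < 1" and eq: "g (w - z - 1 *\<^sub>R h) - g (w - z - 0 *\<^sub>R h) = - (1 - 0) * pd h g (w - z - t *\<^sub>R h)"
        using mvt[of 0 1 "\<lambda>t. g (w - z - t *\<^sub>R h)" "\<lambda>t s. - s * pd h g (w - z - t *\<^sub>R h)"] der
        by (metis (no_types, lifting) has_derivative_continuous continuous_at_imp_continuous_on zero_less_one)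
      have "k w = (\<Sum>b\<in>Basis. (h \<bullet> b) * (pd b g (w - z) - pd b g (w - z - t *\<^sub>R h)))"
        using eq unfolding k_def h_def
        by (simp add: pd_linear[OF smooth_differentiable[OF g(1)], of "y - z"] right_diff_distrib sum_subtractf)
      also have "\<bar>\<dots>\<bar> \<le> (\<Sum>b\<in>(Basis::'a set). norm h * e')"
      proof (rule order_trans[OF sum_abs sum_mono])
        fix b :: 'a assume b: "b \<in> Basis"
        have "norm (w - z - (w - z - t *\<^sub>R h)) < d b"
        proof -
          have "t * norm h \<le> norm h" using t by (simp add: mult_left_le_one_le)
          thus ?thesis using t y D(2)[OF b] unfolding h_def by simp
        qed
        from d(3)[OF b this] Basis_le_norm[OF b, of h]
        show "\<bar>h \<bullet> b * (pd b g (w - z) - pd b g (w - z - t *\<^sub>R h))\<bar> \<le> norm h * e'"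
          unfolding abs_mult by (intro mult_mono) auto
      qed
      finally show ?thesis by simp
    qed
    have i: "integrable lborel (\<lambda>w. (h \<bullet> b) * (pd b g (w - z) * f w))" if "b \<in> Basis" for b
      using mavg_integrable[OF dg[OF that] f, where z = z] by (intro integrable_mult_right) auto
    have "(\<integral>w. k w * f w \<partial>lborel) = (\<integral>w. g (w - y) * f w - g (w - z) * f w
         + (\<Sum>b\<in>Basis. (h \<bullet> b) * (pd b g (w - z) * f w)) \<partial>lborel)"
      unfolding k_def by (simp add: algebra_simps sum_distrib_left)
    also have "\<dots> = mavg g f y - mavg g f z + (\<Sum>b\<in>Basis. (h \<bullet> b) * mavg (pd b g) f z)"
      unfolding mavg_def using mavg_integrable[OF gc g(2) f] i
      by (simp add: Bochner_Integration.integral_add Bochner_Integration.integral_diff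
         Bochner_Integration.integral_sum integrable_sum)
    finally have "\<bar>mavg g f y - mavg g f z + (\<Sum>b\<in>Basis. (h \<bullet> b) * mavg (pd b g) f z)\<bar>
        \<le> real DIM('a) * (norm h * e') * B * V"
      using support_integrable(2)[OF kc ks kb B(1,3)] unfolding V_def by simp
    also have "\<dots> = e * norm h * ((real DIM('a) * B * V) / (real DIM('a) * B * V + 1))"
      unfolding e'_def by simp
    also have "\<dots> \<le> e * norm h * 1"
    proof (rule mult_left_mono)
      have "0 \<le> real DIM('a) * B * V" using B(2) V by simp
      moreover have "x / (x + 1) \<le> 1" if "0 \<le> x" for x :: real
        using that by (simp add: divide_le_eq)
      ultimately show "real DIM('a) * B * V / (real DIM('a) * B * V + 1) \<le> 1" by blast
    qed (use e in simp)
    finally show ?thesis unfolding h_def by (simp add: sum_negf)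
  qed
  with D(1) show "\<exists>d>0. \<forall>y. norm (y - z) < d \<longrightarrow>
     norm (mavg g f y - mavg g f z - (\<Sum>b\<in>Basis. ((y - z) \<bullet> b) * (- mavg (pd b g) f z))) \<le> e * norm (y - z)"
    by blast
qed

lemma pd_mavg:
  fixes g :: "'a::euclidean_space \<Rightarrow> real"
  assumes g: "smooth g" "\<And>w. norm w > r \<Longrightarrow> g w = 0" and f: "bounded_borel f" and b: "b \<in> Basis"
  shows "pd b (mavg g f) z = - mavg (pd b g) f z"
  using pd_eqI[OF mavg_has_derivative[OF g f], where b = b and z = z] b
  by (simp add: inner_Basis if_distrib[of "\<lambda>x. x * _"] sum.delta' sum_negf cong: if_cong)

lemma mavg_C1:
  assumes g: "smooth g" "\<And>w. norm w > r \<Longrightarrow> g w = 0" and f: "bounded_borel f"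
  shows "Ck_on (Suc 0) UNIV (mavg g f)"
  unfolding Ck_on_1
proof (intro conjI ballI)
  show "mavg g f differentiable (at z)" for z
    using mavg_has_derivative[OF g f] differentiable_def by blast
  show "continuous_on UNIV (pd b (mavg g f))" if b: "b \<in> Basis" for b
  proof (rule continuous_on_eq)
    show "continuous_on UNIV (\<lambda>z. - mavg (pd b g) f z)"
      using mavg_continuous[OF smooth_continuous[OF smooth_pd[OF g(1) b]] smooth_pd_support[OF g(2)] f]
      by (intro continuous_on_minus) auto
  qed (simp add: pd_mavg[OF g f b])
qed

section \<open>Averages with probability kernels\<close>

definition smoothing_kernel :: "real \<Rightarrow> ('a::euclidean_space \<Rightarrow> real) \<Rightarrow> bool"
  where "smoothing_kernel l g \<longleftrightarrow> smooth g \<and> (\<forall>w. 0 \<le> g w) \<and> (\<integral>w. g w \<partial>lborel) = 1 \<and>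
    (\<forall>w. g w \<noteq> 0 \<longrightarrow> norm w \<le> l)"

lemma smoothing_kernelD:
  assumes "smoothing_kernel l g"
  shows "smooth g" "0 \<le> g w" "(\<integral>w. g w \<partial>lborel) = 1" "norm w > l \<Longrightarrow> g w = 0"
    "continuous_on V g" "g \<in> borel_measurable borel"
  using assms unfolding smoothing_kernel_def
  by (auto intro: smooth_continuous borel_measurable_continuous_onI simp: not_le[symmetric])

lemma lborel_integral_translate:
  fixes h :: "'a::euclidean_space \<Rightarrow> real"
  assumes "h \<in> borel_measurable borel"
  shows "(\<integral>w. h (w + z) \<partial>lborel) = (\<integral>w. h w \<partial>lborel)"
proof -
  have "(\<integral>w. h w \<partial>lborel) = (\<integral>w. h w \<partial>distr lborel borel ((+) z))"
    by (simp add: lborel_distr_plus)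
  also have "\<dots> = (\<integral>w. h (w + z) \<partial>lborel)"
    using assms by (subst integral_distr) (auto simp: add.commute)
  finally show ?thesis by simp
qed

lemma lborel_nn_integral_reflect:
  fixes h :: "'a::euclidean_space \<Rightarrow> ennreal"
  assumes [measurable]: "h \<in> borel_measurable borel"
  shows "(\<integral>\<^sup>+z. h (w - z) \<partial>lborel) = (\<integral>\<^sup>+z. h z \<partial>lborel)"
proof -
  have "(\<integral>\<^sup>+z. h z \<partial>lborel) = (\<integral>\<^sup>+z. h z \<partial>density (distr lborel borel (\<lambda>x. w + (-1) *\<^sub>R x)) (\<lambda>_. ennreal (\<bar>-1\<bar> ^ DIM('a))))"
    by (subst lborel_affine[of "-1" w, symmetric]) auto
  also have "\<dots> = (\<integral>\<^sup>+z. h (w - z) \<partial>lborel)"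
    by (simp add: density_1 nn_integral_distr)
  finally show ?thesis by simp
qed

lemma smoothing_kernel_integral:
  assumes "smoothing_kernel l g"
  shows "(\<integral>w. g (w - z) \<partial>lborel) = 1" "integrable lborel (\<lambda>w. g (w - z))"
  using lborel_integral_translate[OF smoothing_kernelD(6)[OF assms], of "-z"] smoothing_kernelD(3)[OF assms]
    mavg_integrable[OF smoothing_kernelD(5)[OF assms] smoothing_kernelD(4)[OF assms], where f = "\<lambda>_. 1" and z = z]
  by (auto simp: bounded_borel_def)

lemma smoothing_kernel_mavg_integrable:
  assumes "smoothing_kernel l g" "bounded_borel f"
  shows "integrable lborel (\<lambda>w. g (w - z) * f w)"
  using mavg_integrable[OF smoothing_kernelD(5)[OF assms(1)] smoothing_kernelD(4)[OF assms(1)] assms(2)] by blast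

text \<open>If the average were outside C, a hyperplane would separate it strictly from C. The
  linear functional exceeds b at almost every value that the kernel sees, and averaging with total
  weight 1 keeps it at least b, a contradiction. Only values on the ball of radius l matter, since
  the kernel vanishes elsewhere.\<close>

lemma mavg_in_closed_convex:
  fixes f1 f2 :: "'a::euclidean_space \<Rightarrow> real"
  assumes g: "smoothing_kernel l g" and f: "bounded_borel f1" "bounded_borel f2"
    and C: "convex C" "closed C" and AE: "AE w in lborel. w \<in> cball z l \<longrightarrow> (f1 w, f2 w) \<in> C"
  shows "(mavg g f1 z, mavg g f2 z) \<in> C"
proof (rule ccontr)
  assume "(mavg g f1 z, mavg g f2 z) \<notin> C"
  from separating_hyperplane_closed_point[OF C this] obtain a b where
    ab: "a \<bullet> (mavg g f1 z, mavg g f2 z) < b" "\<And>x. x \<in> C \<Longrightarrow> b < a \<bullet> x" by blast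
  obtain a1 a2 where a: "a = (a1, a2)" by (cases a)
  note i = smoothing_kernel_mavg_integrable[OF g f(1), of z] smoothing_kernel_mavg_integrable[OF g f(2), of z]
  have "b = (\<integral>w. b * g (w - z) \<partial>lborel)" using smoothing_kernel_integral[OF g] by simp
  also have "\<dots> \<le> (\<integral>w. a1 * (g (w - z) * f1 w) + a2 * (g (w - z) * f2 w) \<partial>lborel)"
  proof (rule integral_mono_AE)
    show "AE w in lborel. b * g (w - z) \<le> a1 * (g (w - z) * f1 w) + a2 * (g (w - z) * f2 w)"
      using AE
    proof eventually_elim
      case (elim w)
      show ?case
      proof (cases "w \<in> cball z l")
        case True
        with elim ab(2) have "b < a1 * f1 w + a2 * f2 w" by (auto simp: a)
        hence "g (w - z) * b \<le> g (w - z) * (a1 * f1 w + a2 * f2 w)"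
          by (intro mult_left_mono smoothing_kernelD(2)[OF g]) auto
        thus ?thesis by (simp add: algebra_simps)
      next
        case False
        hence "g (w - z) = 0" using smoothing_kernelD(4)[OF g, of "w - z"]
          by (auto simp: dist_norm norm_minus_commute)
        thus ?thesis by simp
      qed
    qed
  qed (use i smoothing_kernel_integral[OF g] in auto)
  also have "\<dots> = a \<bullet> (mavg g f1 z, mavg g f2 z)"
    using i by (simp add: a mavg_def)
  finally show False using ab(1) by simp
qed

lemma mavg_bounded:
  assumes g: "smoothing_kernel l g" and f: "f \<in> borel_measurable borel" "\<And>w. \<bar>f w\<bar> \<le> B"
  shows "\<bar>mavg g f z\<bar> \<le> B"
proof -
  have bb: "bounded_borel f" using f by (auto simp: bounded_borel_def)
  have "\<bar>mavg g f z\<bar> \<le> (\<integral>w. \<bar>g (w - z) * f w\<bar> \<partial>lborel)"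
    unfolding mavg_def by (rule integral_abs_bound)
  also have "\<dots> \<le> (\<integral>w. g (w - z) * B \<partial>lborel)"
  proof (rule integral_mono)
    show "integrable lborel (\<lambda>w. \<bar>g (w - z) * f w\<bar>)"
      by (rule integrable_abs[OF smoothing_kernel_mavg_integrable[OF g bb]])
  qed (use smoothing_kernel_integral[OF g] smoothing_kernelD(2)[OF g] f(2) in \<open>auto simp: abs_mult intro!: mult_left_mono\<close>)
  also have "\<dots> = B" using smoothing_kernel_integral[OF g] by simp
  finally show ?thesis .
qed

text \<open>A measurable function is almost everywhere a limit of continuous ones. Truncating these
  at the bounds of f changes neither continuity nor the limit and supplies the constant majorant for
  dominated convergence on the bounded set S.\<close>

lemma continuous_dense_L1:
  fixes f :: "'a::euclidean_space \<Rightarrow> real"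
  assumes f: "f \<in> borel_measurable borel" "\<And>w. \<bar>f w\<bar> \<le> B" and S: "bounded S" "S \<in> sets borel" and e: "e > 0"
  obtains h where "continuous_on UNIV h" "\<And>w. \<bar>h w\<bar> \<le> B"
    "(\<integral>\<^sup>+w. ennreal \<bar>f w - h w\<bar> * indicator S w \<partial>lborel) < e"
proof -
  have B: "B \<ge> 0" using f(2)[of 0] by linarith
  have "f \<in> borel_measurable lebesgue"
    using f(1) by (simp add: borel_measurable_if_D measurable_completion)
  hence "f measurable_on UNIV"
    by (rule lebesgue_measurable_imp_measurable_on_real) auto
  then obtain N h where N: "negligible N" and h: "\<And>n. continuous_on UNIV (h n)"
    and lim: "\<And>x. x \<notin> N \<Longrightarrow> (\<lambda>n. h n x) \<longlonglongrightarrow> f x"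
    unfolding measurable_on_def by auto
  define k where "k n x = max (- B) (min B (h n x))" for n x
  have kc: "continuous_on UNIV (k n)" for n
    unfolding k_def by (intro continuous_intros h)
  have kB: "\<bar>k n x\<bar> \<le> B" for n x unfolding k_def using B by auto
  have klim: "(\<lambda>n. k n x) \<longlonglongrightarrow> f x" if "x \<notin> N" for x
  proof -
    have "(\<lambda>n. max (- B) (min B (h n x))) \<longlonglongrightarrow> max (- B) (min B (f x))"
      by (intro tendsto_intros lim that)
    moreover have "max (- B) (min B (f x)) = f x" using f(2)[of x] by auto
    ultimately show ?thesis unfolding k_def by simp
  qed
  have [measurable]: "f \<in> borel_measurable borel" "k n \<in> borel_measurable borel" "S \<in> sets borel" for n
    using f(1) kc S by (auto intro: borel_measurable_continuous_onI)
  have "emeasure lborel S < \<infinity>" using emeasure_bounded_finite[OF S(1)] .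
  hence fin: "(\<integral>\<^sup>+w. ennreal (2 * B) * indicator S w \<partial>lborel) < \<infinity>"
    by (simp add: nn_integral_cmult_indicator ennreal_mult_less_top)
  have AE: "AE x in lborel. x \<notin> N"
    using N negligible_iff_null_sets[of N] AE_not_in[of N lebesgue] by (simp add: AE_completion_iff)
  have "(\<lambda>n. \<integral>\<^sup>+w. ennreal \<bar>f w - k n w\<bar> * indicator S w \<partial>lborel) \<longlonglongrightarrow> (\<integral>\<^sup>+w. 0 \<partial>(lborel::'a measure))"
  proof (rule nn_integral_dominated_convergence[where w = "\<lambda>w. ennreal (2 * B) * indicator S w"])
    show "AE x in lborel. ennreal \<bar>f x - k j x\<bar> * indicator S x \<le> ennreal (2 * B) * indicator S x" for j
    proof (rule AE_I2)
      fix x show "ennreal \<bar>f x - k j x\<bar> * indicator S x \<le> ennreal (2 * B) * indicator S x"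
        using f(2)[of x] kB[of j x] by (intro mult_right_mono ennreal_leI) auto
    qed
    show "AE x in lborel. (\<lambda>n. ennreal \<bar>f x - k n x\<bar> * indicator S x) \<longlonglongrightarrow> 0"
      using AE
    proof eventually_elim
      case (elim x)
      have "(\<lambda>n. \<bar>f x - k n x\<bar>) \<longlonglongrightarrow> \<bar>f x - f x\<bar>" by (intro tendsto_intros klim elim)
      hence "(\<lambda>n. ennreal \<bar>f x - k n x\<bar>) \<longlonglongrightarrow> ennreal 0"
        by (intro tendsto_ennrealI) simp
      hence "(\<lambda>n. indicator S x * ennreal \<bar>f x - k n x\<bar>) \<longlonglongrightarrow> indicator S x * ennreal 0"
        by (intro ennreal_tendsto_cmult) (auto simp: indicator_def)
      thus ?case by (simp add: mult.commute)
    qed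
  qed (use fin in auto)
  hence "(\<lambda>n. \<integral>\<^sup>+w. ennreal \<bar>f w - k n w\<bar> * indicator S w \<partial>lborel) \<longlonglongrightarrow> 0" by simp
  from order_tendstoD(2)[OF this e] obtain n where
    "(\<integral>\<^sup>+w. ennreal \<bar>f w - k n w\<bar> * indicator S w \<partial>lborel) < e"
    by (auto simp: eventually_sequentially)
  with kc kB that show ?thesis by blast
qed

text \<open>After the order of integration is exchanged the kernel is integrated over z and again
  gives 1. The set S has to contain the l-neighbourhood of K because the average at a point of K
  sees that far.\<close>

lemma mavg_L1_contraction:
  fixes f h :: "'a::euclidean_space \<Rightarrow> real"
  assumes g: "smoothing_kernel l g" and f: "bounded_borel f" and h: "bounded_borel h"
    and K: "K \<in> sets borel" "S \<in> sets borel" "\<And>z. z \<in> K \<Longrightarrow> cball z l \<subseteq> S"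
  shows "(\<integral>\<^sup>+z. ennreal \<bar>mavg g f z - mavg g h z\<bar> * indicator K z \<partial>lborel)
    \<le> (\<integral>\<^sup>+w. ennreal \<bar>f w - h w\<bar> * indicator S w \<partial>lborel)"
proof -
  have [measurable]: "f \<in> borel_measurable borel" "h \<in> borel_measurable borel" "g \<in> borel_measurable borel"
    "K \<in> sets borel" "S \<in> sets borel"
    using f h K smoothing_kernelD(6)[OF g] by (auto simp: bounded_borel_def)
  have *: "ennreal \<bar>mavg g f z - mavg g h z\<bar> * indicator K z
    \<le> (\<integral>\<^sup>+w. ennreal (g (w - z)) * (ennreal \<bar>f w - h w\<bar> * indicator S w) \<partial>lborel)" for z
  proof (cases "z \<in> K")
    case True
    note i = smoothing_kernel_mavg_integrable[OF g f, of z] smoothing_kernel_mavg_integrable[OF g h, of z]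
    have i': "integrable lborel (\<lambda>w. g (w - z) * (f w - h w))"
      unfolding right_diff_distrib by (rule Bochner_Integration.integrable_diff[OF i])
    have "mavg g f z - mavg g h z = (\<integral>w. g (w - z) * (f w - h w) \<partial>lborel)"
      unfolding mavg_def right_diff_distrib using i by simp
    hence "ennreal \<bar>mavg g f z - mavg g h z\<bar> \<le> (\<integral>\<^sup>+w. ennreal \<bar>g (w - z) * (f w - h w)\<bar> \<partial>lborel)"
      using integral_norm_bound_ennreal[OF i'] by simp
    also have "\<dots> \<le> (\<integral>\<^sup>+w. ennreal (g (w - z)) * (ennreal \<bar>f w - h w\<bar> * indicator S w) \<partial>lborel)"
    proof (rule nn_integral_mono)
      fix w
      show "ennreal \<bar>g (w - z) * (f w - h w)\<bar> \<le> ennreal (g (w - z)) * (ennreal \<bar>f w - h w\<bar> * indicator S w)"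
      proof (cases "w \<in> cball z l")
        case True
        with K(3)[OF \<open>z \<in> K\<close>] have "w \<in> S" by blast
        thus ?thesis using smoothing_kernelD(2)[OF g, of "w - z"] by (simp add: abs_mult ennreal_mult)
      next
        case False
        hence "g (w - z) = 0" using smoothing_kernelD(4)[OF g, of "w - z"]
          by (auto simp: dist_norm norm_minus_commute)
        thus ?thesis by simp
      qed
    qed
    finally show ?thesis using True by simp
  qed simp
  have "(\<integral>\<^sup>+z. ennreal \<bar>mavg g f z - mavg g h z\<bar> * indicator K z \<partial>lborel)
    \<le> (\<integral>\<^sup>+z. \<integral>\<^sup>+w. ennreal (g (w - z)) * (ennreal \<bar>f w - h w\<bar> * indicator S w) \<partial>lborel \<partial>lborel)"
    by (rule nn_integral_mono) (rule *)
  also have "\<dots> = (\<integral>\<^sup>+w. \<integral>\<^sup>+z. ennreal (g (w - z)) * (ennreal \<bar>f w - h w\<bar> * indicator S w) \<partial>lborel \<partial>lborel)"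
    by (rule lborel_pair.Fubini') measurable
  also have "\<dots> = (\<integral>\<^sup>+w. (\<integral>\<^sup>+z. ennreal (g (w - z)) \<partial>lborel) * (ennreal \<bar>f w - h w\<bar> * indicator S w) \<partial>lborel)"
    by (intro nn_integral_cong nn_integral_multc) measurable
  also have "\<dots> = (\<integral>\<^sup>+w. ennreal \<bar>f w - h w\<bar> * indicator S w \<partial>lborel)"
  proof -
    have "(\<integral>\<^sup>+z. ennreal (g (w - z)) \<partial>lborel) = 1" for w
      using lborel_nn_integral_reflect[of "\<lambda>z. ennreal (g z)" w]
        nn_integral_eq_integral[of lborel g] smoothing_kernel_integral(2)[OF g, of 0] smoothing_kernelD(2,3)[OF g]
      by simp
    thus ?thesis by simp
  qed
  finally show ?thesis .
qed

text \<open>With a continuous h close to f in the mean, the error splits into average of f - h,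
  average of h minus h, and h - f. The outer two are small by contraction and density, the middle
  one by uniform continuity. The threshold d serves all kernels of width l at once.\<close>

lemma mavg_L1_conv:
  fixes f :: "'a::euclidean_space \<Rightarrow> real"
  assumes f: "bounded_borel f" and K: "compact K" and e: "e > 0"
  obtains d where "0 < d" "d \<le> 1" "\<And>l g. 0 < l \<Longrightarrow> l < d \<Longrightarrow> smoothing_kernel l g \<Longrightarrow>
    (\<integral>\<^sup>+z. ennreal \<bar>mavg g f z - f z\<bar> * indicator K z \<partial>lborel) \<le> ennreal e"
proof -
  obtain B where B: "f \<in> borel_measurable borel" "B > 0" "\<And>w. \<bar>f w\<bar> \<le> B"
    using bounded_borelE[OF f] by metis
  obtain R where R: "\<And>z. z \<in> K \<Longrightarrow> norm z \<le> R"
    using compact_imp_bounded[OF K] bounded_iff by blast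
  \<comment> \<open>Widths l are at most 1, so the enlarged ball contains every l-neighbourhood of
    K.\<close>
  define S where "S = (cball 0 (R + 1) :: 'a set)"
  have e3: "ennreal (e / 3) > 0" using e by simp
  obtain h where h: "continuous_on UNIV h" "\<And>w. \<bar>h w\<bar> \<le> B"
    "(\<integral>\<^sup>+w. ennreal \<bar>f w - h w\<bar> * indicator S w \<partial>lborel) < ennreal (e / 3)"
    using continuous_dense_L1[OF B(1,3) _ _ e3, of S] unfolding S_def by auto
  have KS: "cball z l \<subseteq> S" if "z \<in> K" "l \<le> 1" for z l
  proof
    fix w assume "w \<in> cball z l"
    hence "norm w \<le> norm z + l"
      using norm_triangle_ineq2[of w z] by (simp add: dist_norm norm_minus_commute)
    thus "w \<in> S" using R[OF that(1)] that(2) unfolding S_def by simp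
  qed
  define V where "V = measure lborel K"
  have fin: "emeasure lborel K < \<infinity>" using emeasure_compact_finite[OF K] .
  \<comment> \<open>Tolerance for the middle error: integrated over K, of volume V, it contributes
    at most e / 3.\<close>
  define e' where "e' = e / (3 * (V + 1))"
  have V: "V \<ge> 0" unfolding V_def by simp
  have e': "e' > 0" unfolding e'_def using e V by (intro divide_pos_pos) auto
  have "uniformly_continuous_on S h"
    unfolding S_def by (intro compact_uniformly_continuous continuous_on_subset[OF h(1)]) auto
  then obtain d where d: "d > 0" "\<And>x y. x \<in> S \<Longrightarrow> y \<in> S \<Longrightarrow> dist y x < d \<Longrightarrow> \<bar>h y - h x\<bar> < e'"
    unfolding uniformly_continuous_on_def dist_real_def using e' by metis
  have Km: "K \<in> sets borel" using K by (simp add: compact_imp_closed)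
  have hb: "bounded_borel h"
    using h(1,2) by (auto simp: bounded_borel_def intro: borel_measurable_continuous_onI)
  have [measurable]: "f \<in> borel_measurable borel" "h \<in> borel_measurable borel" "K \<in> sets borel"
    using B(1) hb Km by (auto simp: bounded_borel_def)
  have "(\<integral>\<^sup>+z. ennreal \<bar>mavg g f z - f z\<bar> * indicator K z \<partial>lborel) \<le> ennreal e"
    if l: "0 < l" "l < min d 1" and g: "smoothing_kernel l g" for l g
  proof -
    have [measurable]: "S \<in> sets borel" unfolding S_def by simp
    have [measurable]: "mavg g f \<in> borel_measurable borel" "mavg g h \<in> borel_measurable borel"
      using mavg_continuous[OF smoothing_kernelD(5)[OF g] smoothing_kernelD(4)[OF g] f]
        mavg_continuous[OF smoothing_kernelD(5)[OF g] smoothing_kernelD(4)[OF g] hb]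
      by (auto intro: borel_measurable_continuous_onI)
    have mid: "\<bar>mavg g h z - h z\<bar> \<le> e'" if z: "z \<in> K" for z
    proof -
      note i = smoothing_kernel_mavg_integrable[OF g hb, of z] smoothing_kernel_integral[OF g, of z]
      have "mavg g h z - h z = (\<integral>w. g (w - z) * (h w - h z) \<partial>lborel)"
        unfolding mavg_def right_diff_distrib using i by simp
      also have "\<bar>\<dots>\<bar> \<le> (\<integral>w. \<bar>g (w - z) * (h w - h z)\<bar> \<partial>lborel)"
        by (rule integral_abs_bound)
      also have "\<dots> \<le> (\<integral>w. g (w - z) * e' \<partial>lborel)"
      proof (rule integral_mono)
        show "integrable lborel (\<lambda>w. \<bar>g (w - z) * (h w - h z)\<bar>)"
          unfolding right_diff_distrib using i by auto
        fix w
        show "\<bar>g (w - z) * (h w - h z)\<bar> \<le> g (w - z) * e'"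
        proof (cases "w \<in> cball z l")
          case True
          hence "w \<in> S" "z \<in> S" "dist w z < d"
            using KS[OF z, of l] KS[OF z, of 0] l by (auto simp: dist_commute)
          from d(2)[OF this(2,1,3)] show ?thesis
            using smoothing_kernelD(2)[OF g, of "w - z"] by (auto simp: abs_mult intro!: mult_left_mono)
        next
          case False
          hence "g (w - z) = 0" using smoothing_kernelD(4)[OF g, of "w - z"]
            by (auto simp: dist_norm norm_minus_commute)
          thus ?thesis by simp
        qed
      qed (use i in auto)
      also have "\<dots> = e'" using i by simp
      finally show ?thesis .
    qed
    have "(\<integral>\<^sup>+z. ennreal \<bar>mavg g f z - f z\<bar> * indicator K z \<partial>lborel)
      \<le> (\<integral>\<^sup>+z. (ennreal \<bar>mavg g f z - mavg g h z\<bar> * indicator K z + ennreal e' * indicator K z)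
          + ennreal \<bar>f z - h z\<bar> * indicator S z \<partial>lborel)"
    proof (rule nn_integral_mono)
      fix z
      show "ennreal \<bar>mavg g f z - f z\<bar> * indicator K z \<le> (ennreal \<bar>mavg g f z - mavg g h z\<bar> * indicator K z
        + ennreal e' * indicator K z) + ennreal \<bar>f z - h z\<bar> * indicator S z"
      proof (cases "z \<in> K")
        case True
        have "z \<in> S" using KS[OF True, of 0] by auto
        moreover have "ennreal \<bar>mavg g f z - f z\<bar> \<le> ennreal (\<bar>mavg g f z - mavg g h z\<bar> + e' + \<bar>f z - h z\<bar>)"
          using mid[OF True] by (intro ennreal_leI) linarith
        ultimately show ?thesis using True e' by simp
      qed simp
    qed
    also have "\<dots> = (\<integral>\<^sup>+z. ennreal \<bar>mavg g f z - mavg g h z\<bar> * indicator K z \<partial>lborel)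
        + (\<integral>\<^sup>+z. ennreal e' * indicator K z \<partial>lborel)
        + (\<integral>\<^sup>+z. ennreal \<bar>f z - h z\<bar> * indicator S z \<partial>lborel)"
      by (simp add: nn_integral_add)
    also have "\<dots> \<le> ennreal (e / 3) + ennreal (e / 3) + ennreal (e / 3)"
    proof (intro add_mono)
      show "(\<integral>\<^sup>+z. ennreal \<bar>f z - h z\<bar> * indicator S z \<partial>lborel) \<le> ennreal (e / 3)"
        using h(3) by simp
      have "(\<integral>\<^sup>+z. ennreal \<bar>mavg g f z - mavg g h z\<bar> * indicator K z \<partial>lborel)
        \<le> (\<integral>\<^sup>+w. ennreal \<bar>f w - h w\<bar> * indicator S w \<partial>lborel)"
        using KS l by (intro mavg_L1_contraction[OF g f hb Km]) (auto simp: S_def)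
      thus "(\<integral>\<^sup>+z. ennreal \<bar>mavg g f z - mavg g h z\<bar> * indicator K z \<partial>lborel) \<le> ennreal (e / 3)"
        using h(3) by (meson order.strict_implies_order order_trans)
      have "(\<integral>\<^sup>+z. ennreal e' * indicator K z \<partial>lborel) = ennreal (e' * V)"
        using fin e' by (simp add: nn_integral_cmult_indicator V_def emeasure_eq_ennreal_measure ennreal_mult less_top)
      also have "\<dots> \<le> ennreal (e / 3)"
      proof (rule ennreal_leI)
        have "e' * V = (e / 3) * (V / (V + 1))" unfolding e'_def by simp
        also have "\<dots> \<le> (e / 3) * 1"
          using V e by (intro mult_left_mono) (auto simp: divide_le_eq)
        finally show "e' * V \<le> e / 3" by simp
      qed
      finally show "(\<integral>\<^sup>+z. ennreal e' * indicator K z \<partial>lborel) \<le> ennreal (e / 3)" .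
    qed
    also have "\<dots> = ennreal e" using e by (simp flip: ennreal_plus)
    finally show ?thesis .
  qed
  thus ?thesis using that[of "min d 1"] d(1) by auto
qed

section \<open>The period lattice and its fundamental cell\<close>

lemma zero_in_periods [simp]: "0 \<in> periods \<Omega>"
  by (cases \<Omega>) (auto simp: periods_def)

lemma periods_add: "k \<in> periods \<Omega> \<Longrightarrow> j \<in> periods \<Omega> \<Longrightarrow> k + j \<in> periods \<Omega>"
  by (cases \<Omega>) (auto simp: periods_def)

lemma periods_minus: "k \<in> periods \<Omega> \<Longrightarrow> - k \<in> periods \<Omega>"
  by (cases \<Omega>) (auto simp: periods_def)

lemma periods_diff: "k \<in> periods \<Omega> \<Longrightarrow> j \<in> periods \<Omega> \<Longrightarrow> k - j \<in> periods \<Omega>"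
  using periods_add[OF _ periods_minus] by fastforce

lemma finite_periods_bounded:
  assumes "bounded S \<or> \<Omega> = Whole"
  shows "finite (periods \<Omega> \<inter> S)"
proof (cases \<Omega>)
  case Whole
  thus ?thesis by (auto simp: periods_def)
next
  case Torus
  with assms obtain R where R: "\<And>x. x \<in> S \<Longrightarrow> norm x \<le> R" by (auto simp: bounded_iff)
  define Z where "Z = {x::real. x \<in> \<int> \<and> \<bar>x\<bar> \<le> R}"
  have "finite (vec_lambda ` (PiE (UNIV::'a set) (\<lambda>_. Z)))"
    unfolding Z_def by (intro finite_imageI finite_PiE finite_abs_int_segment) auto
  moreover have "periods \<Omega> \<inter> S \<subseteq> vec_lambda ` (PiE (UNIV::'a set) (\<lambda>_. Z))"
  proof
    fix k assume k: "k \<in> periods \<Omega> \<inter> S"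
    have "\<bar>k $ i\<bar> \<le> R" for i using R[of k] k component_le_norm_cart[of k i] by auto
    hence "vec_nth k \<in> PiE UNIV (\<lambda>_. Z)" using k Torus by (auto simp: periods_def Z_def)
    moreover have "k = vec_lambda (vec_nth k)" by simp
    ultimately show "k \<in> vec_lambda ` (PiE (UNIV::'a set) (\<lambda>_. Z))" by blast
  qed
  ultimately show ?thesis by (rule finite_subset[rotated])
qed

lemma countable_periods: "countable (periods \<Omega> :: (real^'n) set)"
proof -
  have "periods \<Omega> = (\<Union>n::nat. periods \<Omega> \<inter> (cball 0 (real n) :: (real^'n) set))"
  proof (intro equalityI subsetI)
    fix x :: "real^'n" assume "x \<in> periods \<Omega>"
    moreover obtain n where "norm x \<le> real n" using real_arch_simple by blast
    ultimately show "x \<in> (\<Union>n::nat. periods \<Omega> \<inter> cball 0 (real n))"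
      by (intro UN_I[of n]) auto
  qed auto
  also have "countable \<dots>"
  proof (rule countable_UN)
    show "countable (periods \<Omega> \<inter> (cball 0 (real n) :: (real^'n) set))" for n
      by (rule countable_finite[OF finite_periods_bounded]) simp
  qed simp
  finally show ?thesis .
qed

lemma closed_periods: "closed (periods \<Omega> :: (real^'n) set)"
proof (cases \<Omega>)
  case Torus
  have "closed ((\<lambda>k :: real^'n. k $ i) -` \<int>)" for i
    by (rule closed_vimage[OF closed_Ints]) (rule continuous_on_component[OF continuous_on_id])
  hence *: "closed (\<Inter>i. (\<lambda>k :: real^'n. k $ i) -` \<int>)" by (rule closed_INT[OF ballI])
  have eq: "periods \<Omega> = (\<Inter>i. (\<lambda>k :: real^'n. k $ i) -` \<int>)"
    unfolding periods_def Torus by (simp add: set_eq_iff)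
  show ?thesis unfolding eq by (rule *)
qed (simp add: periods_def)

text \<open>The cell is half-open, so that the integer parts of the coordinates are the only choice
  and the translates of the cell tile the space without overlap.\<close>

lemma cell_periods_ex1: "\<exists>!k. k \<in> periods \<Omega> \<and> (x :: real^'n) - k \<in> cell \<Omega>"
proof (cases \<Omega>)
  case Torus
  show ?thesis
  proof (rule ex1I[of _ "\<chi> i. of_int \<lfloor>x $ i\<rfloor>"])
    show "(\<chi> i. of_int \<lfloor>x $ i\<rfloor>) \<in> periods \<Omega> \<and> x - (\<chi> i. of_int \<lfloor>x $ i\<rfloor>) \<in> cell \<Omega>"
      using Torus by (auto simp: periods_def cell_def) linarith
  next
    fix k assume k: "k \<in> periods \<Omega> \<and> x - k \<in> cell \<Omega>"
    have "k $ i = of_int \<lfloor>x $ i\<rfloor>" for i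
    proof -
      from k Torus obtain m :: int where m: "k $ i = of_int m" by (auto simp: periods_def elim: Ints_cases)
      have "0 \<le> x $ i - k $ i \<and> x $ i - k $ i < 1" using k Torus by (auto simp: cell_def)
      hence "\<lfloor>x $ i\<rfloor> = m" unfolding m by (intro floor_unique) auto
      thus ?thesis using m by simp
    qed
    thus "k = (\<chi> i. of_int \<lfloor>x $ i\<rfloor>)" by (simp add: vec_eq_iff)
  qed
qed (auto simp: periods_def cell_def)

lemma cell_periods_unique:
  "k \<in> periods \<Omega> \<Longrightarrow> j \<in> periods \<Omega> \<Longrightarrow> x - k \<in> cell \<Omega> \<Longrightarrow> x - j \<in> cell \<Omega> \<Longrightarrow> k = j"
  using cell_periods_ex1[of \<Omega> x] by blast

lemma cell_periods_ex: obtains k where "k \<in> periods \<Omega>" "x - k \<in> cell \<Omega>"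
  using cell_periods_ex1[of \<Omega> x] by blast

lemma cell_borel [measurable]: "(cell \<Omega> :: (real^'n) set) \<in> sets borel"
proof (cases \<Omega>)
  case Torus
  have "{x :: real^'n. 0 \<le> x $ i \<and> x $ i < 1} \<in> sets borel" for i
    using borel_measurable_continuous_onI[of "\<lambda>x :: real^'n. x $ i"]
    by (auto intro!: borel_measurable_le borel_measurable_less sets.sets_Collect_conj continuous_intros simp: pred_def[symmetric])
  hence "(\<Inter>i\<in>UNIV. {x :: real^'n. 0 \<le> x $ i \<and> x $ i < 1}) \<in> sets borel"
    by (intro sets.finite_INT) auto
  moreover have "cell \<Omega> = (\<Inter>i\<in>UNIV. {x :: real^'n. 0 \<le> x $ i \<and> x $ i < 1})"
    using Torus by (auto simp: cell_def)
  ultimately show ?thesis by simp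
qed (simp add: cell_def)

lemma bounded_cell: "\<Omega> = Whole \<or> bounded (cell \<Omega> :: (real^'n) set)"
proof (cases \<Omega>)
  case Torus
  have "cell \<Omega> \<subseteq> cbox 0 (\<chi> i. 1 :: real^'n)" using Torus by (auto simp: cell_def mem_box_cart less_imp_le)
  thus ?thesis using bounded_subset[OF bounded_cbox] by blast
qed simp

lemma open_time_interval: "open (time_interval ts)"
proof -
  have "open {t. ereal t < ts}" by (intro open_Collect_less continuous_intros)
  moreover have "time_interval ts = {0<..} \<inter> {t. ereal t < ts}" by (auto simp: time_interval_def)
  ultimately show ?thesis by (metis open_Int open_greaterThan)
qed

lemma borel_Times_UNIV: "A \<in> sets borel \<Longrightarrow> (A :: (real^'n) set) \<times> (UNIV :: real set) \<in> sets borel"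
  by (intro borel_Times) auto

lemma cell_time_borel [measurable]: "(cell \<Omega> :: (real^'n) set) \<times> time_interval ts \<in> sets borel"
  by (intro borel_Times cell_borel) (auto intro: open_time_interval borel_open)

lemma cell_time_lebesgue [simp]: "(cell \<Omega> :: (real^'n) set) \<times> time_interval ts \<in> sets lebesgue"
  using cell_time_borel by (metis sets_completionI_sets sets_lborel)

lemma cell_UNIV_lebesgue [simp]: "(cell \<Omega> :: (real^'n) set) \<times> (UNIV :: real set) \<in> sets lebesgue"
  using borel_Times_UNIV[OF cell_borel] by (metis sets_completionI_sets sets_lborel)

section \<open>Translation invariance and unfolding along the lattice\<close>

lemma distr_lebesgue_translate: "distr lebesgue lebesgue (\<lambda>x. x + z) = (lebesgue :: 'a::euclidean_space measure)"
proof -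
  have "(\<lambda>x. z + (\<Sum>j\<in>Basis. (1 * (x \<bullet> j)) *\<^sub>R j)) = (\<lambda>x. x + z)"
    by (simp add: euclidean_representation add.commute)
  thus ?thesis using lebesgue_affine_euclidean[of "\<lambda>_. 1" z] by (simp add: density_1)
qed

lemma measurable_lebesgue_translate: "(\<lambda>x. x + z) \<in> (lebesgue :: 'a::euclidean_space measure) \<rightarrow>\<^sub>M lebesgue"
proof -
  have "(\<lambda>x. z + (\<Sum>j\<in>Basis. (1 * (x \<bullet> j)) *\<^sub>R j)) = (\<lambda>x. x + z)"
    by (simp add: euclidean_representation add.commute)
  thus ?thesis using lebesgue_affine_measurable[of "\<lambda>_. 1" z] by simp
qed

lemma lebesgue_integral_translate:
  fixes h :: "'a::euclidean_space \<Rightarrow> real"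
  assumes "h \<in> borel_measurable lebesgue"
  shows "(\<integral>w. h (w + z) \<partial>lebesgue) = (\<integral>w. h w \<partial>lebesgue)"
  using integral_distr[OF measurable_lebesgue_translate[of z] assms] by (simp add: distr_lebesgue_translate)

lemma lebesgue_integrable_translate:
  fixes h :: "'a::euclidean_space \<Rightarrow> real"
  assumes "integrable lebesgue h"
  shows "integrable lebesgue (\<lambda>w. h (w + z))"
  using integrable_distr[OF measurable_lebesgue_translate[of z], of h] assms by (simp add: distr_lebesgue_translate)

abbreviation slab :: "space_kind \<Rightarrow> ((real^'n) \<times> real) set"
  where "slab \<Omega> \<equiv> cell \<Omega> \<times> UNIV"

text \<open>The translates of the cell tile the space: h is cut into the pieces above them, each
  piece is moved back to the cell, and the sum of the moved pieces is the periodization of h. The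
  finite set F contains all periods whose translate meets the support.\<close>

lemma integral_unfold:
  fixes h :: "(real^'n) \<times> real \<Rightarrow> real"
  assumes F: "finite F" "F \<subseteq> periods \<Omega>" and h: "integrable lebesgue h"
    and supp: "\<And>w. h w \<noteq> 0 \<Longrightarrow> \<exists>k\<in>F. fst w - k \<in> cell \<Omega>"
  shows "(\<integral>w. h w \<partial>lebesgue) = (\<integral>w. indicator (slab \<Omega>) w * (\<Sum>k\<in>F. h (w + (k, 0))) \<partial>lebesgue)"
proof -
  \<comment> \<open>The piece of h above the translate of the cell by k.\<close>
  define c where "c k w = indicator (slab \<Omega>) (w - (k, 0)) * h w" for k w
  have meas: "(\<lambda>w. indicator (slab \<Omega>) (w - (k, 0)) :: real) \<in> borel_measurable lebesgue" for k
  proof -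
    have "(indicator (slab \<Omega>) :: _ \<Rightarrow> real) \<in> borel_measurable lebesgue"
      by (rule borel_measurable_indicator) simp
    from measurable_compose[OF measurable_lebesgue_translate[of "-(k,0)"] this]
    show ?thesis by (simp only: add_uminus_conv_diff)
  qed
  have ci: "integrable lebesgue (c k)" for k
  proof (rule Bochner_Integration.integrable_bound[OF h])
    show "c k \<in> borel_measurable lebesgue"
      unfolding c_def using meas h by (intro borel_measurable_times) auto
  qed (auto simp: c_def indicator_def)
  have h_eq: "h w = (\<Sum>k\<in>F. c k w)" for w
  proof (cases "h w = 0")
    case False
    obtain k where k: "k \<in> F" "fst w - k \<in> cell \<Omega>" using supp[OF False] by blast
    have "c j w = 0" if "j \<in> F - {k}" for j
    proof (rule ccontr)
      assume "c j w \<noteq> 0"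
      hence "w - (j, 0) \<in> slab \<Omega>" by (auto simp: c_def indicator_def split: if_splits)
      hence "fst (w - (j, 0)) \<in> cell \<Omega>" by (auto simp only: mem_Times_iff)
      hence "fst w - j \<in> cell \<Omega>" by simp
      moreover have "k \<in> periods \<Omega>" "j \<in> periods \<Omega>" using F k that by auto
      ultimately have "k = j" using cell_periods_unique k by blast
      thus False using that by simp
    qed
    hence "(\<Sum>k\<in>F. c k w) = (\<Sum>k\<in>{k}. c k w)"
      using k F by (intro sum.mono_neutral_right) auto
    also have "\<dots> = h w" using k by (cases w) (auto simp: c_def)
    finally show ?thesis ..
  qed (simp add: c_def)
  have "(\<integral>w. h w \<partial>lebesgue) = (\<Sum>k\<in>F. \<integral>w. c k w \<partial>lebesgue)"
    unfolding h_eq by (rule Bochner_Integration.integral_sum) (rule ci)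
  also have "\<dots> = (\<Sum>k\<in>F. \<integral>w. c k (w + (k, 0)) \<partial>lebesgue)"
    using ci by (intro sum.cong refl lebesgue_integral_translate[symmetric]) auto
  also have "\<dots> = (\<integral>w. (\<Sum>k\<in>F. c k (w + (k, 0))) \<partial>lebesgue)"
    by (intro Bochner_Integration.integral_sum[symmetric] lebesgue_integrable_translate ci)
  finally show ?thesis by (simp add: c_def sum_distrib_left)
qed

text \<open>These are the periods that can relate a point of the cell to a point of the cell shifted
  by a; on the torus they are bounded because the cell is.\<close>

lemma cell_shift_finite: "finite (periods \<Omega> \<inter> {a + c - c' | c c'. c \<in> cell \<Omega> \<and> c' \<in> (cell \<Omega> :: (real^'n) set)})"
proof (rule finite_periods_bounded, cases "\<Omega> = Whole")
  case False
  then obtain D where D: "\<And>x :: real^'n. x \<in> cell \<Omega> \<Longrightarrow> norm x \<le> D"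
    using bounded_cell[of \<Omega>, where 'n = 'n] by (auto simp: bounded_iff)
  have "norm (a + c - c') \<le> norm a + 2 * D" if "c \<in> cell \<Omega>" "c' \<in> cell \<Omega>" for c c' :: "real^'n"
    using D[OF that(1)] D[OF that(2)] norm_triangle_ineq[of a c] norm_triangle_ineq4[of "a + c" c'] by linarith
  thus "bounded {a + c - c' | c c'. c \<in> cell \<Omega> \<and> c' \<in> (cell \<Omega> :: (real^'n) set)} \<or> \<Omega> = Whole"
    unfolding bounded_iff by blast
qed simp

text \<open>The cell shifted by a is another fundamental domain. Restricting h to it and unfolding
  along the lattice gives back h on the original cell, by periodicity.\<close>

lemma slab_integral_shift:
  fixes h :: "(real^'n) \<times> real \<Rightarrow> real"
  assumes per: "periodic \<Omega> h" and h: "h \<in> borel_measurable lebesgue"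
    and int: "integrable lebesgue (\<lambda>w. indicator (slab \<Omega>) w * h (w + a))"
  shows "(\<integral>w. indicator (slab \<Omega>) w * h (w + a) \<partial>lebesgue) = (\<integral>w. indicator (slab \<Omega>) w * h w \<partial>lebesgue)"
proof -
  define F where "F = periods \<Omega> \<inter> {fst a + c - c' | c c'. c \<in> cell \<Omega> \<and> c' \<in> (cell \<Omega> :: (real^'n) set)}"
  have F: "finite F" "F \<subseteq> periods \<Omega>" unfolding F_def using cell_shift_finite by auto
  define H where "H w = indicator (slab \<Omega>) (w - a) * h w" for w
  have Hi: "integrable lebesgue H"
    using lebesgue_integrable_translate[OF int, of "-a"] unfolding H_def by simp
  have "(\<integral>w. indicator (slab \<Omega>) w * h (w + a) \<partial>lebesgue) = (\<integral>w. H w \<partial>lebesgue)"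
    using lebesgue_integral_translate[of H a] Hi unfolding H_def by simp
  also have "\<dots> = (\<integral>w. indicator (slab \<Omega>) w * (\<Sum>k\<in>F. H (w + (k, 0))) \<partial>lebesgue)"
  proof (rule integral_unfold[OF F Hi])
    fix w assume "H w \<noteq> 0"
    hence c: "fst w - fst a \<in> cell \<Omega>" by (cases w; cases a) (auto simp: H_def indicator_def split: if_splits)
    obtain k where k: "k \<in> periods \<Omega>" "fst w - k \<in> cell \<Omega>" by (rule cell_periods_ex)
    have "k = fst a + (fst w - fst a) - (fst w - k)" by simp
    with k c show "\<exists>k\<in>F. fst w - k \<in> cell \<Omega>" unfolding F_def by blast
  qed
  also have "\<dots> = (\<integral>w. indicator (slab \<Omega>) w * h w \<partial>lebesgue)"
  proof (rule Bochner_Integration.integral_cong[OF refl])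
    fix w
    show "indicator (slab \<Omega>) w * (\<Sum>k\<in>F. H (w + (k, 0))) = indicator (slab \<Omega>) w * h w"
    proof (cases "fst w \<in> cell \<Omega>")
      case True
      \<comment> \<open>Exactly one lattice translate of w lies in the shifted cell, so a single
        term of the sum survives.\<close>
      obtain k' where k': "k' \<in> periods \<Omega>" "(fst w - fst a) - k' \<in> cell \<Omega>" by (rule cell_periods_ex)
      define k where "k = - k'"
      have k: "k \<in> periods \<Omega>" "fst w - fst a + k \<in> cell \<Omega>" unfolding k_def using k' periods_minus by auto
      have "k = fst a + (fst w - fst a + k) - fst w" by simp
      hence kF: "k \<in> F" using k True unfolding F_def by blast
      have hp: "h (w + (j, 0)) = h w" if "j \<in> F" for j
        using per F that unfolding periodic_def by blast
      have "H (w + (j, 0)) = 0" if "j \<in> F - {k}" for j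
      proof (rule ccontr)
        assume "H (w + (j, 0)) \<noteq> 0"
        hence "w + (j, 0) - a \<in> slab \<Omega>" by (auto simp: H_def indicator_def split: if_splits)
        hence "fst (w + (j, 0) - a) \<in> cell \<Omega>" by (auto simp only: mem_Times_iff)
        moreover have "fst (w + (j, 0) - a) = fst w - fst a - (- j)" by simp
        ultimately have "fst w - fst a - (- j) \<in> cell \<Omega>" by metis
        moreover have "- j \<in> periods \<Omega>" using that F periods_minus by blast
        ultimately have "- j = k'" using cell_periods_unique k' by blast
        hence "j = - k'" by (metis minus_minus)
        thus False using that unfolding k_def by simp
      qed
      hence "(\<Sum>k\<in>F. H (w + (k, 0))) = (\<Sum>k\<in>{k}. H (w + (k, 0)))"
        using kF F by (intro sum.mono_neutral_right) auto
      also have "\<dots> = h w" using k hp[OF kF] unfolding H_def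
        by (cases w; cases a) (auto simp: indicator_def algebra_simps)
      finally show ?thesis by simp
    qed (cases w, simp)
  qed
  finally show ?thesis .
qed

section \<open>Periodic functions with compact support modulo the lattice\<close>

text \<open>The preimage in the covering space of the projection of K to the torus, hence the
  natural support of a periodic function.\<close>

definition saturate :: "space_kind \<Rightarrow> ((real^'n) \<times> real) set \<Rightarrow> ((real^'n) \<times> real) set"
  where "saturate \<Omega> K = {z. \<exists>k\<in>periods \<Omega>. z + (k, 0) \<in> K}"

lemma supp_in_iff: "supp_in \<Omega> K \<phi> \<longleftrightarrow> (\<forall>z. z \<notin> saturate \<Omega> K \<longrightarrow> \<phi> z = 0)"
  unfolding supp_in_def saturate_def by blast

text \<open>It is the sum of a closed set, the lattice at time zero, and the compact set K.\<close>

lemma closed_saturate: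
  assumes "compact K"
  shows "closed (saturate \<Omega> K)"
proof -
  have "saturate \<Omega> K = (\<Union>x\<in>periods \<Omega> \<times> {0}. \<Union>y\<in>K. {x + y})"
  proof (rule set_eqI)
    fix z
    have "z \<in> saturate \<Omega> K \<longleftrightarrow> (\<exists>k\<in>periods \<Omega>. \<exists>y\<in>K. z = (k, 0) + y)"
    proof
      assume "z \<in> saturate \<Omega> K"
      then obtain k where k: "k \<in> periods \<Omega>" "z + (k, 0) \<in> K" unfolding saturate_def by blast
      hence "- k \<in> periods \<Omega>" "z = (- k, 0) + (z + (k, 0))"
        using periods_minus by (auto simp: prod_eq_iff)
      thus "\<exists>k\<in>periods \<Omega>. \<exists>y\<in>K. z = (k, 0) + y" using k by blast
    next
      assume "\<exists>k\<in>periods \<Omega>. \<exists>y\<in>K. z = (k, 0) + y"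
      then obtain k y where k: "k \<in> periods \<Omega>" "y \<in> K" "z = (k, 0) + y" by blast
      hence "- k \<in> periods \<Omega>" "z + (- k, 0) \<in> K"
        using periods_minus by (auto simp: plus_prod_def)
      thus "z \<in> saturate \<Omega> K" unfolding saturate_def by blast
    qed
    thus "z \<in> saturate \<Omega> K \<longleftrightarrow> z \<in> (\<Union>x\<in>periods \<Omega> \<times> {0}. \<Union>y\<in>K. {x + y})" by auto
  qed
  thus ?thesis using closed_compact_sums[OF closed_Times[OF closed_periods closed_singleton] assms] by metis
qed

lemma saturate_time: "z \<in> saturate \<Omega> K \<Longrightarrow> snd z \<in> snd ` K"
proof -
  assume "z \<in> saturate \<Omega> K"
  then obtain k where "z + (k, 0) \<in> K" unfolding saturate_def by blast
  hence "snd (z + (k, 0)) \<in> snd ` K" by (rule imageI)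
  thus ?thesis by simp
qed

text \<open>On the torus K' is the closed unit cube times the set of times of K; so no new times
  appear, which keeps K' inside any set defined by a condition on time alone.\<close>

lemma saturate_cell_compact:
  assumes "compact (K :: ((real^'n) \<times> real) set)"
  obtains K' where "compact K'" "saturate \<Omega> K \<inter> slab \<Omega> \<subseteq> K'" "snd ` K' \<subseteq> snd ` K"
proof (cases \<Omega>)
  case Whole
  thus ?thesis using assms by (intro that[of K]) (auto simp: saturate_def periods_def)
next
  case Torus
  have "compact (cbox 0 (\<chi> i. 1 :: real^'n) \<times> snd ` K)"
    by (intro compact_Times compact_cbox compact_continuous_image[OF _ assms] continuous_intros)
  moreover have "saturate \<Omega> K \<inter> slab \<Omega> \<subseteq> cbox 0 (\<chi> i. 1 :: real^'n) \<times> snd ` K"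
    using Torus saturate_time[of _ \<Omega> K] by (fastforce simp: cell_def mem_box_cart less_imp_le)
  ultimately show ?thesis by (rule that) auto
qed

lemma supp_in_pd:
  assumes "compact K" "supp_in \<Omega> K f"
  shows "supp_in \<Omega> K (pd b f)"
  using assms pd_zero_open[OF closed_saturate[OF assms(1)]] unfolding supp_in_iff by blast

lemma periodic_pd:
  fixes f :: "(real^'n) \<times> real \<Rightarrow> real"
  assumes "periodic \<Omega> f" "\<And>z. f differentiable (at z)"
  shows "periodic \<Omega> (pd b f)"
  unfolding periodic_def
proof (intro ballI allI)
  fix k :: "real^'n" and z assume "k \<in> periods \<Omega>"
  hence "(\<lambda>z. f (z + (k, 0))) = f" using assms(1) unfolding periodic_def by (intro ext) blast
  thus "pd b f (z + (k, 0)) = pd b f z"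
    using pd_translate[of f z "(k, 0)" b] assms(2) by simp
qed

lemma periodic_bounded:
  fixes f :: "(real^'n) \<times> real \<Rightarrow> real"
  assumes per: "periodic \<Omega> f" and c: "continuous_on UNIV f" and K: "compact K" "supp_in \<Omega> K f"
  obtains M where "M > 0" "\<And>z. \<bar>f z\<bar> \<le> M"
proof -
  obtain K' where K': "compact K'" "saturate \<Omega> K \<inter> slab \<Omega> \<subseteq> K'" by (rule saturate_cell_compact[OF K(1), of \<Omega>])
  have "bounded (f ` K')"
    by (intro compact_imp_bounded compact_continuous_image K'(1) continuous_on_subset[OF c]) auto
  then obtain M where M: "M > 0" "\<And>z. z \<in> K' \<Longrightarrow> \<bar>f z\<bar> \<le> M" by (auto simp: bounded_pos)
  have "\<bar>f z\<bar> \<le> M" for z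
  proof -
    obtain k where k: "k \<in> periods \<Omega>" "fst z - k \<in> cell \<Omega>" by (rule cell_periods_ex)
    have "z - (k, 0) = z + (- k, 0)" by (simp add: prod_eq_iff)
    hence "f (z - (k, 0)) = f z"
      using per periods_minus[OF k(1)] unfolding periodic_def by metis
    moreover have "\<bar>f (z - (k, 0))\<bar> \<le> M"
    proof (cases "z - (k, 0) \<in> saturate \<Omega> K")
      case True
      have "z - (k, 0) \<in> slab \<Omega>" using k(2) by (simp add: mem_Times_iff)
      with True have "z - (k, 0) \<in> saturate \<Omega> K \<inter> slab \<Omega>" by (rule IntI)
      thus ?thesis by (intro M(2) subsetD[OF K'(2)])
    next
      case False
      hence "f (z - (k, 0)) = 0" using K(2) unfolding supp_in_iff by blast
      thus ?thesis using M(1) by simp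
    qed
    ultimately show ?thesis by simp
  qed
  with M(1) that show ?thesis by blast
qed

lemma continuous_lebesgue_measurable:
  "continuous_on UNIV (f :: 'a::euclidean_space \<Rightarrow> real) \<Longrightarrow> f \<in> borel_measurable lebesgue"
  by (intro measurable_completion) (simp add: borel_measurable_continuous_onI)

text \<open>Translation in the direction b leaves the integral over the slab unchanged, so every
  difference quotient of h has integral zero. The quotients are bounded by the supremum of the
  derivative on a common compact set, and dominated convergence passes this to the
  derivative.\<close>

lemma slab_integral_pd_eq_0:
  fixes h :: "(real^'n) \<times> real \<Rightarrow> real"
  assumes d: "\<And>z. h differentiable (at z)" and per: "periodic \<Omega> h" and b: "b \<in> Basis"
    and c: "continuous_on UNIV (pd b h)" and K: "compact K" "supp_in \<Omega> K h"
  shows "(\<integral>w. indicator (slab \<Omega>) w * pd b h w \<partial>lebesgue) = 0"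
proof -
  have hc: "continuous_on UNIV h"
    by (simp add: d continuous_at_imp_continuous_on differentiable_imp_continuous_within)
  obtain M where M: "M > 0" "\<And>z. \<bar>pd b h z\<bar> \<le> M"
    using periodic_bounded[OF periodic_pd[OF per d] c K(1) supp_in_pd[OF K]] by metis
  obtain M' where M': "M' > 0" "\<And>z. \<bar>h z\<bar> \<le> M'"
    using periodic_bounded[OF per hc K] by metis
  \<comment> \<open>Enlarged by 1 so that translations by at most 1 in the direction b keep the
    support, within the slab, inside K2.\<close>
  define K1 where "K1 = {x + y | x y. x \<in> K \<and> y \<in> cball 0 1}"
  have "compact K1" unfolding K1_def by (intro compact_sums K compact_cball)
  then obtain K2 where K2: "compact K2" "saturate \<Omega> K1 \<inter> slab \<Omega> \<subseteq> K2"
    by (rule saturate_cell_compact[of _ \<Omega>])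
  have h0: "indicator (slab \<Omega>) w * h (w + t *\<^sub>R b) = 0" if t: "\<bar>t\<bar> \<le> 1" and w: "w \<notin> K2" for w and t :: real
  proof (rule ccontr)
    assume ne: "indicator (slab \<Omega>) w * h (w + t *\<^sub>R b) \<noteq> 0"
    hence "w \<in> slab \<Omega>" "h (w + t *\<^sub>R b) \<noteq> 0" by (auto simp: indicator_def)
    then obtain k where k: "k \<in> periods \<Omega>" "w + t *\<^sub>R b + (k, 0) \<in> K"
      using K(2) unfolding supp_in_def by blast
    have "w + (k, 0) = (w + t *\<^sub>R b + (k, 0)) + (- (t *\<^sub>R b))" by simp
    moreover have "- (t *\<^sub>R b) \<in> cball 0 1" using t b by (simp add: norm_Basis)
    ultimately have "w + (k, 0) \<in> K1" unfolding K1_def using k(2) by blast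
    hence "w \<in> saturate \<Omega> K1" unfolding saturate_def using k(1) by blast
    with \<open>w \<in> slab \<Omega>\<close> K2(2) w show False by blast
  qed
  have K2l: "K2 \<in> sets lebesgue" using K2(1) by (simp add: compact_imp_closed lmeasurable_compact fmeasurableD)
  have K2i: "integrable lebesgue (\<lambda>w. B * indicator K2 w)" for B :: real
    using lmeasurable_compact[OF K2(1)] by (intro integrable_mult_right) (simp add: lmeasurable_iff_integrable)
  have hl: "h \<in> borel_measurable lebesgue" by (rule continuous_lebesgue_measurable[OF hc])
  have hlt: "(\<lambda>w. h (w + t *\<^sub>R b)) \<in> borel_measurable lebesgue" for t
    by (intro continuous_lebesgue_measurable continuous_on_compose2[OF hc] continuous_intros) auto
  have inds: "(\<lambda>w. indicator (slab \<Omega>) w :: real) \<in> borel_measurable lebesgue"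
    by (rule borel_measurable_indicator) simp
  have int: "integrable lebesgue (\<lambda>w. indicator (slab \<Omega>) w * h (w + t *\<^sub>R b))" if "\<bar>t\<bar> \<le> 1" for t
  proof (rule Bochner_Integration.integrable_bound[OF K2i[of M']])
    show "(\<lambda>w. indicator (slab \<Omega>) w * h (w + t *\<^sub>R b)) \<in> borel_measurable lebesgue"
      by (intro borel_measurable_times inds hlt)
    show "AE w in lebesgue. norm (indicator (slab \<Omega>) w * h (w + t *\<^sub>R b)) \<le> norm (M' * indicator K2 w)"
    proof (rule AE_I2)
      fix w show "norm (indicator (slab \<Omega>) w * h (w + t *\<^sub>R b)) \<le> norm (M' * indicator K2 w)"
        using h0[OF that, of w] M'(1) M'(2)[of "w + t *\<^sub>R b"]
        by (cases "w \<in> K2") (auto simp: indicator_def)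
    qed
  qed
  define t where "t n = inverse (real (Suc n))" for n
  have t: "t n > 0" "\<bar>t n\<bar> \<le> 1" for n by (auto simp: t_def field_simps)
  define q where "q n w = (indicator (slab \<Omega>) w * h (w + t n *\<^sub>R b) - indicator (slab \<Omega>) w * h w) / t n" for n w
  have q0: "(\<integral>w. q n w \<partial>lebesgue) = 0" for n
  proof -
    have "(\<integral>w. q n w \<partial>lebesgue) = ((\<integral>w. indicator (slab \<Omega>) w * h (w + t n *\<^sub>R b) \<partial>lebesgue)
        - (\<integral>w. indicator (slab \<Omega>) w * h w \<partial>lebesgue)) / t n"
      unfolding q_def using int[OF t(2)[of n]] int[of 0]
      by (subst integral_divide_zero) (simp add: Bochner_Integration.integral_diff)
    thus ?thesis using slab_integral_shift[OF per hl int[OF t(2)]] by simp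
  qed
  have mvt_le: "\<bar>h (w + s *\<^sub>R b) - h w\<bar> \<le> M * s" if s: "s > 0" for w s
  proof -
    have der: "((\<lambda>t. h (w + t *\<^sub>R b)) has_derivative (\<lambda>r. r * pd b h (w + t *\<^sub>R b))) (at t)" for t :: real
    proof -
      have l: "pd (r *\<^sub>R b) h x = r * pd b h x" for r x
        using linear_scale[OF has_derivative_linear[OF pd_has_derivative[OF d]], of r b x] by simp
      have a: "((\<lambda>t. w + t *\<^sub>R b) has_derivative (\<lambda>r. r *\<^sub>R b)) (at t)"
        by (auto intro!: derivative_eq_intros)
      show ?thesis using has_derivative_compose[OF a pd_has_derivative[OF d]] unfolding l .
    qed
    obtain r where "h (w + s *\<^sub>R b) - h (w + 0 *\<^sub>R b) = (s - 0) * pd b h (w + r *\<^sub>R b)"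
      using mvt[OF s, of "\<lambda>t. h (w + t *\<^sub>R b)" "\<lambda>t r. r * pd b h (w + t *\<^sub>R b)"] der
      by (metis (no_types, lifting) has_derivative_continuous continuous_at_imp_continuous_on)
    hence "\<bar>h (w + s *\<^sub>R b) - h w\<bar> = s * \<bar>pd b h (w + r *\<^sub>R b)\<bar>" using that by (simp add: abs_mult)
    also have "\<dots> \<le> s * M" using that M by (intro mult_left_mono) auto
    finally show ?thesis by (simp add: mult.commute)
  qed
  have "(\<lambda>n. \<integral>w. q n w \<partial>lebesgue) \<longlonglongrightarrow> (\<integral>w. indicator (slab \<Omega>) w * pd b h w \<partial>lebesgue)"
  proof (rule integral_dominated_convergence[OF _ _ K2i[of M]])
    show "(\<lambda>w. indicator (slab \<Omega>) w * pd b h w) \<in> borel_measurable lebesgue"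
      by (intro borel_measurable_times inds continuous_lebesgue_measurable c)
    show "q n \<in> borel_measurable lebesgue" for n
      unfolding q_def by (intro borel_measurable_divide borel_measurable_diff borel_measurable_times inds hlt hl) auto
    show "AE w in lebesgue. (\<lambda>n. q n w) \<longlonglongrightarrow> indicator (slab \<Omega>) w * pd b h w"
    proof (rule AE_I2)
      fix w
      have l: "pd (r *\<^sub>R b) h w = r * pd b h w" for r
        using linear_scale[OF has_derivative_linear[OF pd_has_derivative[OF d]], of r b w] by simp
      have "((\<lambda>t. w + t *\<^sub>R b) has_derivative (\<lambda>r. r *\<^sub>R b)) (at 0)"
        by (auto intro!: derivative_eq_intros)
      from has_derivative_compose[OF this pd_has_derivative[OF d]]
      have "((\<lambda>t. h (w + t *\<^sub>R b)) has_real_derivative pd b h w) (at 0)"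
        unfolding has_field_derivative_def by (simp add: l mult.commute[of _ "pd b h w"])
      hence "((\<lambda>t. (h (w + t *\<^sub>R b) - h w) / t) \<longlongrightarrow> pd b h w) (at 0)"
        unfolding DERIV_def by simp
      moreover have "filterlim t (at 0) sequentially"
        unfolding filterlim_at t_def using LIMSEQ_inverse_real_of_nat by auto
      ultimately have "(\<lambda>n. (h (w + t n *\<^sub>R b) - h w) / t n) \<longlonglongrightarrow> pd b h w"
        by (rule filterlim_compose)
      hence "(\<lambda>n. indicator (slab \<Omega>) w * ((h (w + t n *\<^sub>R b) - h w) / t n)) \<longlonglongrightarrow> indicator (slab \<Omega>) w * pd b h w"
        by (rule tendsto_mult_left)
      thus "(\<lambda>n. q n w) \<longlonglongrightarrow> indicator (slab \<Omega>) w * pd b h w"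
        unfolding q_def by (simp add: right_diff_distrib)
    qed
    show "AE w in lebesgue. norm (q n w) \<le> M * indicator K2 w" for n
    proof (rule AE_I2)
      fix w
      show "norm (q n w) \<le> M * indicator K2 w"
      proof (cases "w \<in> K2")
        case True
        have "\<bar>q n w\<bar> = indicator (slab \<Omega>) w * (\<bar>h (w + t n *\<^sub>R b) - h w\<bar> / t n)"
          unfolding q_def using t(1)[of n] by (auto simp: indicator_def)
        also have "\<dots> \<le> 1 * M"
          using t(1)[of n] mvt_le[OF t(1), of w n] by (intro mult_mono) (auto simp: indicator_def divide_le_eq)
        finally show ?thesis using True by simp
      next
        case False
        thus ?thesis using h0[OF t(2) False, of n] h0[of 0 w] unfolding q_def by auto
      qed
    qed
  qed
  thus ?thesis unfolding q0 by (simp add: LIMSEQ_const_iff)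
qed

lemma Gam_integral:
  fixes f :: "(real^'n) \<times> real \<Rightarrow> real"
  shows "(\<integral>z. f z \<partial>Gam \<Omega> ts) = (\<integral>z. indicator (cell \<Omega> \<times> time_interval ts) z * f z \<partial>lebesgue)"
  unfolding Gam_def by (subst integral_restrict_space) auto

text \<open>Times in the support of h are admissible anyway, so the integral may be taken over the
  whole slab, on which translations act.\<close>

lemma Gam_integral_pd_eq_0:
  fixes h :: "(real^'n) \<times> real \<Rightarrow> real"
  assumes d: "\<And>z. h differentiable (at z)" and per: "periodic \<Omega> h" and b: "b \<in> Basis"
    and c: "continuous_on UNIV (pd b h)"
    and K: "compact K" "supp_in \<Omega> K h" "K \<subseteq> UNIV \<times> time_interval ts"
  shows "(\<integral>w. pd b h w \<partial>Gam \<Omega> ts) = 0"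
proof -
  have *: "indicator (cell \<Omega> \<times> time_interval ts) w * pd b h w = indicator (slab \<Omega>) w * pd b h w" for w
  proof (cases "w \<in> saturate \<Omega> K")
    case True
    hence "snd w \<in> time_interval ts" using saturate_time[OF True] K(3) by auto
    thus ?thesis by (cases w) (auto simp: indicator_def)
  next
    case False
    hence "pd b h w = 0" using supp_in_pd[OF K(1,2), of b] unfolding supp_in_iff by blast
    thus ?thesis by simp
  qed
  thus ?thesis using slab_integral_pd_eq_0[OF d per b c K(1,2)] unfolding Gam_integral by (subst *)
qed

section \<open>Averages of bounded fields\<close>

lemma complete_measure_lebesgue_on:
  assumes "S \<in> sets lebesgue" shows "complete_measure (lebesgue_on S)"
proof
  fix A B assume B: "B \<subseteq> A" and A: "A \<in> null_sets (lebesgue_on S)"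
  have "A \<in> null_sets lebesgue" "A \<subseteq> S" using A null_sets_restrict_space[OF assms] by auto
  hence "B \<in> null_sets lebesgue" "B \<subseteq> S" using B completion.complete2 by blast+
  thus "B \<in> sets (lebesgue_on S)" using assms by (auto simp: sets_restrict_space_iff)
qed

text \<open>In a complete measure space, a set that differs from a measurable one by a null set is
  measurable. This is wanted because thermodynamic functions are controlled only on a set that the
  state reaches almost everywhere.\<close>

lemma (in complete_measure) borel_measurable_cong_AE:
  assumes f: "f \<in> borel_measurable M" and ae: "AE x in M. f x = g x"
  shows "g \<in> borel_measurable M"
proof (rule measurableI)
  fix A :: "'b set" assume "A \<in> sets borel"
  with f have a: "f -` A \<inter> space M \<in> sets M" by (rule measurable_sets)
  have b: "AE x in M. x \<in> f -` A \<inter> space M \<longleftrightarrow> x \<in> g -` A \<inter> space M"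
    using ae by eventually_elim auto
  show "g -` A \<inter> space M \<in> sets M" by (rule in_sets_AE[OF b a]) auto
qed simp

text \<open>The complement of the essential range is covered by balls with null preimage, and by
  Lindelof countably many of them suffice.\<close>

lemma AE_ess_range:
  fixes f :: "'a \<Rightarrow> 'b::{metric_space, second_countable_topology}"
  assumes f: "f \<in> borel_measurable M"
  shows "AE z in M. f z \<in> ess_range M f"
proof -
  define F where "F = {ball y e | y e. e > 0 \<and> emeasure M {z \<in> space M. f z \<in> ball y e} = 0}"
  have "\<And>S. S \<in> F \<Longrightarrow> open S" unfolding F_def by auto
  then obtain F' where F': "F' \<subseteq> F" "countable F'" "\<Union>F' = \<Union>F"
    by (rule Lindelof)
  have "AE z in M. f z \<notin> S" if S: "S \<in> F'" for S
  proof -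
    have S': "open S" "emeasure M {z \<in> space M. f z \<in> S} = 0" using S F'(1) unfolding F_def by auto
    have "f -` S \<inter> space M \<in> sets M" by (rule measurable_sets[OF f]) (simp add: S')
    hence "{z \<in> space M. f z \<in> S} \<in> null_sets M" using S'(2)
      by (auto simp: null_sets_def vimage_def Int_def conj_commute)
    from AE_not_in[OF this] AE_space show ?thesis by eventually_elim blast
  qed
  hence "AE z in M. \<forall>S\<in>F'. f z \<notin> S" using F'(2) by (simp add: AE_ball_countable)
  thus ?thesis
  proof eventually_elim
    case (elim z)
    hence *: "f z \<notin> \<Union>F" using F'(3) by blast
    show ?case unfolding ess_range_def
    proof (intro CollectI allI impI notI)
      fix e :: real assume "e > 0" "emeasure M {w \<in> space M. f w \<in> ball (f z) e} = 0"
      hence "ball (f z) e \<in> F" unfolding F_def by blast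
      thus False using * \<open>e > 0\<close> by (meson UnionI centre_in_ball)
    qed
  qed
qed

section \<open>Essentially bounded fields as functions on space-time\<close>

text \<open>Values at times outside the interval are arbitrary and possibly not measurable; setting
  them to zero gives a Lebesgue measurable function without changing any average taken away from the
  end times.\<close>

definition zext :: "ereal \<Rightarrow> ((real^'n) \<times> real \<Rightarrow> real) \<Rightarrow> (real^'n) \<times> real \<Rightarrow> real"
  where "zext ts f z = (if snd z \<in> time_interval ts then f z else 0)"

lemma AE_lebesgue_translate:
  fixes z :: "'a::euclidean_space"
  assumes "AE x in lebesgue. P x" shows "AE x in lebesgue. P (x + z)"
  by (rule AE_distrD[OF measurable_lebesgue_translate], subst distr_lebesgue_translate) (rule assms)

text \<open>The exceptional set is covered by the translates of its part above one cell, and the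
  lattice is countable.\<close>

lemma AE_periodic:
  fixes P :: "(real^'n) \<times> real \<Rightarrow> bool"
  assumes "AE z in Gam \<Omega> ts. P z" "periodic \<Omega> P"
  shows "AE z in lebesgue. snd z \<in> time_interval ts \<longrightarrow> P z"
proof -
  have "AE z in lebesgue. z \<in> cell \<Omega> \<times> time_interval ts \<longrightarrow> P z"
    using assms(1) unfolding Gam_def by (subst (asm) AE_restrict_space_iff) auto
  hence "AE z in lebesgue. z + (- k, 0) \<in> cell \<Omega> \<times> time_interval ts \<longrightarrow> P (z + (- k, 0))" for k
    by (rule AE_lebesgue_translate)
  hence "AE z in lebesgue. \<forall>k\<in>periods \<Omega>. z + (- k, 0) \<in> cell \<Omega> \<times> time_interval ts \<longrightarrow> P (z + (- k, 0))"
    by (simp only: AE_ball_countable[OF countable_periods] ball_simps) blast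
  thus ?thesis
  proof eventually_elim
    case (elim z)
    show ?case
    proof
      assume t: "snd z \<in> time_interval ts"
      obtain k where k: "k \<in> periods \<Omega>" "fst z - k \<in> cell \<Omega>" by (rule cell_periods_ex)
      have "z + (- k, 0) \<in> cell \<Omega> \<times> time_interval ts" using t k(2) by (simp add: mem_Times_iff)
      hence "P (z + (- k, 0))" by (rule elim[rule_format, OF k(1)])
      moreover have "P (z + (- k, 0)) = P z"
        using assms(2) periods_minus[OF k(1)] unfolding periodic_def by blast
      ultimately show "P z" by simp
    qed
  qed
qed

text \<open>On each of the countably many translates of the cell the function is a translate of the
  extension by zero from a single cell, which is measurable by assumption.\<close>

lemma periodic_zext_measurable:
  fixes f :: "(real^'n) \<times> real \<Rightarrow> real"
  assumes per: "periodic \<Omega> f" and f: "f \<in> borel_measurable (Gam \<Omega> ts)"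
  shows "zext ts f \<in> borel_measurable lebesgue"
proof -
  define g where "g z = indicator (cell \<Omega> \<times> time_interval ts) z *\<^sub>R f z" for z
  have g: "g \<in> borel_measurable lebesgue"
    using f unfolding Gam_def g_def[abs_def] by (subst (asm) borel_measurable_restrict_space_iff) auto
  define S where "S k = {z :: (real^'n) \<times> real. z + (- k, 0) \<in> slab \<Omega>}" for k
  show ?thesis
  proof (rule measurable_piecewise_restrict[where C = "S ` periods \<Omega>" and M = lebesgue and N = borel])
    show "countable (S ` periods \<Omega>)" by (intro countable_image countable_periods)
    show "space lebesgue \<subseteq> \<Union> (S ` periods \<Omega>)"
    proof
      fix z :: "(real^'n) \<times> real"
      obtain k where "k \<in> periods \<Omega>" "fst z - k \<in> cell \<Omega>" by (rule cell_periods_ex)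
      thus "z \<in> \<Union> (S ` periods \<Omega>)" unfolding S_def by (auto simp: mem_Times_iff)
    qed
    fix W assume "W \<in> S ` periods \<Omega>"
    then obtain k where k: "k \<in> periods \<Omega>" "W = S k" by blast
    have "(\<lambda>z. z + (- k, 0)) -` (slab \<Omega>) \<inter> space lebesgue \<in> sets lebesgue"
      by (rule measurable_sets[OF measurable_lebesgue_translate]) simp
    thus "W \<inter> space lebesgue \<in> sets lebesgue" by (simp add: k S_def vimage_def)
    have "(\<lambda>z. g (z + (- k, 0))) \<in> borel_measurable lebesgue"
      by (rule measurable_compose[OF measurable_lebesgue_translate g])
    hence "(\<lambda>z. g (z + (- k, 0))) \<in> borel_measurable (lebesgue_on W)" by (rule measurable_restrict_space1)
    moreover have "zext ts f z = g (z + (- k, 0))" if "z \<in> space (lebesgue_on W)" for z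
    proof -
      have "z + (- k, 0) \<in> slab \<Omega>" using that by (simp add: space_restrict_space k S_def)
      moreover have "f (z + (- k, 0)) = f z"
        using per periods_minus[OF k(1)] unfolding periodic_def by blast
      ultimately show ?thesis unfolding g_def zext_def by (auto simp: indicator_def mem_Times_iff)
    qed
    ultimately show "zext ts f \<in> borel_measurable (lebesgue_on W)"
      using measurable_cong[of "lebesgue_on W" "zext ts f" "\<lambda>z. g (z + (- k, 0))" borel] by blast
  qed
qed

lemma LinfE:
  assumes "Linf \<Omega> ts (f :: (real^'n) \<times> real \<Rightarrow> 'b::euclidean_space)"
  obtains C where "periodic \<Omega> f" "f \<in> borel_measurable (Gam \<Omega> ts)" "C > 0"
    "AE z in Gam \<Omega> ts. norm (f z) \<le> C"
proof -
  obtain C where C: "periodic \<Omega> f" "f \<in> borel_measurable (Gam \<Omega> ts)" "AE z in Gam \<Omega> ts. norm (f z) \<le> C"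
    using assms unfolding Linf_def by blast
  from C(3) have "AE z in Gam \<Omega> ts. norm (f z) \<le> \<bar>C\<bar> + 1" by eventually_elim linarith
  with C(1,2) show ?thesis by (intro that[of "\<bar>C\<bar> + 1"]) auto
qed

lemma zext_bound:
  assumes "Linf \<Omega> ts f"
  obtains C where "C > 0" "AE z in lebesgue. \<bar>zext ts f z\<bar> \<le> C"
proof -
  obtain C where C: "periodic \<Omega> f" "C > 0" "AE z in Gam \<Omega> ts. norm (f z) \<le> C"
    using LinfE[OF assms] by metis
  have "periodic \<Omega> (\<lambda>z. norm (f z) \<le> C)" using C(1) unfolding periodic_def by simp
  from AE_periodic[OF C(3) this] have "AE z in lebesgue. \<bar>zext ts f z\<bar> \<le> C"
    by eventually_elim (use C(2) in \<open>auto simp: zext_def\<close>)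
  with C(2) that show ?thesis by blast
qed

lemma zext_measurable: "Linf \<Omega> ts f \<Longrightarrow> zext ts f \<in> borel_measurable lebesgue"
  using periodic_zext_measurable unfolding Linf_def by blast

text \<open>A Lebesgue measurable function agrees almost everywhere with a Borel one; truncation at
  an essential bound makes it bounded everywhere and alters it on a null set only.\<close>

lemma Linf_bounded_borel_representative:
  assumes "Linf \<Omega> ts f"
  shows "\<exists>f'. bounded_borel f' \<and> (AE z in lebesgue. zext ts f z = f' z)"
proof -
  obtain C where C: "C > 0" "AE z in lebesgue. \<bar>zext ts f z\<bar> \<le> C" using zext_bound[OF assms] .
  obtain g where g: "g \<in> borel_measurable lborel" "AE z in lborel. zext ts f z = g z"
    using completion_ex_borel_measurable_real[OF zext_measurable[OF assms]] by blast
  define h where "h z = max (- C) (min C (g z))" for z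
  have "h \<in> borel_measurable borel" unfolding h_def using g(1) by simp
  moreover have "\<bar>h z\<bar> \<le> C" for z unfolding h_def using C(1) by auto
  moreover have "AE z in lebesgue. zext ts f z = h z"
    using C(2) AE_completion[OF g(2)] by eventually_elim (auto simp: h_def)
  ultimately show ?thesis unfolding bounded_borel_def by blast
qed

definition rep :: "ereal \<Rightarrow> ((real^'n) \<times> real \<Rightarrow> real) \<Rightarrow> (real^'n) \<times> real \<Rightarrow> real"
  where "rep ts f = (SOME f'. bounded_borel f' \<and> (AE z in lebesgue. zext ts f z = f' z))"

lemma rep:
  assumes "Linf \<Omega> ts f"
  shows "bounded_borel (rep ts f)" "AE z in lebesgue. zext ts f z = rep ts f z"
  using someI_ex[OF Linf_bounded_borel_representative[OF assms]] unfolding rep_def by auto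

lemma Linf_add: "Linf \<Omega> ts f \<Longrightarrow> Linf \<Omega> ts g \<Longrightarrow> Linf \<Omega> ts (\<lambda>z. f z + g z :: real)"
proof -
  assume f: "Linf \<Omega> ts f" and g: "Linf \<Omega> ts g"
  obtain C where C: "periodic \<Omega> f" "f \<in> borel_measurable (Gam \<Omega> ts)" "AE z in Gam \<Omega> ts. norm (f z) \<le> C" using LinfE[OF f] by metis
  obtain D where D: "periodic \<Omega> g" "g \<in> borel_measurable (Gam \<Omega> ts)" "AE z in Gam \<Omega> ts. norm (g z) \<le> D" using LinfE[OF g] by metis
  have "AE z in Gam \<Omega> ts. norm (f z + g z) \<le> C + D" using C(3) D(3) by eventually_elim auto
  thus ?thesis using C D unfolding Linf_def periodic_def by (auto intro!: borel_measurable_add)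
qed

lemma Linf_mult: "Linf \<Omega> ts f \<Longrightarrow> Linf \<Omega> ts g \<Longrightarrow> Linf \<Omega> ts (\<lambda>z. f z * g z :: real)"
proof -
  assume f: "Linf \<Omega> ts f" and g: "Linf \<Omega> ts g"
  obtain C where C: "periodic \<Omega> f" "f \<in> borel_measurable (Gam \<Omega> ts)" "C > 0" "AE z in Gam \<Omega> ts. norm (f z) \<le> C" using LinfE[OF f] by metis
  obtain D where D: "periodic \<Omega> g" "g \<in> borel_measurable (Gam \<Omega> ts)" "D > 0" "AE z in Gam \<Omega> ts. norm (g z) \<le> D" using LinfE[OF g] by metis
  have "AE z in Gam \<Omega> ts. norm (f z * g z) \<le> C * D"
    using C(4) D(4) by eventually_elim (use C(3) in \<open>auto simp: abs_mult intro!: mult_mono\<close>)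
  thus ?thesis using C D unfolding Linf_def periodic_def by (auto intro!: borel_measurable_times)
qed

lemma Linf_const: "Linf \<Omega> ts (\<lambda>_. c :: real)"
  unfolding Linf_def periodic_def by (auto intro!: exI[of _ "norm c"])

lemma Linf_sum: "(\<And>i. i \<in> I \<Longrightarrow> Linf \<Omega> ts (f i)) \<Longrightarrow> Linf \<Omega> ts (\<lambda>z. \<Sum>i\<in>I. f i z :: real)"
  by (induction I rule: infinite_finite_induct) (auto intro: Linf_add Linf_const)

lemma Linf_component:
  assumes "Linf \<Omega> ts (v :: (real^'n::finite) \<times> real \<Rightarrow> real^'n)"
  shows "Linf \<Omega> ts (\<lambda>z. v z $ i)"
proof -
  obtain C where C: "periodic \<Omega> v" "v \<in> borel_measurable (Gam \<Omega> ts)" "AE z in Gam \<Omega> ts. norm (v z) \<le> C" using LinfE[OF assms] by metis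
  have "AE z in Gam \<Omega> ts. norm (v z $ i) \<le> C"
    using C(3) by eventually_elim (use component_le_norm_cart order_trans in fastforce)
  moreover have "(\<lambda>z. v z $ i) \<in> borel_measurable (Gam \<Omega> ts)"
    using measurable_compose[OF C(2) borel_measurable_continuous_onI[OF continuous_on_component[OF continuous_on_id]]] by simp
  ultimately show ?thesis using C unfolding Linf_def periodic_def by auto
qed

text \<open>Continuity of h is known on C only. Multiplied by the indicator of the closed set C it
  becomes Borel, and its composition with the state agrees almost everywhere with the field, which
  by completeness is then measurable too.\<close>

lemma Linf_thermo_field:
  assumes u: "Linf \<Omega> ts u" and r: "Linf \<Omega> ts \<rho>" and C: "compact C" "continuous_on C h"
    and AE: "AE z in Gam \<Omega> ts. (u z, \<rho> z) \<in> C"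
  shows "Linf \<Omega> ts (thermo_field h u \<rho>)"
proof -
  have "closed C" using C(1) compact_imp_closed by blast
  have H: "(\<lambda>x. indicator C x *\<^sub>R h x) \<in> borel_measurable borel"
    using \<open>closed C\<close> C(2) by (intro borel_measurable_continuous_on_indicator) auto
  have "(\<lambda>z. (u z, \<rho> z)) \<in> borel_measurable (Gam \<Omega> ts)"
    using u r unfolding Linf_def by (auto intro!: borel_measurable_Pair)
  from measurable_compose[OF this H]
  have m: "(\<lambda>z. indicator C (u z, \<rho> z) *\<^sub>R h (u z, \<rho> z)) \<in> borel_measurable (Gam \<Omega> ts)" .
  have ae: "AE z in Gam \<Omega> ts. indicator C (u z, \<rho> z) *\<^sub>R h (u z, \<rho> z) = thermo_field h u \<rho> z"
    using AE by eventually_elim (simp add: thermo_field_def)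
  interpret complete_measure "Gam \<Omega> ts" unfolding Gam_def by (rule complete_measure_lebesgue_on) simp
  have m: "thermo_field h u \<rho> \<in> borel_measurable (Gam \<Omega> ts)"
    by (rule borel_measurable_cong_AE[OF m ae])
  obtain B where B: "\<And>x. x \<in> C \<Longrightarrow> norm (h x) \<le> B"
    using compact_imp_bounded[OF compact_continuous_image[OF C(2,1)]] by (auto simp: bounded_iff)
  have "AE z in Gam \<Omega> ts. norm (thermo_field h u \<rho> z) \<le> B"
    using AE by eventually_elim (use B in \<open>auto simp: thermo_field_def\<close>)
  moreover have "periodic \<Omega> (thermo_field h u \<rho>)"
    using u r unfolding Linf_def periodic_def thermo_field_def by auto
  ultimately show ?thesis using m unfolding Linf_def by blast
qed

section \<open>Averages away from the end times\<close>

text \<open>Only time is restricted, since neither the whole space nor the torus has a boundary. The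
  second condition is stated in \<open>ereal\<close> to cover an infinite final time.\<close>

definition inner_dom :: "ereal \<Rightarrow> real \<Rightarrow> ((real^'n) \<times> real) set"
  where "inner_dom ts l = {z. l < snd z \<and> ereal (snd z + l) < ts}"

lemma open_inner_dom: "open (inner_dom ts l)"
  unfolding inner_dom_def by (intro open_Collect_conj open_Collect_less continuous_intros)

lemma inner_dom_cball:
  assumes "z \<in> inner_dom ts l" "w \<in> cball z l" shows "snd w \<in> time_interval ts"
proof -
  have "\<bar>snd w - snd z\<bar> \<le> l"
    using assms(2) dist_snd_le[of z w] by (simp add: dist_real_def)
  hence "snd w \<ge> snd z - l" "snd w \<le> snd z + l" by linarith+
  thus ?thesis using assms(1) unfolding inner_dom_def time_interval_def
    by (auto intro: le_less_trans[of "ereal (snd w)" "ereal (snd z + l)"])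
qed

lemma compact_subset_inner_dom:
  assumes "compact K" "K \<subseteq> UNIV \<times> time_interval ts"
  obtains e where "e > 0" "\<And>l. l < e \<Longrightarrow> K \<subseteq> inner_dom ts l"
proof -
  have "open (UNIV \<times> time_interval ts :: ((real^'n) \<times> real) set)" by (intro open_Times open_UNIV open_time_interval)
  then obtain e where e: "e > 0" "(\<Union>x\<in>K. cball x e) \<subseteq> UNIV \<times> time_interval ts"
    using compact_subset_open_imp_cball_epsilon_subset[OF assms(1) _ assms(2)] by metis
  have "K \<subseteq> inner_dom ts l" if "l < e" for l
  proof
    fix z assume z: "z \<in> K"
    have sub: "cball z e \<subseteq> UNIV \<times> time_interval ts" using e(2) z by blast
    have c: "snd w \<in> time_interval ts" if "w \<in> cball z e" for w
      using subsetD[OF sub that] by (simp add: mem_Times_iff)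
    have "snd (z + (0, e)) \<in> time_interval ts" "snd (z - (0, e)) \<in> time_interval ts"
      using e(1) by (intro c; simp add: dist_norm norm_Pair)+
    hence "snd z + e \<in> time_interval ts" "snd z - e \<in> time_interval ts" by simp_all
    thus "z \<in> inner_dom ts l" using that unfolding inner_dom_def time_interval_def
      by (auto intro: less_trans[of "ereal (snd z + l)" "ereal (snd z + e)"])
  qed
  with e(1) that show ?thesis by blast
qed

text \<open>The exponent \<open>CARD('n) + 1\<close> is the dimension of space-time, so the
  prefactor cancels the Jacobian of the dilation by l.\<close>

lemma smoothing_kernel_scaled:
  fixes G :: "(real^'n) \<times> real \<Rightarrow> real"
  assumes G: "mollifier G" and l: "0 < l"
  shows "smoothing_kernel l (scaled G l)"
  unfolding smoothing_kernel_def
proof (intro conjI allI impI)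
  have sm: "smooth G" using G unfolding mollifier_def by blast
  have eq: "scaled G l = (\<lambda>w. (1 / l ^ (CARD('n) + 1)) * G ((1 / l) *\<^sub>R w + 0))"
    unfolding scaled_def by (auto simp: fun_eq_iff inverse_eq_divide)
  show s: "smooth (scaled G l)" unfolding eq by (rule smooth_affine[OF sm])
  show "0 \<le> scaled G l w" for w
  proof -
    have "0 \<le> G (w /\<^sub>R l)" using G unfolding mollifier_def by blast
    thus ?thesis using l unfolding scaled_def by simp
  qed
  show "norm w \<le> l" if "scaled G l w \<noteq> 0" for w
  proof -
    have "norm (w /\<^sub>R l) \<le> 1" using that G unfolding scaled_def mollifier_def by (metis div_0)
    thus ?thesis using l by (simp add: field_simps)
  qed
  have Gm: "G \<in> borel_measurable borel" using sm by (intro borel_measurable_continuous_onI smooth_continuous)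
  have [measurable]: "scaled G l \<in> borel_measurable borel" using s by (intro borel_measurable_continuous_onI smooth_continuous)
  have "(\<integral>w. scaled G l w \<partial>lborel) = (\<integral>w. scaled G l w \<partial>density (distr lborel borel (\<lambda>x. 0 + l *\<^sub>R x)) (\<lambda>_. ennreal (\<bar>l\<bar> ^ DIM((real^'n) \<times> real))))"
    by (subst lborel_affine[of l 0, symmetric]) (use l in auto)
  also have "\<dots> = (\<integral>w. l ^ (CARD('n) + 1) * scaled G l (l *\<^sub>R w) \<partial>lborel)"
    using l by (subst integral_density) (auto simp: integral_distr)
  also have "\<dots> = (\<integral>w. G w \<partial>lborel)" unfolding scaled_def using l by simp
  also have "\<dots> = 1" using G Gm unfolding mollifier_def by (simp add: integral_completion)
  finally show "(\<integral>w. scaled G l w \<partial>lborel) = 1" .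
qed

lemma cball_diff_iff: "w \<in> cball z l \<longleftrightarrow> norm (w - z) \<le> l"
  by (simp add: dist_norm norm_minus_commute)

lemma support_zext:
  assumes "z \<in> inner_dom ts l" "\<And>w. norm w > l \<Longrightarrow> g w = 0"
  shows "g (w - z) * f w = g (w - z) * zext ts f w"
  using inner_dom_cball[OF assms(1), of w] assms(2)[of "w - z"] unfolding cball_diff_iff zext_def
  by (cases "norm (w - z) \<le> l") auto

text \<open>The passage from Lebesgue to Borel measure: the field is exchanged for its Borel
  representative and the completion is dropped. The kernel is an arbitrary continuous g, so that
  derivatives of mollifiers are included.\<close>

lemma zext_integral_rep:
  fixes g :: "(real^'n) \<times> real \<Rightarrow> real"
  assumes f: "Linf \<Omega> ts f" and g: "continuous_on UNIV g" "\<And>w. norm w > l \<Longrightarrow> g w = 0"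
  shows "integrable lebesgue (\<lambda>w. g (w - z) * zext ts f w)"
    "(\<integral>w. g (w - z) * zext ts f w \<partial>lebesgue) = mavg g (rep ts f) z"
proof -
  have gm: "(\<lambda>w. g (w - z)) \<in> borel_measurable lebesgue"
    by (intro continuous_lebesgue_measurable continuous_on_compose2[OF g(1)] continuous_intros) auto
  have m: "(\<lambda>w. g (w - z) * zext ts f w) \<in> borel_measurable lebesgue"
    by (intro borel_measurable_times gm zext_measurable[OF f])
  have i: "integrable lborel (\<lambda>w. g (w - z) * rep ts f w)" by (rule mavg_integrable[OF g rep(1)[OF f]])
  hence m': "(\<lambda>w. g (w - z) * rep ts f w) \<in> borel_measurable lborel" by auto
  have ae: "AE w in lebesgue. g (w - z) * zext ts f w = g (w - z) * rep ts f w"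
    using rep(2)[OF f] by eventually_elim simp
  have i': "integrable lebesgue (\<lambda>w. g (w - z) * rep ts f w)" using i integrable_completion[OF m'] by blast
  show "integrable lebesgue (\<lambda>w. g (w - z) * zext ts f w)"
    using i' integrable_cong_AE[OF m _ ae] by blast
  have "(\<integral>w. g (w - z) * zext ts f w \<partial>lebesgue) = (\<integral>w. g (w - z) * rep ts f w \<partial>lebesgue)"
    using i' by (intro integral_cong_AE[OF m _ ae]) auto
  thus "(\<integral>w. g (w - z) * zext ts f w \<partial>lebesgue) = mavg g (rep ts f) z"
    unfolding mavg_def using integral_completion[OF m'] by simp
qed

text \<open>\<open>avg\<close> integrates over the displacement; a translation moves z from the
  field into the kernel. At points of \<open>inner_dom\<close> the kernel does not see the times at
  which the field was set to zero.\<close>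

lemma avg_eq_zext:
  assumes G: "mollifier G" and l: "0 < l" and f: "Linf \<Omega> ts f" and z: "z \<in> inner_dom ts l"
  shows "avg G l f z = (\<integral>w. scaled G l (w - z) * zext ts f w \<partial>lebesgue)"
proof -
  note k = smoothing_kernel_scaled[OF G l]
  define H where "H w = scaled G l (w - z) * zext ts f w" for w
  have "integrable lebesgue H" unfolding H_def
    by (rule zext_integral_rep(1)[OF f smoothing_kernelD(5)[OF k] smoothing_kernelD(4)[OF k]])
  hence t: "(\<integral>w. H (w + z) \<partial>lebesgue) = (\<integral>w. H w \<partial>lebesgue)" by (intro lebesgue_integral_translate) auto
  have "H (w + z) = scaled G l w * f (z + w)" for w
    using support_zext[of z ts l "scaled G l" "w + z" f, OF z smoothing_kernelD(4)[OF k]] unfolding H_def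
    by (auto simp: add.commute)
  hence "avg G l f z = (\<integral>w. H (w + z) \<partial>lebesgue)" unfolding avg_def by simp
  thus ?thesis unfolding t by (simp add: H_def[abs_def])
qed

lemma avg_eq_mavg:
  assumes "mollifier G" "0 < l" "Linf \<Omega> ts f" "z \<in> inner_dom ts l"
  shows "avg G l f z = mavg (scaled G l) (rep ts f) z"
proof -
  note k = smoothing_kernel_scaled[OF assms(1,2)]
  show ?thesis
    unfolding avg_eq_zext[OF assms]
    by (rule zext_integral_rep(2)[OF assms(3) smoothing_kernelD(5)[OF k] smoothing_kernelD(4)[OF k]])
qed

lemma avg_add:
  assumes G: "mollifier G" and l: "0 < l" and f: "Linf \<Omega> ts f" and g: "Linf \<Omega> ts g" and z: "z \<in> inner_dom ts l"
  shows "avg G l (\<lambda>w. f w + g w) z = avg G l f z + avg G l g z"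
proof -
  note k = smoothing_kernel_scaled[OF G l]
  have "avg G l (\<lambda>w. f w + g w) z = (\<integral>w. scaled G l (w - z) * zext ts f w + scaled G l (w - z) * zext ts g w \<partial>lebesgue)"
    unfolding avg_eq_zext[OF G l Linf_add[OF f g] z]
    by (intro Bochner_Integration.integral_cong refl) (auto simp: zext_def algebra_simps)
  also have "\<dots> = avg G l f z + avg G l g z"
    unfolding avg_eq_zext[OF G l f z] avg_eq_zext[OF G l g z]
    by (intro Bochner_Integration.integral_add zext_integral_rep(1)[OF f smoothing_kernelD(5)[OF k] smoothing_kernelD(4)[OF k]]
        zext_integral_rep(1)[OF g smoothing_kernelD(5)[OF k] smoothing_kernelD(4)[OF k]])
  finally show ?thesis .
qed

lemma avg_cmult: "avg G l (\<lambda>w. c * f w) z = c * avg G l f z"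
  unfolding avg_def by (subst integral_mult_right_zero[symmetric]) (simp add: algebra_simps)

lemma avg_zero: "avg G l (\<lambda>w. 0) z = 0"
  unfolding avg_def by simp

lemma avg_sum:
  assumes G: "mollifier G" and l: "0 < l" and f: "\<And>i. i \<in> I \<Longrightarrow> Linf \<Omega> ts (f i)" and z: "z \<in> inner_dom ts l"
  shows "avg G l (\<lambda>w. \<Sum>i\<in>I. f i w) z = (\<Sum>i\<in>I. avg G l (f i) z)"
  using f
proof (induction I rule: infinite_finite_induct)
  case (insert i I)
  have "avg G l (\<lambda>w. f i w + (\<Sum>i\<in>I. f i w)) z = avg G l (f i) z + avg G l (\<lambda>w. \<Sum>i\<in>I. f i w) z"
    using insert by (intro avg_add[OF G l _ _ z] Linf_sum) auto
  thus ?case using insert by simp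
qed (auto simp: avg_zero)

lemma avg_C1:
  assumes G: "mollifier G" and l: "0 < l" and f: "Linf \<Omega> ts f"
  shows "Ck_on (Suc 0) (inner_dom ts l) (avg G l f)"
proof (rule C1_cong[OF open_inner_dom avg_eq_mavg[OF G l f]])
  note k = smoothing_kernel_scaled[OF G l]
  show "Ck_on (Suc 0) (inner_dom ts l) (mavg (scaled G l) (rep ts f))"
    by (rule Ck_on_subset[OF mavg_C1[OF smoothing_kernelD(1)[OF k] smoothing_kernelD(4)[OF k] rep(1)[OF f]]]) auto
qed auto

text \<open>The right-hand side has the same form as the pairing of f with the derivative of a
  translated kernel. That is how the weak equations turn into equations for averages.\<close>

lemma pd_avg:
  assumes G: "mollifier G" and l: "0 < l" and f: "Linf \<Omega> ts f" and z: "z \<in> inner_dom ts l" and b: "b \<in> Basis"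
  shows "pd b (avg G l f) z = - mavg (pd b (scaled G l)) (rep ts f) z"
proof -
  note k = smoothing_kernel_scaled[OF G l]
  have "pd b (avg G l f) z = pd b (mavg (scaled G l) (rep ts f)) z"
    by (rule pd_cong_open[OF open_inner_dom z avg_eq_mavg[OF G l f]])
  thus ?thesis using pd_mavg[OF smoothing_kernelD(1)[OF k] smoothing_kernelD(4)[OF k] rep(1)[OF f] b] by simp
qed

lemma avg_periodic:
  fixes f :: "(real^'n) \<times> real \<Rightarrow> real"
  assumes "periodic \<Omega> f" shows "periodic \<Omega> (avg G l f)"
  unfolding periodic_def
proof (intro ballI allI)
  fix k :: "real^'n" and z assume k: "k \<in> periods \<Omega>"
  have "f (z + (k, 0) + w) = f (z + w)" for w
  proof -
    have "f ((z + w) + (k, 0)) = f (z + w)" using assms k unfolding periodic_def by blast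
    thus ?thesis by (simp only: ac_simps)
  qed
  thus "avg G l f (z + (k, 0)) = avg G l f z" unfolding avg_def by simp
qed

section \<open>Periodized kernels as test functions\<close>

text \<open>The function to which \<open>distr_avg\<close> applies a distribution, with a general
  kernel g in place of the scaled mollifier.\<close>

definition perker :: "space_kind \<Rightarrow> ((real^'n) \<times> real \<Rightarrow> real) \<Rightarrow> (real^'n) \<times> real \<Rightarrow> (real^'n) \<times> real \<Rightarrow> real"
  where "perker \<Omega> g z w = (\<Sum>\<^sub>\<infinity>k\<in>periods \<Omega>. g (w + (k, 0) - z))"

text \<open>The periods whose term in \<open>perker\<close> can be nonzero at some point above V
  when the kernel has support radius r.\<close>

definition meets :: "space_kind \<Rightarrow> (real^'n) set \<Rightarrow> (real^'n) \<times> real \<Rightarrow> real \<Rightarrow> (real^'n) set"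
  where "meets \<Omega> V z r = periods \<Omega> \<inter> {k. \<exists>w. fst w \<in> V \<and> norm (w + (k, 0) - z) \<le> r}"

lemma finite_meets:
  assumes "\<Omega> = Whole \<or> bounded V" shows "finite (meets \<Omega> V z r)"
  unfolding meets_def
proof (rule finite_periods_bounded, rule disjE[OF assms])
  assume "bounded V"
  then obtain R where R: "\<And>x. x \<in> V \<Longrightarrow> norm x \<le> R" by (auto simp: bounded_iff)
  have "norm k \<le> r + R + norm (fst z)" if "fst w \<in> V" "norm (w + (k, 0) - z) \<le> r" for k w
  proof -
    have "norm (fst w + k - fst z) \<le> r"
      using norm_fst_le[of "fst (w + (k, 0) - z)" "snd (w + (k, 0) - z)"] that(2)
      unfolding prod.collapse by simp
    moreover have "norm k \<le> norm (fst w + k - fst z) + norm (fst w) + norm (fst z)"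
      using norm_triangle_ineq4[of "fst w + k - fst z" "fst w - fst z"] norm_triangle_ineq4[of "fst w" "fst z"]
      by simp
    ultimately show ?thesis using R[OF that(1)] by linarith
  qed
  thus "bounded {k. \<exists>w. fst w \<in> V \<and> norm (w + (k, 0) - z) \<le> r} \<or> \<Omega> = Whole"
    unfolding bounded_iff by blast
qed simp

text \<open>The finite index set depends on V and not on the point w, so on an open V the sum may be
  differentiated term by term.\<close>

lemma perker_eq_sum:
  assumes "\<Omega> = Whole \<or> bounded V" "\<And>w. norm w > r \<Longrightarrow> g w = 0" "fst w \<in> V"
  shows "perker \<Omega> g z w = (\<Sum>k\<in>meets \<Omega> V z r. g (w + (k, 0) - z))"
proof -
  have "perker \<Omega> g z w = (\<Sum>\<^sub>\<infinity>k\<in>meets \<Omega> V z r. g (w + (k, 0) - z))"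
    unfolding perker_def
  proof (rule infsum_cong_neutral)
    fix k assume "k \<in> periods \<Omega> - meets \<Omega> V z r"
    hence "\<not> norm (w + (k, 0) - z) \<le> r" using assms(3) unfolding meets_def by blast
    thus "g (w + (k, 0) - z) = 0" using assms(2) by simp
  qed (auto simp: meets_def)
  thus ?thesis using finite_meets[OF assms(1)] by simp
qed

lemma smooth_perker_sum:
  assumes "smooth g" "finite F"
  shows "smooth (\<lambda>w. \<Sum>k\<in>F. g (w + (k, 0) - z))"
proof (rule smooth_sum[OF assms(2)])
  fix k
  show "smooth (\<lambda>w. g (w + (k, 0) - z))" using smooth_translate[OF assms(1), of "(k, 0) - z"] by (simp add: add_diff_eq)
qed

text \<open>Near each point a fixed finite sum of translates represents the kernel, which gives
  smoothness; shifting the summation index gives periodicity. The support consists of lattice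
  translates of the ball of radius l about z, whose times are admissible by the choice of z.\<close>

lemma test_fun_perker:
  fixes g :: "(real^'n) \<times> real \<Rightarrow> real"
  assumes g: "smoothing_kernel l g" and z: "z \<in> inner_dom ts l"
  shows "test_fun \<Omega> ts (perker \<Omega> g z)"
  unfolding test_fun_def
proof (intro conjI exI[of _ "cball z l"])
  show "smooth (perker \<Omega> g z)"
  proof (rule smooth_local)
    fix w0 :: "(real^'n) \<times> real"
    define V where "V = ball (fst w0) 1"
    have b: "\<Omega> = Whole \<or> bounded V" unfolding V_def by simp
    have "open (V \<times> (UNIV :: real set))" unfolding V_def by (intro open_Times) auto
    moreover have "w0 \<in> V \<times> UNIV" unfolding V_def by (simp add: mem_Times_iff)
    moreover have "\<forall>w\<in>V \<times> UNIV. perker \<Omega> g z w = (\<Sum>k\<in>meets \<Omega> V z l. g (w + (k, 0) - z))"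
      using perker_eq_sum[OF b smoothing_kernelD(4)[OF g]] by auto
    ultimately show "\<exists>W h. open W \<and> w0 \<in> W \<and> smooth h \<and> (\<forall>x\<in>W. perker \<Omega> g z x = h x)"
      using smooth_perker_sum[OF smoothing_kernelD(1)[OF g] finite_meets[OF b]] by blast
  qed
  show "periodic \<Omega> (perker \<Omega> g z)"
    unfolding periodic_def
  proof (intro ballI allI)
    fix j :: "real^'n" and w assume j: "j \<in> periods \<Omega>"
    have "bij_betw (\<lambda>k. j + k) (periods \<Omega>) (periods \<Omega>)"
    proof (rule bij_betwI[of _ _ _ "\<lambda>k. k - j"])
      show "(\<lambda>k. j + k) \<in> periods \<Omega> \<rightarrow> periods \<Omega>" "(\<lambda>k. k - j) \<in> periods \<Omega> \<rightarrow> periods \<Omega>"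
        using j periods_add periods_diff by blast+
    qed auto
    from infsum_reindex_bij_betw[OF this, of "\<lambda>k. g (w + (k, 0) - z)"]
    show "perker \<Omega> g z (w + (j, 0)) = perker \<Omega> g z w"
      unfolding perker_def by (simp add: add.assoc)
  qed
  show "cball z l \<subseteq> UNIV \<times> time_interval ts"
    using inner_dom_cball[OF z] by (auto simp: mem_Times_iff)
  show "supp_in \<Omega> (cball z l) (perker \<Omega> g z)"
    unfolding supp_in_def
  proof (intro allI impI)
    fix w assume "perker \<Omega> g z w \<noteq> 0"
    then obtain k where "k \<in> periods \<Omega>" "g (w + (k, 0) - z) \<noteq> 0"
      unfolding perker_def by (meson infsum_0)
    thus "\<exists>k\<in>periods \<Omega>. w + (k, 0) \<in> cball z l"
      using smoothing_kernelD(4)[OF g, of "w + (k, 0) - z"] unfolding cball_diff_iff by (auto simp: not_less[symmetric])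
  qed
qed auto

text \<open>Integrating over one cell against the periodized kernel is the same as integrating over
  the whole space against the kernel itself; this is \<open>integral_unfold\<close> read from right
  to left.\<close>

lemma reg_pd_perker:
  fixes f :: "(real^'n) \<times> real \<Rightarrow> real"
  assumes f: "Linf \<Omega> ts f" and g: "smoothing_kernel l g" and z: "z \<in> inner_dom ts l" and b: "b \<in> Basis"
  shows "reg \<Omega> ts f (pd b (perker \<Omega> g z)) = mavg (pd b g) (rep ts f) z"
proof -
  have sm: "smooth (pd b g)" by (rule smooth_pd[OF smoothing_kernelD(1)[OF g] b])
  have pc: "continuous_on UNIV (pd b g)" by (rule smooth_continuous[OF sm])
  have ps: "pd b g w = 0" if "norm w > l" for w by (rule smooth_pd_support[OF smoothing_kernelD(4)[OF g] that])
  \<comment> \<open>The cell is not open, and derivatives at its boundary points need the finite sum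
    in a neighbourhood; hence an open V around it, bounded on the torus.\<close>
  obtain V :: "(real^'n) set" where V: "open V" "cell \<Omega> \<subseteq> V" "\<Omega> = Whole \<or> bounded V"
  proof (cases "\<Omega> = Whole")
    case True thus ?thesis by (intro that[of UNIV]) auto
  next
    case False
    then obtain R where "\<And>x :: real^'n. x \<in> cell \<Omega> \<Longrightarrow> norm x < R"
      using bounded_cell[of \<Omega>, where 'n = 'n] unfolding bounded_pos_less by auto
    thus ?thesis by (intro that[of "ball 0 R"]) auto
  qed
  define F where "F = meets \<Omega> V z l"
  have F: "finite F" "F \<subseteq> periods \<Omega>" unfolding F_def using finite_meets[OF V(3)] by (auto simp: meets_def)
  define h where "h w = pd b g (w - z) * zext ts f w" for w
  have hi: "integrable lebesgue h" unfolding h_def by (rule zext_integral_rep(1)[OF f pc ps])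
  have pdk: "pd b (perker \<Omega> g z) w = (\<Sum>k\<in>F. pd b g (w + (k, 0) - z))" if w: "fst w \<in> cell \<Omega>" for w
  proof -
    have "pd b (perker \<Omega> g z) w = pd b (\<lambda>w. \<Sum>k\<in>F. g (w + ((k, 0) - z))) w"
    proof (rule pd_cong_open[of "V \<times> UNIV"])
      show "open (V \<times> (UNIV :: real set))" using V(1) by (intro open_Times) auto
      show "w \<in> V \<times> UNIV" using w V(2) by (auto simp: mem_Times_iff)
      show "perker \<Omega> g z x = (\<Sum>k\<in>F. g (x + ((k, 0) - z)))" if "x \<in> V \<times> UNIV" for x
        using perker_eq_sum[OF V(3) smoothing_kernelD(4)[OF g], where w = x and z = z] that unfolding F_def by (auto simp: add_diff_eq)
    qed
    also have "\<dots> = (\<Sum>k\<in>F. pd b (\<lambda>w. g (w + ((k, 0) - z))) w)"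
      using smooth_differentiable[OF smooth_translate[OF smoothing_kernelD(1)[OF g]]] by (intro pd_sum F) auto
    also have "\<dots> = (\<Sum>k\<in>F. pd b g (w + ((k, 0) - z)))"
      by (intro sum.cong refl pd_translate smooth_differentiable smoothing_kernelD(1)[OF g])
    also have "\<dots> = (\<Sum>k\<in>F. pd b g (w + (k, 0) - z))" by (simp only: add_diff_eq)
    finally show ?thesis .
  qed
  have "(\<integral>w. h w \<partial>lebesgue) = (\<integral>w. indicator (slab \<Omega>) w * (\<Sum>k\<in>F. h (w + (k, 0))) \<partial>lebesgue)"
  proof (rule integral_unfold[OF F hi])
    fix w assume "h w \<noteq> 0"
    hence n: "norm (w - z) \<le> l" using ps[of "w - z"] unfolding h_def by (auto simp: not_less[symmetric])
    obtain k where k: "k \<in> periods \<Omega>" "fst w - k \<in> cell \<Omega>" by (rule cell_periods_ex)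
    have "fst (w - (k, 0)) \<in> V" "norm (w - (k, 0) + (k, 0) - z) \<le> l" using k(2) V(2) n by auto
    hence "k \<in> F" unfolding F_def meets_def using k(1) by blast
    with k show "\<exists>k\<in>F. fst w - k \<in> cell \<Omega>" by blast
  qed
  also have "\<dots> = (\<integral>w. indicator (cell \<Omega> \<times> time_interval ts) w * (f w * pd b (perker \<Omega> g z) w) \<partial>lebesgue)"
  proof (rule Bochner_Integration.integral_cong[OF refl])
    fix w
    show "indicator (slab \<Omega>) w * (\<Sum>k\<in>F. h (w + (k, 0)))
      = indicator (cell \<Omega> \<times> time_interval ts) w * (f w * pd b (perker \<Omega> g z) w)"
    proof (cases "fst w \<in> cell \<Omega> \<and> snd w \<in> time_interval ts")
      case True
      have "h (w + (k, 0)) = f w * pd b g (w + (k, 0) - z)" if "k \<in> F" for k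
      proof -
        have "f (w + (k, 0)) = f w" using f F(2) that unfolding Linf_def periodic_def by blast
        thus ?thesis using True unfolding h_def zext_def by simp
      qed
      hence "(\<Sum>k\<in>F. h (w + (k, 0))) = f w * (\<Sum>k\<in>F. pd b g (w + (k, 0) - z))"
        by (simp add: sum_distrib_left)
      with pdk[of w] True show ?thesis by (simp add: indicator_def mem_Times_iff)
    next
      case False
      thus ?thesis unfolding h_def zext_def by (auto simp: indicator_def mem_Times_iff)
    qed
  qed
  finally show ?thesis unfolding reg_def Gam_integral
    using zext_integral_rep(2)[OF f pc ps, where z = z] unfolding h_def by simp
qed

lemma axis_time_Basis [simp]: "(axis i 1, 0) \<in> (Basis :: ((real^'n) \<times> real) set)" "(0, 1) \<in> (Basis :: ((real^'n) \<times> real) set)"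
  by (auto simp: Basis_prod_def axis_in_Basis_iff)

text \<open>The minus sign in the definition of the distributional derivative cancels the one from
  differentiating the kernel with respect to its centre.\<close>

lemma ddx_perker:
  assumes f: "Linf \<Omega> ts f" and G: "mollifier G" and l: "0 < l" and z: "z \<in> inner_dom ts l"
  shows "ddx i (reg \<Omega> ts f) (perker \<Omega> (scaled G l) z) = dx i (avg G l f) z"
  unfolding ddx_def dx_def
  by (simp add: reg_pd_perker[OF f smoothing_kernel_scaled[OF G l] z] pd_avg[OF G l f z])

lemma ddt_perker:
  assumes f: "Linf \<Omega> ts f" and G: "mollifier G" and l: "0 < l" and z: "z \<in> inner_dom ts l"
  shows "ddt (reg \<Omega> ts f) (perker \<Omega> (scaled G l) z) = dt (avg G l f) z"
  unfolding ddt_def dt_def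
  by (simp add: reg_pd_perker[OF f smoothing_kernel_scaled[OF G l] z] pd_avg[OF G l f z])

text \<open>Although the divergence of v is only a distribution, its average is a function,
  continuous on \<open>inner_dom\<close>, to which pointwise algebra applies.\<close>

lemma distr_avg_ddiv:
  assumes f: "Linf \<Omega> ts v" and G: "mollifier G" and l: "0 < l" and z: "z \<in> inner_dom ts l"
  shows "distr_avg \<Omega> G l (ddiv \<Omega> ts v) z = (\<Sum>i\<in>UNIV. dx i (avg G l (\<lambda>w. v w $ i)) z)"
  unfolding distr_avg_def perker_def[symmetric, abs_def] ddiv_def
  using ddx_perker[OF Linf_component[OF f] G l z] by simp

section \<open>Distributions and local convergence in the mean\<close>

lemma test_funE:
  assumes "test_fun \<Omega> ts \<phi>"
  obtains K where "smooth \<phi>" "periodic \<Omega> \<phi>" "compact K" "K \<subseteq> UNIV \<times> time_interval ts" "supp_in \<Omega> K \<phi>"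
  using assms unfolding test_fun_def by blast

lemma compact_lebesgue [simp]: "compact (K :: 'a::euclidean_space set) \<Longrightarrow> K \<in> sets lebesgue"
  by (simp add: lmeasurable_compact fmeasurableD)

lemma finite_measure_lebesgue_on_compact: "compact (K :: 'a::euclidean_space set) \<Longrightarrow> finite_measure (lebesgue_on K)"
  by (simp add: finite_measure_lebesgue_on lmeasurable_compact)

lemma bounded_integrable_compact:
  fixes h :: "'a::euclidean_space \<Rightarrow> real"
  assumes "compact K" "h \<in> borel_measurable (lebesgue_on K)" "AE z in lebesgue_on K. \<bar>h z\<bar> \<le> B"
  shows "integrable (lebesgue_on K) h"
  using finite_measure.integrable_const_bound[OF finite_measure_lebesgue_on_compact[OF assms(1)], of h B] assms by simp

lemma AE_on_compact:
  assumes "AE z in lebesgue. snd z \<in> time_interval ts \<longrightarrow> P z" "compact K" "K \<subseteq> UNIV \<times> time_interval ts"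
  shows "AE z in lebesgue_on K. P z"
proof -
  have "AE z in lebesgue. z \<in> K \<longrightarrow> P z" using assms(1)
    by eventually_elim (use assms(3) in \<open>auto simp: mem_Times_iff subset_iff\<close>)
  thus ?thesis using assms(2) by (subst AE_restrict_space_iff) auto
qed

lemma Linf_measurable_on:
  fixes f :: "(real^'n) \<times> real \<Rightarrow> real"
  assumes f: "Linf \<Omega> ts f" and K: "compact K" "K \<subseteq> UNIV \<times> time_interval ts"
  shows "f \<in> borel_measurable (lebesgue_on K)"
proof -
  have "zext ts f \<in> borel_measurable (lebesgue_on K)"
    by (rule measurable_restrict_space1[OF zext_measurable[OF f]])
  moreover have "zext ts f z = f z" if "z \<in> space (lebesgue_on K)" for z
    using that subsetD[OF K(2), of z] unfolding zext_def by (simp add: mem_Times_iff)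
  ultimately show ?thesis using measurable_cong[of "lebesgue_on K" "zext ts f" f borel] by blast
qed

lemma Linf_AE_rep:
  fixes f :: "(real^'n) \<times> real \<Rightarrow> real"
  assumes f: "Linf \<Omega> ts f" and K: "compact K" "K \<subseteq> UNIV \<times> time_interval ts"
  shows "AE z in lebesgue_on K. f z = rep ts f z"
proof (rule AE_on_compact[OF _ K])
  show "AE z in lebesgue. snd z \<in> time_interval ts \<longrightarrow> f z = rep ts f z"
    using rep(2)[OF f] by eventually_elim (auto simp: zext_def)
qed

text \<open>Moves the pairing to a compact set of finite measure. K' may stick out of the half-open
  cell, hence the indicator of the slab in the integrand.\<close>

lemma reg_eq_on_compact:
  fixes f :: "(real^'n) \<times> real \<Rightarrow> real"
  assumes K': "compact K'" and v: "\<And>z. z \<in> slab \<Omega> \<Longrightarrow> z \<notin> K' \<Longrightarrow> \<psi> z = 0" and t: "K' \<subseteq> UNIV \<times> time_interval ts"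
  shows "reg \<Omega> ts f \<psi> = (\<integral>z. f z * (indicator (slab \<Omega>) z * \<psi> z) \<partial>lebesgue_on K')"
    "integrable (Gam \<Omega> ts) (\<lambda>z. f z * \<psi> z) \<longleftrightarrow> integrable (lebesgue_on K') (\<lambda>z. f z * (indicator (slab \<Omega>) z * \<psi> z))"
proof -
  have t': "snd z \<in> time_interval ts" if "z \<in> K'" for z
    using subsetD[OF t that] by (simp add: mem_Times_iff)
  have eq: "indicator (cell \<Omega> \<times> time_interval ts) z * (f z * \<psi> z) = indicator K' z *\<^sub>R (f z * (indicator (slab \<Omega>) z * \<psi> z))" for z
    using v[of z] t'[of z] by (auto simp: indicator_def mem_Times_iff)
  show "reg \<Omega> ts f \<psi> = (\<integral>z. f z * (indicator (slab \<Omega>) z * \<psi> z) \<partial>lebesgue_on K')"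
    unfolding reg_def Gam_integral eq using K' by (subst integral_restrict_space) auto
  show "integrable (Gam \<Omega> ts) (\<lambda>z. f z * \<psi> z) \<longleftrightarrow> integrable (lebesgue_on K') (\<lambda>z. f z * (indicator (slab \<Omega>) z * \<psi> z))"
  proof -
    have "integrable (Gam \<Omega> ts) (\<lambda>z. f z * \<psi> z)
      \<longleftrightarrow> integrable lebesgue (\<lambda>z. indicator (cell \<Omega> \<times> time_interval ts) z *\<^sub>R (f z * \<psi> z))"
      unfolding Gam_def by (rule integrable_restrict_space) simp
    also have "\<dots> \<longleftrightarrow> integrable lebesgue (\<lambda>z. indicator K' z *\<^sub>R (f z * (indicator (slab \<Omega>) z * \<psi> z)))"
      by (simp only: real_scaleR_def[of "indicator (cell \<Omega> \<times> time_interval ts) _"] eq)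
    also have "\<dots> \<longleftrightarrow> integrable (lebesgue_on K') (\<lambda>z. f z * (indicator (slab \<Omega>) z * \<psi> z))"
      using K' by (intro integrable_restrict_space[symmetric]) simp
    finally show ?thesis .
  qed
qed

text \<open>One compact set, depending on K alone, carries within the slab all functions supported
  in the translates of K. It has no times other than those of K, and \<open>inner_dom\<close> is a
  condition on time, so inclusion in it is inherited.\<close>

lemma test_support:
  assumes K: "compact K" "K \<subseteq> UNIV \<times> time_interval ts"
  obtains K' where "compact K'" "K' \<subseteq> UNIV \<times> time_interval ts"
    "\<And>\<psi> z. supp_in \<Omega> K \<psi> \<Longrightarrow> z \<in> slab \<Omega> \<Longrightarrow> z \<notin> K' \<Longrightarrow> \<psi> z = 0"
    "\<And>l. K \<subseteq> inner_dom ts l \<Longrightarrow> K' \<subseteq> inner_dom ts l"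
proof -
  obtain K' where K': "compact K'" "saturate \<Omega> K \<inter> slab \<Omega> \<subseteq> K'" "snd ` K' \<subseteq> snd ` K"
    by (rule saturate_cell_compact[OF K(1), of \<Omega>])
  have sub: "\<exists>w\<in>K. snd z = snd w" if "z \<in> K'" for z using K'(3) that by (auto simp: image_iff subset_iff)
  show ?thesis
  proof (rule that[OF K'(1)])
    show "K' \<subseteq> UNIV \<times> time_interval ts"
    proof
      fix z assume "z \<in> K'"
      then obtain w where "w \<in> K" "snd z = snd w" using sub by blast
      with subsetD[OF K(2)] show "z \<in> UNIV \<times> time_interval ts" by (simp add: mem_Times_iff)
    qed
    show "\<psi> z = 0" if "supp_in \<Omega> K \<psi>" "z \<in> slab \<Omega>" "z \<notin> K'" for \<psi> z
      using that K'(2) unfolding supp_in_iff by blast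
    show "K' \<subseteq> inner_dom ts l" if "K \<subseteq> inner_dom ts l" for l
    proof
      fix z assume "z \<in> K'"
      then obtain w where "w \<in> K" "snd z = snd w" using sub by blast
      thus "z \<in> inner_dom ts l" using that unfolding inner_dom_def by auto
    qed
  qed
qed

lemma slab_test_measurable:
  assumes "continuous_on UNIV (\<psi> :: (real^'n) \<times> real \<Rightarrow> real)"
  shows "(\<lambda>z. indicator (slab \<Omega>) z * \<psi> z) \<in> borel_measurable (lebesgue_on K')"
  using assms by (intro measurable_restrict_space1 borel_measurable_times continuous_lebesgue_measurable borel_measurable_indicator) auto

lemma Linf_on_compact:
  fixes f :: "(real^'n) \<times> real \<Rightarrow> real"
  assumes f: "Linf \<Omega> ts f" and K: "compact K" "K \<subseteq> UNIV \<times> time_interval ts"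
  obtains C where "C > 0" "AE z in lebesgue_on K. \<bar>f z\<bar> \<le> C"
proof -
  obtain B where B: "B > 0" "\<And>z. \<bar>rep ts f z\<bar> \<le> B" using bounded_borelE[OF rep(1)[OF f]] by metis
  have "AE z in lebesgue_on K. \<bar>f z\<bar> \<le> B" using Linf_AE_rep[OF f K] by eventually_elim (use B in simp)
  with B(1) that show ?thesis by blast
qed

text \<open>V depends on f and K but not on the test function: this is the continuity estimate of
  order zero for a regular distribution.\<close>

lemma reg_bound:
  fixes f :: "(real^'n) \<times> real \<Rightarrow> real"
  assumes f: "Linf \<Omega> ts f" and K: "compact K" "K \<subseteq> UNIV \<times> time_interval ts"
  obtains V where "\<And>\<psi> B. continuous_on UNIV \<psi> \<Longrightarrow> supp_in \<Omega> K \<psi> \<Longrightarrow> (\<And>z. \<bar>\<psi> z\<bar> \<le> B) \<Longrightarrow>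
    integrable (Gam \<Omega> ts) (\<lambda>z. f z * \<psi> z) \<and> \<bar>reg \<Omega> ts f \<psi>\<bar> \<le> V * B"
proof -
  obtain K' where K': "compact K'" "K' \<subseteq> UNIV \<times> time_interval ts"
    and v: "\<And>\<psi> z. supp_in \<Omega> K \<psi> \<Longrightarrow> z \<in> slab \<Omega> \<Longrightarrow> z \<notin> K' \<Longrightarrow> \<psi> z = 0"
    using test_support[OF K, of \<Omega>] by metis
  obtain C where C: "C > 0" "AE z in lebesgue_on K'. \<bar>f z\<bar> \<le> C" using Linf_on_compact[OF f K'] by metis
  define V where "V = measure (lebesgue_on K') (space (lebesgue_on K'))"
  interpret finite_measure "lebesgue_on K'" by (rule finite_measure_lebesgue_on_compact[OF K'(1)])
  have "integrable (Gam \<Omega> ts) (\<lambda>z. f z * \<psi> z) \<and> \<bar>reg \<Omega> ts f \<psi>\<bar> \<le> V * C * B"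
    if \<psi>: "continuous_on UNIV \<psi>" "supp_in \<Omega> K \<psi>" "\<And>z. \<bar>\<psi> z\<bar> \<le> B" for \<psi> B
  proof -
    define h where "h z = f z * (indicator (slab \<Omega>) z * \<psi> z)" for z
    have hm: "h \<in> borel_measurable (lebesgue_on K')" unfolding h_def
      by (intro borel_measurable_times[OF Linf_measurable_on[OF f K']] slab_test_measurable \<psi>)
    have ae: "AE z in lebesgue_on K'. \<bar>h z\<bar> \<le> C * B"
      using C(2)
    proof eventually_elim
      case (elim z)
      have "\<bar>f z\<bar> * (indicator (slab \<Omega>) z * \<bar>\<psi> z\<bar>) \<le> C * (1 * B)"
        using elim \<psi>(3)[of z] C(1) by (intro mult_mono) (auto simp: indicator_def)
      thus ?case unfolding h_def by (simp add: abs_mult)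
    qed
    have i: "integrable (lebesgue_on K') h" by (rule bounded_integrable_compact[OF K'(1) hm ae])
    have "\<bar>\<integral>z. h z \<partial>lebesgue_on K'\<bar> \<le> (\<integral>z. \<bar>h z\<bar> \<partial>lebesgue_on K')" by (rule integral_abs_bound)
    also have "\<dots> \<le> (\<integral>z. C * B \<partial>lebesgue_on K')"
      using i ae by (intro integral_mono_AE) auto
    also have "\<dots> = V * C * B" unfolding V_def by simp
    finally show ?thesis using i reg_eq_on_compact[OF K'(1) v[OF \<psi>(2)] K'(2), where f = f] unfolding h_def by auto
  qed
  thus ?thesis using that by blast
qed

lemma test_fun_pd:
  assumes "test_fun \<Omega> ts \<phi>" "b \<in> Basis" shows "test_fun \<Omega> ts (pd b \<phi>)"
proof -
  obtain K where "smooth \<phi>" "periodic \<Omega> \<phi>" "compact K" "K \<subseteq> UNIV \<times> time_interval ts" "supp_in \<Omega> K \<phi>"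
    using test_funE[OF assms(1)] .
  thus ?thesis unfolding test_fun_def
    using smooth_pd assms(2) periodic_pd smooth_differentiable supp_in_pd by metis
qed

lemma test_fun_continuous: "test_fun \<Omega> ts \<phi> \<Longrightarrow> continuous_on UNIV \<phi>"
  unfolding test_fun_def using smooth_continuous by blast

lemma test_fun_bounded:
  assumes "test_fun \<Omega> ts \<phi>" obtains M where "\<And>z. \<bar>\<phi> z\<bar> \<le> M"
proof -
  obtain K where K: "smooth \<phi>" "periodic \<Omega> \<phi>" "compact K" "supp_in \<Omega> K \<phi>"
    using test_funE[OF assms] .
  show ?thesis using periodic_bounded[OF K(2) smooth_continuous[OF K(1)] K(3,4)] that by metis
qed

lemma reg_integrable:
  fixes f :: "(real^'n) \<times> real \<Rightarrow> real"
  assumes f: "Linf \<Omega> ts f" and \<phi>: "test_fun \<Omega> ts \<phi>"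
  shows "integrable (Gam \<Omega> ts) (\<lambda>z. f z * \<phi> z)"
proof -
  obtain K where K: "smooth \<phi>" "periodic \<Omega> \<phi>" "compact K" "K \<subseteq> UNIV \<times> time_interval ts" "supp_in \<Omega> K \<phi>"
    using test_funE[OF \<phi>] .
  obtain M where "\<And>z. \<bar>\<phi> z\<bar> \<le> M" using test_fun_bounded[OF \<phi>] by metis
  with reg_bound[OF f K(3,4)] K(5) test_fun_continuous[OF \<phi>] show ?thesis by metis
qed

lemma reg_add_right: "Linf \<Omega> ts f \<Longrightarrow> test_fun \<Omega> ts \<phi> \<Longrightarrow> test_fun \<Omega> ts \<psi> \<Longrightarrow>
    reg \<Omega> ts f (\<lambda>z. \<phi> z + \<psi> z) = reg \<Omega> ts f \<phi> + reg \<Omega> ts f \<psi>"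
  unfolding reg_def distrib_left by (intro Bochner_Integration.integral_add reg_integrable)

lemma reg_cmult_right: "reg \<Omega> ts f (\<lambda>z. c * \<phi> z) = c * reg \<Omega> ts f \<phi>"
  unfolding reg_def by (subst integral_mult_right_zero[symmetric]) (simp add: algebra_simps)

lemma reg_add_left: "Linf \<Omega> ts f \<Longrightarrow> Linf \<Omega> ts g \<Longrightarrow> test_fun \<Omega> ts \<phi> \<Longrightarrow>
    reg \<Omega> ts (\<lambda>z. f z + g z) \<phi> = reg \<Omega> ts f \<phi> + reg \<Omega> ts g \<phi>"
  unfolding reg_def distrib_right by (intro Bochner_Integration.integral_add reg_integrable)

text \<open>The derivative of a bounded field has order at most one, so bounds on the test function
  and its first derivatives suffice in the continuity clause.\<close>

lemma distribution_minus_reg_pd: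
  fixes f :: "(real^'n) \<times> real \<Rightarrow> real"
  assumes f: "Linf \<Omega> ts f" and b: "b \<in> Basis"
  shows "distribution \<Omega> ts (\<lambda>\<phi>. - reg \<Omega> ts f (pd b \<phi>))"
  unfolding distribution_def
proof (intro conjI allI impI)
  fix \<phi> \<psi> :: "(real^'n) \<times> real \<Rightarrow> real"
  assume \<phi>: "test_fun \<Omega> ts \<phi>" and \<psi>: "test_fun \<Omega> ts \<psi>"
  have "pd b (\<lambda>z. \<phi> z + \<psi> z) = (\<lambda>z. pd b \<phi> z + pd b \<psi> z)"
    using \<phi> \<psi> smooth_differentiable unfolding test_fun_def by (intro ext pd_add) auto
  thus "- reg \<Omega> ts f (pd b (\<lambda>z. \<phi> z + \<psi> z)) = - reg \<Omega> ts f (pd b \<phi>) + - reg \<Omega> ts f (pd b \<psi>)"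
    using reg_add_right[OF f test_fun_pd[OF \<phi> b] test_fun_pd[OF \<psi> b]] by simp
next
  fix c and \<phi> :: "(real^'n) \<times> real \<Rightarrow> real"
  assume \<phi>: "test_fun \<Omega> ts \<phi>"
  have "pd b (\<lambda>z. c * \<phi> z) = (\<lambda>z. c * pd b \<phi> z)"
    using \<phi> smooth_differentiable unfolding test_fun_def by (intro ext pd_cmult) auto
  thus "- reg \<Omega> ts f (pd b (\<lambda>z. c * \<phi> z)) = c * - reg \<Omega> ts f (pd b \<phi>)"
    by (simp add: reg_cmult_right)
next
  fix K :: "((real, 'n) vec \<times> real) set" assume "compact K \<and> K \<subseteq> UNIV \<times> time_interval ts"
  hence K: "compact K" "K \<subseteq> UNIV \<times> time_interval ts" by auto
  obtain V where V: "\<And>\<psi> B. continuous_on UNIV \<psi> \<Longrightarrow> supp_in \<Omega> K \<psi> \<Longrightarrow> (\<And>z. \<bar>\<psi> z\<bar> \<le> B) \<Longrightarrow>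
    integrable (Gam \<Omega> ts) (\<lambda>z. f z * \<psi> z) \<and> \<bar>reg \<Omega> ts f \<psi>\<bar> \<le> V * B" using reg_bound[OF f K] by metis
  show "\<exists>C N. \<forall>\<phi> B. test_fun \<Omega> ts \<phi> \<longrightarrow> supp_in \<Omega> K \<phi> \<longrightarrow>
        (\<forall>bs z. set bs \<subseteq> Basis \<longrightarrow> length bs \<le> N \<longrightarrow> \<bar>pds bs \<phi> z\<bar> \<le> B) \<longrightarrow> \<bar>- reg \<Omega> ts f (pd b \<phi>)\<bar> \<le> C * B"
  proof (intro exI allI impI)
    fix \<phi> B assume \<phi>: "test_fun \<Omega> ts \<phi>" "supp_in \<Omega> K \<phi>"
      and B: "\<forall>bs z. set bs \<subseteq> Basis \<longrightarrow> length bs \<le> Suc 0 \<longrightarrow> \<bar>pds bs \<phi> z\<bar> \<le> B"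
    have "\<bar>pd b \<phi> z\<bar> \<le> B" for z using B[rule_format, of "[b]" z] b by simp
    thus "\<bar>- reg \<Omega> ts f (pd b \<phi>)\<bar> \<le> V * B"
      using V[OF test_fun_continuous[OF test_fun_pd[OF \<phi>(1) b]] supp_in_pd[OF K(1) \<phi>(2)]] by simp
  qed
qed

lemma distribution_add:
  assumes D: "distribution \<Omega> ts D" and E: "distribution \<Omega> ts E"
  shows "distribution \<Omega> ts (\<lambda>\<phi>. D \<phi> + E \<phi>)"
  unfolding distribution_def
proof (intro conjI allI impI)
  fix K :: "((real, 'a) vec \<times> real) set" assume K: "compact K \<and> K \<subseteq> UNIV \<times> time_interval ts"
  have bnd: "\<exists>C N. \<forall>\<phi> B. test_fun \<Omega> ts \<phi> \<longrightarrow> supp_in \<Omega> K \<phi> \<longrightarrow>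
        (\<forall>bs z. set bs \<subseteq> Basis \<longrightarrow> length bs \<le> N \<longrightarrow> \<bar>pds bs \<phi> z\<bar> \<le> B) \<longrightarrow> \<bar>F \<phi>\<bar> \<le> C * B"
    if "distribution \<Omega> ts F" for F
    using that K unfolding distribution_def by (elim conjE allE[of _ K] impE) auto
  obtain C N where 1: "\<forall>\<phi> B. test_fun \<Omega> ts \<phi> \<longrightarrow> supp_in \<Omega> K \<phi> \<longrightarrow>
        (\<forall>bs z. set bs \<subseteq> Basis \<longrightarrow> length bs \<le> N \<longrightarrow> \<bar>pds bs \<phi> z\<bar> \<le> B) \<longrightarrow> \<bar>D \<phi>\<bar> \<le> C * B"
    using bnd[OF D] by (elim exE)
  obtain C' N' where 2: "\<forall>\<phi> B. test_fun \<Omega> ts \<phi> \<longrightarrow> supp_in \<Omega> K \<phi> \<longrightarrow>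
        (\<forall>bs z. set bs \<subseteq> Basis \<longrightarrow> length bs \<le> N' \<longrightarrow> \<bar>pds bs \<phi> z\<bar> \<le> B) \<longrightarrow> \<bar>E \<phi>\<bar> \<le> C' * B"
    using bnd[OF E] by (elim exE)
  show "\<exists>C N. \<forall>\<phi> B. test_fun \<Omega> ts \<phi> \<longrightarrow> supp_in \<Omega> K \<phi> \<longrightarrow>
        (\<forall>bs z. set bs \<subseteq> Basis \<longrightarrow> length bs \<le> N \<longrightarrow> \<bar>pds bs \<phi> z\<bar> \<le> B) \<longrightarrow> \<bar>D \<phi> + E \<phi>\<bar> \<le> C * B"
  proof (intro exI allI impI)
    fix \<phi> B assume \<phi>: "test_fun \<Omega> ts \<phi>" "supp_in \<Omega> K \<phi>"
      and B: "\<forall>bs z. set bs \<subseteq> Basis \<longrightarrow> length bs \<le> max N N' \<longrightarrow> \<bar>pds bs \<phi> z\<bar> \<le> B"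
    have "\<bar>D \<phi>\<bar> \<le> C * B" by (rule 1[rule_format, OF \<phi>]) (rule B[rule_format]; simp)
    moreover have "\<bar>E \<phi>\<bar> \<le> C' * B" by (rule 2[rule_format, OF \<phi>]) (rule B[rule_format]; simp)
    ultimately show "\<bar>D \<phi> + E \<phi>\<bar> \<le> (C + C') * B" by (simp add: distrib_right)
  qed
qed (use D E in \<open>simp_all add: distribution_def distrib_left\<close>)

lemma distribution_zero: "distribution \<Omega> ts (\<lambda>\<phi>. 0)"
  unfolding distribution_def by (auto intro!: exI[of _ "0::real"])

lemma distribution_sum: "(\<And>i. i \<in> I \<Longrightarrow> distribution \<Omega> ts (D i)) \<Longrightarrow> distribution \<Omega> ts (\<lambda>\<phi>. \<Sum>i\<in>I. D i \<phi>)"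
  by (induction I rule: infinite_finite_induct) (auto intro: distribution_add distribution_zero)

lemma distribution_ddt: "Linf \<Omega> ts f \<Longrightarrow> distribution \<Omega> ts (ddt (reg \<Omega> ts f))"
  unfolding ddt_def[abs_def] dt_def by (rule distribution_minus_reg_pd) auto

lemma distribution_ddiv: "(\<And>i. Linf \<Omega> ts (\<lambda>z. F z $ i)) \<Longrightarrow> distribution \<Omega> ts (ddiv \<Omega> ts F)"
  unfolding ddiv_def[abs_def] ddx_def dx_def
  by (intro distribution_sum distribution_minus_reg_pd) auto

section \<open>Bounded local convergence in the mean\<close>

text \<open>Local convergence in the mean alone is not preserved by products. The local bound,
  eventually uniform in l, confines all values to a compact set, on which the functions to be
  applied are Lipschitz.\<close>

definition lconv :: "ereal \<Rightarrow> (real \<Rightarrow> (real^'n) \<times> real \<Rightarrow> real) \<Rightarrow> ((real^'n) \<times> real \<Rightarrow> real) \<Rightarrow> bool"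
  where "lconv ts F f \<longleftrightarrow> (\<forall>K. compact K \<longrightarrow> K \<subseteq> UNIV \<times> time_interval ts \<longrightarrow>
    f \<in> borel_measurable (lebesgue_on K) \<and>
    (\<exists>B. (AE z in lebesgue_on K. \<bar>f z\<bar> \<le> B) \<and>
      (\<forall>\<^sub>F l in at_right 0. F l \<in> borel_measurable (lebesgue_on K) \<and> (\<forall>z\<in>K. \<bar>F l z\<bar> \<le> B))) \<and>
    ((\<lambda>l. \<integral>\<^sup>+z. ennreal \<bar>F l z - f z\<bar> \<partial>lebesgue_on K) \<longlongrightarrow> 0) (at_right 0))"

lemma lconvD:
  assumes "lconv ts F f" "compact K" "K \<subseteq> UNIV \<times> time_interval ts"
  obtains B where "f \<in> borel_measurable (lebesgue_on K)" "AE z in lebesgue_on K. \<bar>f z\<bar> \<le> B"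
    "\<forall>\<^sub>F l in at_right 0. F l \<in> borel_measurable (lebesgue_on K) \<and> (\<forall>z\<in>K. \<bar>F l z\<bar> \<le> B)"
    "((\<lambda>l. \<integral>\<^sup>+z. ennreal \<bar>F l z - f z\<bar> \<partial>lebesgue_on K) \<longlongrightarrow> 0) (at_right 0)"
  using assms unfolding lconv_def by blast

lemma lconv_cong:
  assumes F: "lconv ts F f"
    and ev: "\<And>K. compact K \<Longrightarrow> K \<subseteq> UNIV \<times> time_interval ts \<Longrightarrow> \<forall>\<^sub>F l in at_right 0. \<forall>z\<in>K. G l z = F l z"
    and ae: "AE z in lebesgue. snd z \<in> time_interval ts \<longrightarrow> g z = f z"
  shows "lconv ts G g"
  unfolding lconv_def
proof (intro allI impI)
  fix K :: "((real, 'a) vec \<times> real) set" assume K: "compact K" "K \<subseteq> UNIV \<times> time_interval ts"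
  obtain B where B: "f \<in> borel_measurable (lebesgue_on K)" "AE z in lebesgue_on K. \<bar>f z\<bar> \<le> B"
    "\<forall>\<^sub>F l in at_right 0. F l \<in> borel_measurable (lebesgue_on K) \<and> (\<forall>z\<in>K. \<bar>F l z\<bar> \<le> B)"
    "((\<lambda>l. \<integral>\<^sup>+z. ennreal \<bar>F l z - f z\<bar> \<partial>lebesgue_on K) \<longlongrightarrow> 0) (at_right 0)" by (rule lconvD[OF F K])
  interpret complete_measure "lebesgue_on K" by (rule complete_measure_lebesgue_on) (simp add: K)
  have aeK: "AE z in lebesgue_on K. g z = f z" by (rule AE_on_compact[OF ae K])
  hence aeK': "AE z in lebesgue_on K. f z = g z" by eventually_elim simp
  show "g \<in> borel_measurable (lebesgue_on K) \<and>
    (\<exists>B. (AE z in lebesgue_on K. \<bar>g z\<bar> \<le> B) \<and>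
      (\<forall>\<^sub>F l in at_right 0. G l \<in> borel_measurable (lebesgue_on K) \<and> (\<forall>z\<in>K. \<bar>G l z\<bar> \<le> B))) \<and>
    ((\<lambda>l. \<integral>\<^sup>+z. ennreal \<bar>G l z - g z\<bar> \<partial>lebesgue_on K) \<longlongrightarrow> 0) (at_right 0)"
  proof (intro conjI exI[of _ B])
    show "g \<in> borel_measurable (lebesgue_on K)" by (rule borel_measurable_cong_AE[OF B(1) aeK'])
    show "AE z in lebesgue_on K. \<bar>g z\<bar> \<le> B" using B(2) aeK by eventually_elim simp
    show "\<forall>\<^sub>F l in at_right 0. G l \<in> borel_measurable (lebesgue_on K) \<and> (\<forall>z\<in>K. \<bar>G l z\<bar> \<le> B)"
      using ev[OF K] B(3)
    proof eventually_elim
      case (elim l)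
      have "G l \<in> borel_measurable (lebesgue_on K) \<longleftrightarrow> F l \<in> borel_measurable (lebesgue_on K)"
        using elim by (intro measurable_cong) simp
      thus ?case using elim by simp
    qed
    show "((\<lambda>l. \<integral>\<^sup>+z. ennreal \<bar>G l z - g z\<bar> \<partial>lebesgue_on K) \<longlongrightarrow> 0) (at_right 0)"
    proof (rule Lim_transform_eventually[OF B(4)])
      show "\<forall>\<^sub>F l in at_right 0. (\<integral>\<^sup>+z. ennreal \<bar>F l z - f z\<bar> \<partial>lebesgue_on K) = (\<integral>\<^sup>+z. ennreal \<bar>G l z - g z\<bar> \<partial>lebesgue_on K)"
        using ev[OF K]
      proof eventually_elim
        case (elim l)
        show ?case
        proof (rule nn_integral_cong_AE)
          show "AE z in lebesgue_on K. ennreal \<bar>F l z - f z\<bar> = ennreal \<bar>G l z - g z\<bar>"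
            using aeK AE_space by eventually_elim (use elim in simp)
        qed
      qed
    qed
  qed
qed

text \<open>The bounds confine all values to a square, and H is Lipschitz on its intersection with
  C; so convergence in the mean is inherited with the Lipschitz constant as a factor. Closedness of
  C makes H Borel after cutting off and bounded on that compact intersection.\<close>

lemma lconv_compose:
  fixes H :: "real \<times> real \<Rightarrow> real"
  assumes F: "lconv ts F f" and G: "lconv ts G g" and C: "closed C" "continuous_on C H"
    and Lip: "\<And>B. \<exists>L. \<forall>x1 x2 y1 y2. (x1, x2) \<in> C \<longrightarrow> (y1, y2) \<in> C \<longrightarrow> \<bar>x1\<bar> \<le> B \<longrightarrow> \<bar>x2\<bar> \<le> B \<longrightarrow> \<bar>y1\<bar> \<le> B \<longrightarrow> \<bar>y2\<bar> \<le> B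
       \<longrightarrow> \<bar>H (x1, x2) - H (y1, y2)\<bar> \<le> L * (\<bar>x1 - y1\<bar> + \<bar>x2 - y2\<bar>)"
    and ae: "AE z in lebesgue. snd z \<in> time_interval ts \<longrightarrow> (f z, g z) \<in> C"
    and ev: "\<And>K. compact K \<Longrightarrow> K \<subseteq> UNIV \<times> time_interval ts \<Longrightarrow> \<forall>\<^sub>F l in at_right 0. \<forall>z\<in>K. (F l z, G l z) \<in> C"
  shows "lconv ts (\<lambda>l z. H (F l z, G l z)) (\<lambda>z. H (f z, g z))"
  unfolding lconv_def
proof (intro allI impI)
  fix K :: "((real, 'a) vec \<times> real) set" assume K: "compact K" "K \<subseteq> UNIV \<times> time_interval ts"
  obtain B1 where B1: "f \<in> borel_measurable (lebesgue_on K)" "AE z in lebesgue_on K. \<bar>f z\<bar> \<le> B1"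
    "\<forall>\<^sub>F l in at_right 0. F l \<in> borel_measurable (lebesgue_on K) \<and> (\<forall>z\<in>K. \<bar>F l z\<bar> \<le> B1)"
    "((\<lambda>l. \<integral>\<^sup>+z. ennreal \<bar>F l z - f z\<bar> \<partial>lebesgue_on K) \<longlongrightarrow> 0) (at_right 0)" by (rule lconvD[OF F K])
  obtain B2 where B2: "g \<in> borel_measurable (lebesgue_on K)" "AE z in lebesgue_on K. \<bar>g z\<bar> \<le> B2"
    "\<forall>\<^sub>F l in at_right 0. G l \<in> borel_measurable (lebesgue_on K) \<and> (\<forall>z\<in>K. \<bar>G l z\<bar> \<le> B2)"
    "((\<lambda>l. \<integral>\<^sup>+z. ennreal \<bar>G l z - g z\<bar> \<partial>lebesgue_on K) \<longlongrightarrow> 0) (at_right 0)" by (rule lconvD[OF G K])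
  define B where "B = max B1 B2"
  interpret complete_measure "lebesgue_on K" by (rule complete_measure_lebesgue_on) (simp add: K)
  have aeK: "AE z in lebesgue_on K. (f z, g z) \<in> C" by (rule AE_on_compact[OF ae K])
  obtain L0 where L0: "\<And>x1 x2 y1 y2. (x1, x2) \<in> C \<Longrightarrow> (y1, y2) \<in> C \<Longrightarrow> \<bar>x1\<bar> \<le> B \<Longrightarrow> \<bar>x2\<bar> \<le> B \<Longrightarrow> \<bar>y1\<bar> \<le> B \<Longrightarrow> \<bar>y2\<bar> \<le> B
       \<Longrightarrow> \<bar>H (x1, x2) - H (y1, y2)\<bar> \<le> L0 * (\<bar>x1 - y1\<bar> + \<bar>x2 - y2\<bar>)" using Lip[of B] by metis
  \<comment> \<open>Only a nonnegative constant may be moved through \<open>ennreal\<close>.\<close>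
  define L where "L = max L0 0"
  have L: "\<bar>H (x1, x2) - H (y1, y2)\<bar> \<le> L * (\<bar>x1 - y1\<bar> + \<bar>x2 - y2\<bar>)"
    if "(x1, x2) \<in> C" "(y1, y2) \<in> C" "\<bar>x1\<bar> \<le> B" "\<bar>x2\<bar> \<le> B" "\<bar>y1\<bar> \<le> B" "\<bar>y2\<bar> \<le> B" for x1 x2 y1 y2
  proof -
    have "L0 * (\<bar>x1 - y1\<bar> + \<bar>x2 - y2\<bar>) \<le> L * (\<bar>x1 - y1\<bar> + \<bar>x2 - y2\<bar>)"
      unfolding L_def by (intro mult_right_mono) auto
    with L0[OF that] show ?thesis by linarith
  qed
  have "compact (C \<inter> ({-B..B} \<times> {-B..B}))" using C(1) by (intro closed_Int_compact compact_Times) auto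
  hence "bounded (H ` (C \<inter> ({-B..B} \<times> {-B..B})))"
    by (intro compact_imp_bounded compact_continuous_image continuous_on_subset[OF C(2)]) auto
  then obtain D where D': "\<And>x. x \<in> C \<inter> ({-B..B} \<times> {-B..B}) \<Longrightarrow> \<bar>H x\<bar> \<le> D" by (auto simp: bounded_iff)
  have D: "\<bar>H (x1, x2)\<bar> \<le> D" if "(x1, x2) \<in> C" "\<bar>x1\<bar> \<le> B" "\<bar>x2\<bar> \<le> B" for x1 x2
    by (rule D') (use that in \<open>auto simp: abs_le_iff\<close>)
  have Hm: "(\<lambda>x. indicator C x *\<^sub>R H x) \<in> borel_measurable borel"
    using C by (intro borel_measurable_continuous_on_indicator) auto
  have meas: "(\<lambda>z. H (a z, b z)) \<in> borel_measurable (lebesgue_on K)"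
    if ab: "a \<in> borel_measurable (lebesgue_on K)" "b \<in> borel_measurable (lebesgue_on K)"
      "AE z in lebesgue_on K. (a z, b z) \<in> C" for a b
  proof (rule borel_measurable_cong_AE)
    show "(\<lambda>z. indicator C (a z, b z) *\<^sub>R H (a z, b z)) \<in> borel_measurable (lebesgue_on K)"
      using measurable_compose[OF borel_measurable_Pair[OF ab(1,2)] Hm] .
    show "AE z in lebesgue_on K. indicator C (a z, b z) *\<^sub>R H (a z, b z) = H (a z, b z)"
      using ab(3) by eventually_elim simp
  qed
  have evK: "\<forall>\<^sub>F l in at_right 0. (F l \<in> borel_measurable (lebesgue_on K) \<and> G l \<in> borel_measurable (lebesgue_on K))
     \<and> (\<forall>z\<in>K. (F l z, G l z) \<in> C \<and> \<bar>F l z\<bar> \<le> B \<and> \<bar>G l z\<bar> \<le> B)"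
    using B1(3) B2(3) ev[OF K] by eventually_elim (force simp: B_def)
  show "(\<lambda>z. H (f z, g z)) \<in> borel_measurable (lebesgue_on K) \<and>
    (\<exists>B. (AE z in lebesgue_on K. \<bar>H (f z, g z)\<bar> \<le> B) \<and>
      (\<forall>\<^sub>F l in at_right 0. (\<lambda>z. H (F l z, G l z)) \<in> borel_measurable (lebesgue_on K) \<and> (\<forall>z\<in>K. \<bar>H (F l z, G l z)\<bar> \<le> B))) \<and>
    ((\<lambda>l. \<integral>\<^sup>+z. ennreal \<bar>H (F l z, G l z) - H (f z, g z)\<bar> \<partial>lebesgue_on K) \<longlongrightarrow> 0) (at_right 0)"
  proof (intro conjI exI[of _ D])
    show "(\<lambda>z. H (f z, g z)) \<in> borel_measurable (lebesgue_on K)" by (rule meas[OF B1(1) B2(1) aeK])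
    show "AE z in lebesgue_on K. \<bar>H (f z, g z)\<bar> \<le> D"
      using aeK B1(2) B2(2) by eventually_elim (auto intro!: D simp: B_def)
    show "\<forall>\<^sub>F l in at_right 0. (\<lambda>z. H (F l z, G l z)) \<in> borel_measurable (lebesgue_on K) \<and> (\<forall>z\<in>K. \<bar>H (F l z, G l z)\<bar> \<le> D)"
      using evK
    proof eventually_elim
      case (elim l)
      have "AE z in lebesgue_on K. (F l z, G l z) \<in> C" using AE_space by eventually_elim (use elim in simp)
      thus ?case using elim by (auto intro!: meas D)
    qed
    have lim: "((\<lambda>l. ennreal L * ((\<integral>\<^sup>+z. ennreal \<bar>F l z - f z\<bar> \<partial>lebesgue_on K) + (\<integral>\<^sup>+z. ennreal \<bar>G l z - g z\<bar> \<partial>lebesgue_on K))) \<longlongrightarrow> ennreal L * (0 + 0)) (at_right 0)"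
      by (intro ennreal_tendsto_cmult tendsto_add B1(4) B2(4)) simp
    show "((\<lambda>l. \<integral>\<^sup>+z. ennreal \<bar>H (F l z, G l z) - H (f z, g z)\<bar> \<partial>lebesgue_on K) \<longlongrightarrow> 0) (at_right 0)"
    proof (rule tendsto_sandwich[OF _ _ tendsto_const])
      show "((\<lambda>l. ennreal L * ((\<integral>\<^sup>+z. ennreal \<bar>F l z - f z\<bar> \<partial>lebesgue_on K) + (\<integral>\<^sup>+z. ennreal \<bar>G l z - g z\<bar> \<partial>lebesgue_on K))) \<longlongrightarrow> 0) (at_right 0)"
        using lim by simp
      show "\<forall>\<^sub>F l in at_right 0. (\<integral>\<^sup>+z. ennreal \<bar>H (F l z, G l z) - H (f z, g z)\<bar> \<partial>lebesgue_on K)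
         \<le> ennreal L * ((\<integral>\<^sup>+z. ennreal \<bar>F l z - f z\<bar> \<partial>lebesgue_on K) + (\<integral>\<^sup>+z. ennreal \<bar>G l z - g z\<bar> \<partial>lebesgue_on K))"
        using evK
      proof eventually_elim
        case (elim l)
        have [measurable]: "F l \<in> borel_measurable (lebesgue_on K)" "G l \<in> borel_measurable (lebesgue_on K)"
          "f \<in> borel_measurable (lebesgue_on K)" "g \<in> borel_measurable (lebesgue_on K)"
          using elim B1(1) B2(1) by auto
        have "(\<integral>\<^sup>+z. ennreal \<bar>H (F l z, G l z) - H (f z, g z)\<bar> \<partial>lebesgue_on K)
          \<le> (\<integral>\<^sup>+z. ennreal L * (ennreal \<bar>F l z - f z\<bar> + ennreal \<bar>G l z - g z\<bar>) \<partial>lebesgue_on K)"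
        proof (rule nn_integral_mono_AE)
          show "AE z in lebesgue_on K. ennreal \<bar>H (F l z, G l z) - H (f z, g z)\<bar>
            \<le> ennreal L * (ennreal \<bar>F l z - f z\<bar> + ennreal \<bar>G l z - g z\<bar>)"
            using aeK B1(2) B2(2) AE_space
          proof eventually_elim
            fix z assume z: "(f z, g z) \<in> C" "\<bar>f z\<bar> \<le> B1" "\<bar>g z\<bar> \<le> B2" "z \<in> space (lebesgue_on K)"
            have "\<bar>H (F l z, G l z) - H (f z, g z)\<bar> \<le> L * (\<bar>F l z - f z\<bar> + \<bar>G l z - g z\<bar>)"
              using elim z by (intro L) (auto simp: B_def)
            hence "ennreal \<bar>H (F l z, G l z) - H (f z, g z)\<bar> \<le> ennreal (L * (\<bar>F l z - f z\<bar> + \<bar>G l z - g z\<bar>))"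
              by (rule ennreal_leI)
            thus "ennreal \<bar>H (F l z, G l z) - H (f z, g z)\<bar> \<le> ennreal L * (ennreal \<bar>F l z - f z\<bar> + ennreal \<bar>G l z - g z\<bar>)"
              by (simp add: ennreal_mult L_def)
          qed
        qed
        also have "\<dots> = ennreal L * ((\<integral>\<^sup>+z. ennreal \<bar>F l z - f z\<bar> \<partial>lebesgue_on K) + (\<integral>\<^sup>+z. ennreal \<bar>G l z - g z\<bar> \<partial>lebesgue_on K))"
          by (simp add: nn_integral_cmult nn_integral_add)
        finally show ?case .
      qed
    qed simp
  qed
qed

lemma lconv_const: "lconv ts (\<lambda>l z. c) (\<lambda>z. c)"
  unfolding lconv_def by (auto intro!: exI[of _ "\<bar>c\<bar>"])

lemma lconv_add: assumes "lconv ts F f" "lconv ts G g" shows "lconv ts (\<lambda>l z. F l z + G l z) (\<lambda>z. f z + g z)"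
proof -
  have "lconv ts (\<lambda>l z. fst (F l z, G l z) + snd (F l z, G l z)) (\<lambda>z. fst (f z, g z) + snd (f z, g z))"
  proof (rule lconv_compose[OF assms closed_UNIV, of "\<lambda>x. fst x + snd x"])
    show "\<exists>L. \<forall>x1 x2 y1 y2. (x1, x2) \<in> UNIV \<longrightarrow> (y1, y2) \<in> UNIV \<longrightarrow> \<bar>x1\<bar> \<le> B \<longrightarrow> \<bar>x2\<bar> \<le> B \<longrightarrow> \<bar>y1\<bar> \<le> B \<longrightarrow> \<bar>y2\<bar> \<le> B
       \<longrightarrow> \<bar>fst (x1, x2) + snd (x1, x2) - (fst (y1, y2) + snd (y1, y2))\<bar> \<le> L * (\<bar>x1 - y1\<bar> + \<bar>x2 - y2\<bar>)" for B :: real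
      by (intro exI[of _ 1]) auto
  qed (auto intro!: continuous_intros)
  thus ?thesis by simp
qed

text \<open>Multiplication is Lipschitz on bounded sets only, with the bound itself as constant;
  here the boundedness built into \<open>lconv\<close> is used.\<close>

lemma lconv_mult: assumes "lconv ts F f" "lconv ts G g" shows "lconv ts (\<lambda>l z. F l z * G l z) (\<lambda>z. f z * g z)"
proof -
  have "\<bar>fst (x1, x2) * snd (x1, x2) - fst (y1, y2) * snd (y1, y2)\<bar> \<le> B * (\<bar>x1 - y1\<bar> + \<bar>x2 - y2\<bar>)"
    if "\<bar>x1\<bar> \<le> B" "\<bar>x2\<bar> \<le> B" "\<bar>y1\<bar> \<le> B" "\<bar>y2\<bar> \<le> B" for x1 x2 y1 y2 B :: real
  proof -
    have "x1 * x2 - y1 * y2 = x2 * (x1 - y1) + y1 * (x2 - y2)" by (simp add: algebra_simps)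
    also have "\<bar>\<dots>\<bar> \<le> \<bar>x2\<bar> * \<bar>x1 - y1\<bar> + \<bar>y1\<bar> * \<bar>x2 - y2\<bar>" by (rule order_trans[OF abs_triangle_ineq]) (simp add: abs_mult)
    also have "\<dots> \<le> B * \<bar>x1 - y1\<bar> + B * \<bar>x2 - y2\<bar>" using that by (intro add_mono mult_right_mono) auto
    finally show ?thesis by (simp add: distrib_left)
  qed
  hence L: "\<exists>L. \<forall>x1 x2 y1 y2. (x1, x2) \<in> UNIV \<longrightarrow> (y1, y2) \<in> UNIV \<longrightarrow> \<bar>x1\<bar> \<le> B \<longrightarrow> \<bar>x2\<bar> \<le> B \<longrightarrow> \<bar>y1\<bar> \<le> B \<longrightarrow> \<bar>y2\<bar> \<le> B
       \<longrightarrow> \<bar>fst (x1, x2) * snd (x1, x2) - (fst (y1, y2) * snd (y1, y2))\<bar> \<le> L * (\<bar>x1 - y1\<bar> + \<bar>x2 - y2\<bar>)" for B :: real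
    by blast
  have "lconv ts (\<lambda>l z. fst (F l z, G l z) * snd (F l z, G l z)) (\<lambda>z. fst (f z, g z) * snd (f z, g z))"
    by (rule lconv_compose[OF assms closed_UNIV _ L]) (auto intro!: continuous_intros)
  thus ?thesis by simp
qed

lemma lconv_diff: assumes "lconv ts F f" "lconv ts G g" shows "lconv ts (\<lambda>l z. F l z - G l z) (\<lambda>z. f z - g z)"
  using lconv_add[OF assms(1) lconv_mult[OF lconv_const[of ts "-1"] assms(2)]] by simp

lemma lconv_sum: "(\<And>i. i \<in> I \<Longrightarrow> lconv ts (F i) (f i)) \<Longrightarrow> lconv ts (\<lambda>l z. \<Sum>i\<in>I. F i l z) (\<lambda>z. \<Sum>i\<in>I. f i z)"
  by (induction I rule: infinite_finite_induct) (auto intro: lconv_add lconv_const)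

lemma lconv_divide:
  assumes F: "lconv ts F f" and G: "lconv ts G g" and c: "c > 0"
    and ae: "AE z in lebesgue. snd z \<in> time_interval ts \<longrightarrow> c \<le> g z"
    and ev: "\<And>K. compact K \<Longrightarrow> K \<subseteq> UNIV \<times> time_interval ts \<Longrightarrow> \<forall>\<^sub>F l in at_right 0. \<forall>z\<in>K. c \<le> G l z"
  shows "lconv ts (\<lambda>l z. F l z / G l z) (\<lambda>z. f z / g z)"
proof -
  define C where "C = (UNIV :: real set) \<times> {c..}"
  have "closed C" unfolding C_def by (intro closed_Times) auto
  have Lip: "\<bar>x1 / x2 - y1 / y2\<bar> \<le> ((1 + \<bar>B\<bar> / c) / c) * (\<bar>x1 - y1\<bar> + \<bar>x2 - y2\<bar>)"
    if h: "c \<le> x2" "c \<le> y2" "\<bar>y1\<bar> \<le> B" for x1 x2 y1 y2 B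
  proof -
    have p: "x2 > 0" "y2 > 0" using h c by auto
    \<comment> \<open>In this splitting only y1 needs the bound B and the denominators need only the
      lower bound c. The coefficients 1/c and \<bar>B\<bar>/c^2 add up to the claimed
      constant.\<close>
    have "x1 / x2 - y1 / y2 = (x1 - y1) / x2 + (y1 / y2) * (y2 - x2) / x2"
      using p by (simp add: field_simps)
    also have "\<bar>\<dots>\<bar> \<le> \<bar>x1 - y1\<bar> / x2 + \<bar>y1\<bar> / y2 * \<bar>x2 - y2\<bar> / x2"
      using p by (intro order_trans[OF abs_triangle_ineq]) (simp add: abs_mult abs_minus_commute)
    also have "\<dots> \<le> \<bar>x1 - y1\<bar> / c + \<bar>B\<bar> / c * \<bar>x2 - y2\<bar> / c"
      using h p c by (intro add_mono frac_le mult_mono) auto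
    also have "\<dots> \<le> ((1 + \<bar>B\<bar> / c) / c) * (\<bar>x1 - y1\<bar> + \<bar>x2 - y2\<bar>)"
    proof -
      have "((1 + \<bar>B\<bar> / c) / c) * (\<bar>x1 - y1\<bar> + \<bar>x2 - y2\<bar>) = \<bar>x1 - y1\<bar> / c + \<bar>B\<bar> / c * \<bar>x2 - y2\<bar> / c
        + (\<bar>B\<bar> / c * \<bar>x1 - y1\<bar> / c + \<bar>x2 - y2\<bar> / c)" by (simp add: add_divide_distrib distrib_left distrib_right)
      moreover have "0 \<le> \<bar>B\<bar> / c * \<bar>x1 - y1\<bar> / c + \<bar>x2 - y2\<bar> / c" using c by simp
      ultimately show ?thesis by linarith
    qed
    finally show ?thesis .
  qed
  have "lconv ts (\<lambda>l z. fst (F l z, G l z) / snd (F l z, G l z)) (\<lambda>z. fst (f z, g z) / snd (f z, g z))"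
  proof (rule lconv_compose[OF F G \<open>closed C\<close>, of "\<lambda>x. fst x / snd x"])
    show "continuous_on C (\<lambda>x. fst x / snd x)" using c unfolding C_def by (intro continuous_intros) auto
    show "\<exists>L. \<forall>x1 x2 y1 y2. (x1, x2) \<in> C \<longrightarrow> (y1, y2) \<in> C \<longrightarrow> \<bar>x1\<bar> \<le> B \<longrightarrow> \<bar>x2\<bar> \<le> B \<longrightarrow> \<bar>y1\<bar> \<le> B \<longrightarrow> \<bar>y2\<bar> \<le> B
       \<longrightarrow> \<bar>fst (x1, x2) / snd (x1, x2) - fst (y1, y2) / snd (y1, y2)\<bar> \<le> L * (\<bar>x1 - y1\<bar> + \<bar>x2 - y2\<bar>)" for B
      using Lip unfolding C_def by (intro exI[of _ "(1 + \<bar>B\<bar> / c) / c"]) auto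
  qed (use ae ev in \<open>auto simp: C_def\<close>)
  thus ?thesis by simp
qed

text \<open>The two partial derivatives are bounded on the compact set C, and convexity of C allows
  the mean value inequality inside it; the sum of the bounds is a Lipschitz constant. This is what
  membership of averaged states in a convex subset of U is for.\<close>

lemma lconv_C1:
  fixes h :: "real \<times> real \<Rightarrow> real"
  assumes F: "lconv ts F f" and G: "lconv ts G g" and h: "Ck_on (Suc 0) U h"
    and C: "compact C" "convex C" "C \<subseteq> U"
    and ae: "AE z in lebesgue. snd z \<in> time_interval ts \<longrightarrow> (f z, g z) \<in> C"
    and ev: "\<And>K. compact K \<Longrightarrow> K \<subseteq> UNIV \<times> time_interval ts \<Longrightarrow> \<forall>\<^sub>F l in at_right 0. \<forall>z\<in>K. (F l z, G l z) \<in> C"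
  shows "lconv ts (\<lambda>l z. h (F l z, G l z)) (\<lambda>z. h (f z, g z))"
proof (rule lconv_compose[OF F G compact_imp_closed[OF C(1)] _ _ ae ev])
  show "continuous_on C h" by (rule continuous_on_subset[OF Ck_on_1D(3)[OF h] C(3)])
  have "\<exists>M. \<forall>x\<in>C. \<bar>pd b h x\<bar> \<le> M" if "b \<in> Basis" for b
    using compact_imp_bounded[OF compact_continuous_image[OF continuous_on_subset[OF Ck_on_1D(2)[OF h that] C(3)] C(1)]]
    by (auto simp: bounded_iff)
  from this[of "(1, 0)"] this[of "(0, 1)"] obtain M N
    where M: "\<And>x. x \<in> C \<Longrightarrow> \<bar>pd (1, 0) h x\<bar> \<le> M" and N: "\<And>x. x \<in> C \<Longrightarrow> \<bar>pd (0, 1) h x\<bar> \<le> N"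
    by (auto simp: Basis_prod_def)
  have L: "\<bar>h x - h y\<bar> \<le> (M + N) * norm (x - y)" if xy: "x \<in> C" "y \<in> C" for x y
  proof -
    have "norm (h x - h y) \<le> (M + N) * norm (x - y)"
    proof (rule differentiable_bound[OF C(2)])
      show "(h has_derivative (\<lambda>b. pd b h x)) (at x within C)" if "x \<in> C" for x
        using pd_has_derivative[OF Ck_on_1D(1)[OF h]] that C(3) has_derivative_at_withinI by blast
      show "onorm (\<lambda>b. pd b h x) \<le> M + N" if "x \<in> C" for x
      proof (rule onorm_le)
        fix b :: "real \<times> real"
        obtain b1 b2 where b: "b = (b1, b2)" by (cases b)
        have d: "h differentiable (at x)" using Ck_on_1D(1)[OF h] that C(3) by blast
        interpret linear "\<lambda>b. pd b h x" by (rule has_derivative_linear[OF pd_has_derivative[OF d]])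
        have "pd b h x = b1 * pd (1,0) h x + b2 * pd (0,1) h x"
          using add[of "b1 *\<^sub>R (1,0)" "b2 *\<^sub>R (0,1)"] scaleR[of b1 "(1,0)"] scaleR[of b2 "(0,1)"] by (simp add: b)
        also have "\<bar>\<dots>\<bar> \<le> \<bar>b1\<bar> * \<bar>pd (1,0) h x\<bar> + \<bar>b2\<bar> * \<bar>pd (0,1) h x\<bar>"
          by (rule order_trans[OF abs_triangle_ineq]) (simp add: abs_mult)
        also have "\<dots> \<le> norm b * M + norm b * N"
          using M[OF that] N[OF that] norm_fst_le[of b1 b2] norm_snd_le[of b2 b1] by (intro add_mono mult_mono) (auto simp: b)
        finally show "norm (pd b h x) \<le> (M + N) * norm b" by (simp add: algebra_simps)
      qed
    qed (use xy in auto)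
    thus ?thesis by simp
  qed
  show "\<exists>L. \<forall>x1 x2 y1 y2. (x1, x2) \<in> C \<longrightarrow> (y1, y2) \<in> C \<longrightarrow> \<bar>x1\<bar> \<le> B \<longrightarrow> \<bar>x2\<bar> \<le> B \<longrightarrow> \<bar>y1\<bar> \<le> B \<longrightarrow> \<bar>y2\<bar> \<le> B
       \<longrightarrow> \<bar>h (x1, x2) - h (y1, y2)\<bar> \<le> L * (\<bar>x1 - y1\<bar> + \<bar>x2 - y2\<bar>)" for B
  proof (intro exI allI impI)
    fix x1 x2 y1 y2 assume xy: "(x1, x2) \<in> C" "(y1, y2) \<in> C"
    have "norm (x1 - y1, x2 - y2) \<le> \<bar>x1 - y1\<bar> + \<bar>x2 - y2\<bar>" using norm_Pair_le[of "x1 - y1" "x2 - y2"] by simp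
    moreover have "0 \<le> M + N" using M[OF xy(1)] N[OF xy(1)] by linarith
    ultimately have "(M + N) * norm (x1 - y1, x2 - y2) \<le> (M + N) * (\<bar>x1 - y1\<bar> + \<bar>x2 - y2\<bar>)"
      by (intro mult_left_mono)
    with L[OF xy] show "\<bar>h (x1, x2) - h (y1, y2)\<bar> \<le> (M + N) * (\<bar>x1 - y1\<bar> + \<bar>x2 - y2\<bar>)" by simp
  qed
qed

section \<open>Convergence of averages and integration by parts\<close>

lemma eventually_inner_dom:
  assumes "compact K" "K \<subseteq> UNIV \<times> time_interval ts"
  shows "\<forall>\<^sub>F l in at_right 0. 0 < l \<and> K \<subseteq> inner_dom ts l"
proof -
  obtain e where e: "e > 0" "\<And>l. l < e \<Longrightarrow> K \<subseteq> inner_dom ts l" using compact_subset_inner_dom[OF assms] by metis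
  show ?thesis unfolding eventually_at_right_field using e by (intro exI[of _ e]) auto
qed

lemma continuous_on_compact_measurable:
  fixes f :: "'a::euclidean_space \<Rightarrow> real"
  assumes "compact K" "continuous_on K f" shows "f \<in> borel_measurable (lebesgue_on K)"
  using assms by (intro continuous_imp_measurable_on_sets_lebesgue) auto

lemma lconv_avg:
  fixes f :: "(real^'n) \<times> real \<Rightarrow> real"
  assumes G: "mollifier G" and f: "Linf \<Omega> ts f"
  shows "lconv ts (\<lambda>l. avg G l f) f"
  unfolding lconv_def
proof (intro allI impI)
  fix K :: "((real, 'n) vec \<times> real) set" assume K: "compact K" "K \<subseteq> UNIV \<times> time_interval ts"
  obtain B where B: "rep ts f \<in> borel_measurable borel" "B > 0" "\<And>z. \<bar>rep ts f z\<bar> \<le> B"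
    using bounded_borelE[OF rep(1)[OF f]] by metis
  note ev = eventually_inner_dom[OF K]
  note aeK = Linf_AE_rep[OF f K]
  show "f \<in> borel_measurable (lebesgue_on K) \<and>
    (\<exists>B. (AE z in lebesgue_on K. \<bar>f z\<bar> \<le> B) \<and>
      (\<forall>\<^sub>F l in at_right 0. avg G l f \<in> borel_measurable (lebesgue_on K) \<and> (\<forall>z\<in>K. \<bar>avg G l f z\<bar> \<le> B))) \<and>
    ((\<lambda>l. \<integral>\<^sup>+z. ennreal \<bar>avg G l f z - f z\<bar> \<partial>lebesgue_on K) \<longlongrightarrow> 0) (at_right 0)"
  proof (intro conjI exI[of _ B])
    show "f \<in> borel_measurable (lebesgue_on K)" by (rule Linf_measurable_on[OF f K])
    show "AE z in lebesgue_on K. \<bar>f z\<bar> \<le> B" using aeK by eventually_elim (use B in simp)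
    show "\<forall>\<^sub>F l in at_right 0. avg G l f \<in> borel_measurable (lebesgue_on K) \<and> (\<forall>z\<in>K. \<bar>avg G l f z\<bar> \<le> B)"
      using ev
    proof eventually_elim
      case (elim l)
      hence l: "0 < l" "K \<subseteq> inner_dom ts l" by auto
      have "continuous_on K (avg G l f)" by (rule continuous_on_subset[OF Ck_on_1D(3)[OF avg_C1[OF G l(1) f]] l(2)])
      moreover have "\<bar>avg G l f z\<bar> \<le> B" if "z \<in> K" for z
        using avg_eq_mavg[OF G l(1) f, of z] mavg_bounded[OF smoothing_kernel_scaled[OF G l(1)] B(1,3), of z] l(2) that by auto
      ultimately show ?case using continuous_on_compact_measurable[OF K(1)] by blast
    qed
    show "((\<lambda>l. \<integral>\<^sup>+z. ennreal \<bar>avg G l f z - f z\<bar> \<partial>lebesgue_on K) \<longlongrightarrow> 0) (at_right 0)"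
    proof (rule order_tendstoI)
      fix e :: ennreal assume "0 < e"
      \<comment> \<open>The given e may be infinite; a smaller positive number is finite and can
        serve as a real tolerance.\<close>
      then obtain x where x: "0 < x" "x < e" using dense by blast
      hence "x < top" using less_le_trans[OF x(2) top_greatest] by simp
      define e' where "e' = enn2real x"
      have e': "0 < e'" "ennreal e' < e"
        using x \<open>x < top\<close> unfolding e'_def by (auto simp: enn2real_positive_iff)
      obtain d where d: "0 < d" "d \<le> 1" "\<And>l g. 0 < l \<Longrightarrow> l < d \<Longrightarrow> smoothing_kernel l g \<Longrightarrow>
        (\<integral>\<^sup>+z. ennreal \<bar>mavg g (rep ts f) z - rep ts f z\<bar> * indicator K z \<partial>lborel) \<le> ennreal e'"
        by (rule mavg_L1_conv[OF rep(1)[OF f] K(1) e'(1)]) (rule that)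
      have "\<forall>\<^sub>F l in at_right 0. l < d" unfolding eventually_at_right_field using d(1) by blast
      with ev show "\<forall>\<^sub>F l in at_right 0. (\<integral>\<^sup>+z. ennreal \<bar>avg G l f z - f z\<bar> \<partial>lebesgue_on K) < e"
      proof eventually_elim
        case (elim l)
        hence l: "0 < l" "K \<subseteq> inner_dom ts l" "l < d" by auto
        have "(\<integral>\<^sup>+z. ennreal \<bar>avg G l f z - f z\<bar> \<partial>lebesgue_on K)
          = (\<integral>\<^sup>+z. ennreal \<bar>mavg (scaled G l) (rep ts f) z - rep ts f z\<bar> \<partial>lebesgue_on K)"
        proof (rule nn_integral_cong_AE)
          show "AE z in lebesgue_on K. ennreal \<bar>avg G l f z - f z\<bar> = ennreal \<bar>mavg (scaled G l) (rep ts f) z - rep ts f z\<bar>"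
            using aeK AE_space
          proof eventually_elim
            fix z assume z: "f z = rep ts f z" "z \<in> space (lebesgue_on K)"
            hence "avg G l f z = mavg (scaled G l) (rep ts f) z" using l by (intro avg_eq_mavg[OF G l(1) f]) auto
            with z show "ennreal \<bar>avg G l f z - f z\<bar> = ennreal \<bar>mavg (scaled G l) (rep ts f) z - rep ts f z\<bar>" by simp
          qed
        qed
        also have "\<dots> = (\<integral>\<^sup>+z. ennreal \<bar>mavg (scaled G l) (rep ts f) z - rep ts f z\<bar> * indicator K z \<partial>lborel)"
          using K(1) by (subst nn_integral_restrict_space) (auto simp: nn_integral_completion)
        also have "\<dots> \<le> ennreal e'" by (rule d(3)[OF l(1,3) smoothing_kernel_scaled[OF G l(1)]])
        finally show ?case using e'(2) by simp
      qed
    qed simp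
  qed
qed

text \<open>The difference of the two pairings is at most the supremum of the test function times
  the distance in the mean on a compact set that carries it within the slab.\<close>

lemma lconv_reg:
  assumes F: "lconv ts F f" and \<psi>: "test_fun \<Omega> ts \<psi>"
  shows "((\<lambda>l. reg \<Omega> ts (F l) \<psi>) \<longlongrightarrow> reg \<Omega> ts f \<psi>) (at_right 0)"
proof -
  obtain K where K: "smooth \<psi>" "periodic \<Omega> \<psi>" "compact K" "K \<subseteq> UNIV \<times> time_interval ts" "supp_in \<Omega> K \<psi>"
    using test_funE[OF \<psi>] .
  obtain K' where K': "compact K'" "K' \<subseteq> UNIV \<times> time_interval ts"
    and v0: "\<And>\<psi> z. supp_in \<Omega> K \<psi> \<Longrightarrow> z \<in> slab \<Omega> \<Longrightarrow> z \<notin> K' \<Longrightarrow> \<psi> z = 0"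
    using test_support[OF K(3,4), of \<Omega>] by metis
  note v = v0[OF K(5)]
  obtain M0 where M0: "\<And>z. \<bar>\<psi> z\<bar> \<le> M0" using test_fun_bounded[OF \<psi>] by metis
  define M where "M = M0 + 1"
  have "0 \<le> M0" using order_trans[OF abs_ge_zero M0] .
  hence M: "M > 0" "\<bar>\<psi> z\<bar> \<le> M" for z using M0[of z] unfolding M_def by auto
  obtain B where B: "f \<in> borel_measurable (lebesgue_on K')" "AE z in lebesgue_on K'. \<bar>f z\<bar> \<le> B"
    "\<forall>\<^sub>F l in at_right 0. F l \<in> borel_measurable (lebesgue_on K') \<and> (\<forall>z\<in>K'. \<bar>F l z\<bar> \<le> B)"
    "((\<lambda>l. \<integral>\<^sup>+z. ennreal \<bar>F l z - f z\<bar> \<partial>lebesgue_on K') \<longlongrightarrow> 0) (at_right 0)" by (rule lconvD[OF F K'])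
  define \<eta> where "\<eta> z = indicator (slab \<Omega>) z * \<psi> z" for z
  have \<eta>m: "\<eta> \<in> borel_measurable (lebesgue_on K')" unfolding \<eta>_def by (rule slab_test_measurable[OF smooth_continuous[OF K(1)]])
  have \<eta>M: "\<bar>\<eta> z\<bar> \<le> M" for z using M unfolding \<eta>_def by (auto simp: indicator_def)
  have int: "integrable (lebesgue_on K') (\<lambda>z. a z * \<eta> z)"
    if a: "a \<in> borel_measurable (lebesgue_on K')" "AE z in lebesgue_on K'. \<bar>a z\<bar> \<le> B" for a
  proof (rule bounded_integrable_compact[OF K'(1)])
    show "AE z in lebesgue_on K'. \<bar>a z * \<eta> z\<bar> \<le> \<bar>B\<bar> * M"
      using a(2) by eventually_elim (auto simp: abs_mult intro!: mult_mono \<eta>M)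
  qed (intro borel_measurable_times a \<eta>m)
  have "((\<lambda>l. ennreal M * (\<integral>\<^sup>+z. ennreal \<bar>F l z - f z\<bar> \<partial>lebesgue_on K')) \<longlongrightarrow> ennreal M * 0) (at_right 0)"
    by (intro ennreal_tendsto_cmult B(4)) simp
  hence lim: "((\<lambda>l. ennreal M * (\<integral>\<^sup>+z. ennreal \<bar>F l z - f z\<bar> \<partial>lebesgue_on K')) \<longlongrightarrow> 0) (at_right 0)" by simp
  have "((\<lambda>l. ennreal \<bar>reg \<Omega> ts (F l) \<psi> - reg \<Omega> ts f \<psi>\<bar>) \<longlongrightarrow> 0) (at_right 0)"
  proof (rule tendsto_sandwich[OF _ _ tendsto_const lim])
    show "\<forall>\<^sub>F l in at_right 0. ennreal \<bar>reg \<Omega> ts (F l) \<psi> - reg \<Omega> ts f \<psi>\<bar> \<le> ennreal M * (\<integral>\<^sup>+z. ennreal \<bar>F l z - f z\<bar> \<partial>lebesgue_on K')"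
      using B(3)
    proof eventually_elim
      case (elim l)
      have "AE z in lebesgue_on K'. \<bar>F l z\<bar> \<le> B" using AE_space by eventually_elim (use elim in simp)
      hence i: "integrable (lebesgue_on K') (\<lambda>z. F l z * \<eta> z)" "integrable (lebesgue_on K') (\<lambda>z. f z * \<eta> z)"
        using elim B(1,2) by (auto intro: int)
      have [measurable]: "F l \<in> borel_measurable (lebesgue_on K')" "f \<in> borel_measurable (lebesgue_on K')" using elim B(1) by auto
      have id: "integrable (lebesgue_on K') (\<lambda>z. (F l z - f z) * \<eta> z)"
        unfolding left_diff_distrib by (rule Bochner_Integration.integrable_diff[OF i])
      have "reg \<Omega> ts (F l) \<psi> - reg \<Omega> ts f \<psi> = (\<integral>z. (F l z - f z) * \<eta> z \<partial>lebesgue_on K')"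
        using i reg_eq_on_compact(1)[where \<psi> = \<psi> and f = f, OF K'(1) v K'(2)]
          reg_eq_on_compact(1)[where \<psi> = \<psi> and f = "F l", OF K'(1) v K'(2)]
        unfolding left_diff_distrib \<eta>_def by simp
      also have "ennreal \<bar>\<dots>\<bar> \<le> (\<integral>\<^sup>+z. ennreal \<bar>(F l z - f z) * \<eta> z\<bar> \<partial>lebesgue_on K')"
        using integral_norm_bound_ennreal[OF id] by simp
      also have "\<dots> \<le> (\<integral>\<^sup>+z. ennreal M * ennreal \<bar>F l z - f z\<bar> \<partial>lebesgue_on K')"
      proof (rule nn_integral_mono)
        fix z
        have "\<bar>F l z - f z\<bar> * \<bar>\<eta> z\<bar> \<le> \<bar>F l z - f z\<bar> * M" by (intro mult_left_mono \<eta>M) auto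
        hence "\<bar>(F l z - f z) * \<eta> z\<bar> \<le> M * \<bar>F l z - f z\<bar>" by (simp add: abs_mult mult.commute)
        thus "ennreal \<bar>(F l z - f z) * \<eta> z\<bar> \<le> ennreal M * ennreal \<bar>F l z - f z\<bar>"
          using M(1) by (subst ennreal_mult[symmetric]) (auto intro: ennreal_leI)
      qed
      also have "\<dots> = ennreal M * (\<integral>\<^sup>+z. ennreal \<bar>F l z - f z\<bar> \<partial>lebesgue_on K')"
        by (simp add: nn_integral_cmult)
      finally show ?case .
    qed
  qed simp
  hence "((\<lambda>l. \<bar>reg \<Omega> ts (F l) \<psi> - reg \<Omega> ts f \<psi>\<bar>) \<longlongrightarrow> 0) (at_right 0)"
    by (intro tendsto_ennrealD) auto
  hence "((\<lambda>l. reg \<Omega> ts (F l) \<psi> - reg \<Omega> ts f \<psi>) \<longlongrightarrow> 0) (at_right 0)"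
    by (simp add: tendsto_rabs_zero_iff)
  thus ?thesis by (simp add: LIM_zero_iff)
qed

text \<open>F may behave arbitrarily near the end times; the test function confines the integrand to
  a compact part of \<open>inner_dom\<close>, where continuity gives measurability and a
  bound.\<close>

lemma reg_continuous_integrable:
  fixes F :: "(real^'n) \<times> real \<Rightarrow> real"
  assumes F: "continuous_on (inner_dom ts l) F" and \<psi>: "continuous_on UNIV \<psi>"
    and K: "compact K" "K \<subseteq> UNIV \<times> time_interval ts" "K \<subseteq> inner_dom ts l" "supp_in \<Omega> K \<psi>"
  shows "integrable (Gam \<Omega> ts) (\<lambda>z. F z * \<psi> z)"
proof -
  obtain K' where K': "compact K'" "K' \<subseteq> UNIV \<times> time_interval ts"
    and v: "\<And>\<psi> z. supp_in \<Omega> K \<psi> \<Longrightarrow> z \<in> slab \<Omega> \<Longrightarrow> z \<notin> K' \<Longrightarrow> \<psi> z = 0"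
    and inn: "\<And>l. K \<subseteq> inner_dom ts l \<Longrightarrow> K' \<subseteq> inner_dom ts l"
    using test_support[OF K(1,2), of \<Omega>] by metis
  have c: "continuous_on K' (\<lambda>z. F z * \<psi> z)"
    using continuous_on_subset[OF F inn[OF K(3)]] continuous_on_subset[OF \<psi>] by (intro continuous_on_mult) auto
  obtain B where B: "\<And>z. z \<in> K' \<Longrightarrow> \<bar>F z * \<psi> z\<bar> \<le> B"
    using compact_imp_bounded[OF compact_continuous_image[OF c K'(1)]] by (auto simp: bounded_iff)
  have int: "integrable (lebesgue_on K') (\<lambda>z. F z * (indicator (slab \<Omega>) z * \<psi> z))"
  proof (rule bounded_integrable_compact[OF K'(1)])
    show "(\<lambda>z. F z * (indicator (slab \<Omega>) z * \<psi> z)) \<in> borel_measurable (lebesgue_on K')"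
      by (intro borel_measurable_times[OF continuous_on_compact_measurable[OF K'(1) continuous_on_subset[OF F inn[OF K(3)]]]]
          slab_test_measurable \<psi>)
    show "AE z in lebesgue_on K'. \<bar>F z * (indicator (slab \<Omega>) z * \<psi> z)\<bar> \<le> \<bar>B\<bar>"
      using AE_space
    proof eventually_elim
      fix z assume "z \<in> space (lebesgue_on K')"
      hence "\<bar>F z * \<psi> z\<bar> \<le> B" using B by simp
      thus "\<bar>F z * (indicator (slab \<Omega>) z * \<psi> z)\<bar> \<le> \<bar>B\<bar>" by (auto simp: indicator_def)
    qed
  qed
  have "integrable (Gam \<Omega> ts) (\<lambda>z. F z * \<psi> z)
    \<longleftrightarrow> integrable (lebesgue_on K') (\<lambda>z. F z * (indicator (slab \<Omega>) z * \<psi> z))"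
    by (rule reg_eq_on_compact(2)[OF K'(1) _ K'(2)]) (rule v[OF K(4)])
  with int show ?thesis by (rule iffD2[rotated])
qed

text \<open>Integration by parts. F is regular in \<open>inner_dom\<close> only, but the test
  function vanishes outside the closed set S inside it, so the product is regular everywhere,
  periodic and supported in translates of K; the integral of its derivative is zero.\<close>

lemma reg_pd:
  fixes F :: "(real^'n) \<times> real \<Rightarrow> real"
  assumes F: "Ck_on (Suc 0) (inner_dom ts l) F" "periodic \<Omega> F" and \<phi>: "smooth \<phi>" "periodic \<Omega> \<phi>"
    and K: "compact K" "K \<subseteq> UNIV \<times> time_interval ts" "K \<subseteq> inner_dom ts l" "supp_in \<Omega> K \<phi>" and b: "b \<in> Basis"
  shows "reg \<Omega> ts (pd b F) \<phi> = - reg \<Omega> ts F (pd b \<phi>)"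
proof -
  define h where "h z = F z * \<phi> z" for z
  define S where "S = saturate \<Omega> K"
  have S: "closed S" unfolding S_def by (rule closed_saturate[OF K(1)])
  have SI: "S \<subseteq> inner_dom ts l"
  proof
    fix z assume "z \<in> S"
    then obtain w where "w \<in> K" "snd z = snd w" using saturate_time[of z \<Omega> K] unfolding S_def by auto
    thus "z \<in> inner_dom ts l" using K(3) unfolding inner_dom_def by auto
  qed
  have \<phi>0: "\<phi> z = 0" if "z \<notin> S" for z using K(4) that unfolding supp_in_iff S_def by blast
  have pd0: "pd b \<phi> z = 0" if "z \<notin> S" for z by (rule pd_zero_open[OF S \<phi>0 that])
  have h_out: "h z = 0" if "z \<notin> S" for z using \<phi>0[OF that] unfolding h_def by simp
  have dh_out: "h differentiable (at z)" "pd b h z = 0" if "z \<notin> S" for z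
    using differentiable_cong_open[of "- S" z h "\<lambda>_. 0"] pd_zero_open[OF S h_out that] S that h_out by auto
  have dh_in: "h differentiable (at z)" "pd b h z = F z * pd b \<phi> z + pd b F z * \<phi> z" if "z \<in> inner_dom ts l" for z
    unfolding h_def using Ck_on_1D(1)[OF F(1) that] smooth_differentiable[OF \<phi>(1), of z]
    by (auto intro!: derivative_intros pd_mult)
  have pdh: "pd b h z = F z * pd b \<phi> z + pd b F z * \<phi> z" for z
    using dh_in(2)[of z] dh_out(2)[of z] pd0[of z] \<phi>0[of z] SI by (cases "z \<in> S") auto
  have d: "h differentiable (at z)" for z using dh_in(1)[of z] dh_out(1)[of z] SI by (cases "z \<in> S") auto
  have c: "continuous_on UNIV (pd b h)"
  proof -
    have "continuous_on (inner_dom ts l) (\<lambda>z. F z * pd b \<phi> z + pd b F z * \<phi> z)"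
      by (intro continuous_on_add continuous_on_mult Ck_on_1D(3)[OF F(1)] Ck_on_1D(2)[OF F(1) b]
          smooth_continuous smooth_pd \<phi>(1) b)
    hence 1: "continuous_on (inner_dom ts l) (pd b h)" unfolding pdh[abs_def] .
    have 2: "continuous_on (- S) (pd b h)"
      by (rule continuous_on_eq[OF continuous_on_const[of _ 0]]) (use dh_out(2) in auto)
    have "continuous_on (inner_dom ts l \<union> - S) (pd b h)"
      using 1 2 S open_inner_dom by (intro continuous_on_open_Un) auto
    moreover have "inner_dom ts l \<union> - S = UNIV" using SI by auto
    ultimately show ?thesis by simp
  qed
  have per: "periodic \<Omega> h" using F(2) \<phi>(2) unfolding h_def periodic_def by simp
  have supp: "supp_in \<Omega> K h" using h_out unfolding supp_in_iff S_def by blast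
  have "(\<integral>w. pd b h w \<partial>Gam \<Omega> ts) = 0" by (rule Gam_integral_pd_eq_0[OF d per b c K(1) supp K(2)])
  moreover have "(\<integral>w. pd b h w \<partial>Gam \<Omega> ts) = reg \<Omega> ts F (pd b \<phi>) + reg \<Omega> ts (pd b F) \<phi>"
    unfolding reg_def pdh
  proof (rule Bochner_Integration.integral_add)
    show "integrable (Gam \<Omega> ts) (\<lambda>z. F z * pd b \<phi> z)"
      by (rule reg_continuous_integrable[OF Ck_on_1D(3)[OF F(1)] smooth_continuous[OF smooth_pd[OF \<phi>(1) b]] K(1-3) supp_in_pd[OF K(1,4)]])
    show "integrable (Gam \<Omega> ts) (\<lambda>z. pd b F z * \<phi> z)"
      by (rule reg_continuous_integrable[OF Ck_on_1D(2)[OF F(1) b] smooth_continuous[OF \<phi>(1)] K(1-4)])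
  qed
  ultimately show ?thesis by linarith
qed

section \<open>Coarse-grained balance equations\<close>

text \<open>Derivatives are independent variables here, so the statement is pure algebra. At a
  point, r is the mean density, w the Favre velocity, m the mean momentum, R the mean stress, V the
  mean velocity and P the mean pressure; \<open>dm i j\<close>, \<open>dR i j\<close> and
  \<open>dw i j\<close> are derivatives in direction j, and names with dt are time derivatives. The
  momentum equation is contracted with w, and the mass equation absorbs the terms with half the
  square of w. On the right stand \<open>m i - r * V i\<close>, which is \<open>tau\<close> of
  density and velocity, and \<open>R i j / r - w i * w j\<close>, which is \<open>ftau2\<close> of
  two velocity components.\<close>

lemma kinetic_energy_algebra:
  fixes w m V dP dtm dtw dV :: "'n::finite \<Rightarrow> real" and R dm dw dR :: "'n \<Rightarrow> 'n \<Rightarrow> real"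
  assumes r: "r \<noteq> 0" and m: "\<And>i. m i = r * w i" and dtm: "\<And>i. dtm i = r * dtw i + dtr * w i"
    and mass: "dtr + (\<Sum>j\<in>UNIV. dm j j) = 0"
    and momentum: "\<And>i. dtm i + (\<Sum>j\<in>UNIV. dR i j) + dP i = 0"
    and R: "\<And>i j. R i j = R j i"
  shows "(\<Sum>i\<in>UNIV. 1/2 * (m i * dtw i + dtm i * w i))
      + (\<Sum>j\<in>UNIV. (\<Sum>i\<in>UNIV. R i j * dw i j + dR i j * w i
            - (1/2 * (w i * w i) * dm j j + 1/2 * (w i * dw i j + dw i j * w i) * m j)) + (P * dV j + dP j * V j))
    = P * (\<Sum>j\<in>UNIV. dV j) - ((\<Sum>i\<in>UNIV. dP i / r * (m i - r * V i))
      - r * (\<Sum>i\<in>UNIV. \<Sum>j\<in>UNIV. dw j i * (R i j / r - w i * w j)))"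
proof -
  have t1: "(\<Sum>i\<in>UNIV. 1/2 * (m i * dtw i + dtm i * w i)) = (\<Sum>i\<in>UNIV. w i * dtm i) - dtr * (\<Sum>i\<in>UNIV. 1/2 * (w i * w i))"
    unfolding sum_distrib_left sum_subtractf[symmetric]
    by (intro sum.cong refl) (simp add: m dtm algebra_simps)
  have t2: "(\<Sum>j\<in>UNIV. (\<Sum>i\<in>UNIV. R i j * dw i j + dR i j * w i
            - (1/2 * (w i * w i) * dm j j + 1/2 * (w i * dw i j + dw i j * w i) * m j)) + (P * dV j + dP j * V j))
     = (\<Sum>j\<in>UNIV. \<Sum>i\<in>UNIV. (R i j - r * w i * w j) * dw i j) + (\<Sum>j\<in>UNIV. \<Sum>i\<in>UNIV. dR i j * w i)
       - (\<Sum>j\<in>UNIV. dm j j) * (\<Sum>i\<in>UNIV. 1/2 * (w i * w i)) + P * (\<Sum>j\<in>UNIV. dV j) + (\<Sum>j\<in>UNIV. dP j * V j)"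
  proof -
    have "(\<Sum>i\<in>UNIV. R i j * dw i j + dR i j * w i
            - (1/2 * (w i * w i) * dm j j + 1/2 * (w i * dw i j + dw i j * w i) * m j))
        = (\<Sum>i\<in>UNIV. (R i j - r * w i * w j) * dw i j) + (\<Sum>i\<in>UNIV. dR i j * w i)
          - dm j j * (\<Sum>i\<in>UNIV. 1/2 * (w i * w i))" for j
      unfolding sum_distrib_left sum.distrib[symmetric] sum_subtractf[symmetric]
      by (intro sum.cong refl) (simp add: m algebra_simps)
    thus ?thesis by (simp only: sum.distrib sum_subtractf sum_distrib_right sum_distrib_left[of P])
  qed
  have t3: "(\<Sum>j\<in>UNIV. \<Sum>i\<in>UNIV. dR i j * w i) = (\<Sum>i\<in>UNIV. w i * (\<Sum>j\<in>UNIV. dR i j))"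
    by (subst sum.swap) (simp add: sum_distrib_left mult.commute)
  have t4: "(\<Sum>i\<in>UNIV. w i * dtm i) + (\<Sum>i\<in>UNIV. w i * (\<Sum>j\<in>UNIV. dR i j)) = - (\<Sum>i\<in>UNIV. w i * dP i)"
  proof -
    have "w i * dtm i + w i * (\<Sum>j\<in>UNIV. dR i j) = - (w i * dP i)" for i
    proof -
      have "w i * (dtm i + (\<Sum>j\<in>UNIV. dR i j) + dP i) = 0" using momentum[of i] by simp
      thus ?thesis by (simp add: distrib_left)
    qed
    thus ?thesis by (simp add: sum.distrib[symmetric] sum_negf[symmetric])
  qed
  \<comment> \<open>The mass equation times kinetic energy per unit mass: this cancels what t1 and
    t2 leave over.\<close>
  have t5: "dtr * c + (\<Sum>j\<in>UNIV. dm j j) * c = 0" for c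
    using mass by (metis distrib_right mult_zero_left)
  have t6: "(\<Sum>i\<in>UNIV. dP i / r * (m i - r * V i)) = (\<Sum>i\<in>UNIV. w i * dP i) - (\<Sum>j\<in>UNIV. dP j * V j)"
    unfolding sum_subtractf[symmetric] using r by (intro sum.cong refl) (simp add: m field_simps)
  \<comment> \<open>Here the symmetry of R is used: the index that differentiates w stands first in
    \<open>Qflux\<close> and second in the momentum equation.\<close>
  have t7: "r * (\<Sum>i\<in>UNIV. \<Sum>j\<in>UNIV. dw j i * (R i j / r - w i * w j))
     = (\<Sum>j\<in>UNIV. \<Sum>i\<in>UNIV. (R i j - r * w i * w j) * dw i j)"
    unfolding sum_distrib_left
  proof (intro sum.cong refl)
    fix i j
    show "r * (dw j i * (R i j / r - w i * w j)) = (R j i - r * w j * w i) * dw j i"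
      using r R[of i j] by (simp add: field_simps)
  qed
  show ?thesis unfolding t1 t2 t3 t6 t7 using t4 t5[of "\<Sum>i\<in>UNIV. 1/2 * (w i * w i)"] by linarith
qed

text \<open>Here k and J are subscale kinetic energy and its flux, W and m the mean fluxes of
  internal energy and mass, and u, r, s, \<beta>, la, pp belong to the averaged state. Derivatives
  of s are already expressed by the first law. The mass equation enters with weight la and the
  subscale energy equation with weight \<beta>; the latter trades the mean pressure work and Q for
  divergences.\<close>

lemma entropy_algebra:
  fixes d\<beta> dla du dr V dV J dJ W dW m dm :: "'n::finite \<Rightarrow> real"
  assumes mass: "dtr + (\<Sum>j\<in>UNIV. dm j) = 0"
    and internal: "dtk + (\<Sum>j\<in>UNIV. dJ j) = - dtu - (\<Sum>j\<in>UNIV. dW j) - (P * (\<Sum>j\<in>UNIV. dV j) - Q)"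
    and gibbs: "s = \<beta> * (u + pp) - la * r"
  shows "- (\<beta> * (P - pp) * (\<Sum>j\<in>UNIV. dV j))
      + (((\<Sum>j\<in>UNIV. d\<beta> j * (W j - u * V j)) - (\<Sum>j\<in>UNIV. dla j * (m j - r * V j)))
         + \<beta> * Q + dt\<beta> * k + (\<Sum>j\<in>UNIV. d\<beta> j * J j))
    = (\<beta> * dtu - la * dtr + (\<beta> * dtk + dt\<beta> * k))
      + (\<Sum>j\<in>UNIV. s * dV j + (\<beta> * du j - la * dr j) * V j + (\<beta> * dJ j + d\<beta> j * J j)
        + (\<beta> * (dW j - (u * dV j + du j * V j)) + d\<beta> j * (W j - u * V j))
        - (la * (dm j - (r * dV j + dr j * V j)) + dla j * (m j - r * V j)))"
proof -
  \<comment> \<open>By the Gibbs relation the coefficient of \<open>dV j\<close> is s - \<beta> u +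
    la r = \<beta> pp, which is the resolved pressure part of the inertial term.\<close>
  have 1: "(\<Sum>j\<in>UNIV. s * dV j + (\<beta> * du j - la * dr j) * V j + (\<beta> * dJ j + d\<beta> j * J j)
        + (\<beta> * (dW j - (u * dV j + du j * V j)) + d\<beta> j * (W j - u * V j))
        - (la * (dm j - (r * dV j + dr j * V j)) + dla j * (m j - r * V j)))
    = \<beta> * pp * (\<Sum>j\<in>UNIV. dV j) + \<beta> * (\<Sum>j\<in>UNIV. dJ j) + (\<Sum>j\<in>UNIV. d\<beta> j * J j) + \<beta> * (\<Sum>j\<in>UNIV. dW j)
      + (\<Sum>j\<in>UNIV. d\<beta> j * (W j - u * V j)) - la * (\<Sum>j\<in>UNIV. dm j) - (\<Sum>j\<in>UNIV. dla j * (m j - r * V j))"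
    unfolding sum_distrib_left sum.distrib[symmetric] sum_subtractf[symmetric]
    by (intro sum.cong refl) (simp add: gibbs algebra_simps)
  have 2: "la * dtr + la * (\<Sum>j\<in>UNIV. dm j) = 0" using mass by (metis distrib_left mult_zero_right)
  have 3: "\<beta> * dtk + \<beta> * (\<Sum>j\<in>UNIV. dJ j) = - \<beta> * dtu - \<beta> * (\<Sum>j\<in>UNIV. dW j) - (\<beta> * P * (\<Sum>j\<in>UNIV. dV j) - \<beta> * Q)"
    using arg_cong[OF internal, of "\<lambda>x. \<beta> * x"] by (simp add: algebra_simps)
  show ?thesis unfolding 1 using 2 3 by (simp add: algebra_simps)
qed

text \<open>Expanding the second and third Favre cumulants, all products of means collapse: what
  remains is the mean flux of pressure work and kinetic energy minus the flux of resolved kinetic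
  energy. S stands for the mean of pressure times velocity, RR for the mean of the cubic
  terms.\<close>

lemma energy_flux_algebra:
  fixes R RR :: "'n::finite \<Rightarrow> 'n \<Rightarrow> real" and w m :: "'n \<Rightarrow> real"
  assumes r: "r \<noteq> 0" and m: "\<And>i. m i = r * w i"
  shows "1/2 * r * (\<Sum>i\<in>UNIV. R i i / r - w i * w i) * w j + (S - P * V)
      + 1/2 * r * (\<Sum>i\<in>UNIV. RR i j / r - w i * (R i j / r - w i * w j) - w i * (R i j / r - w i * w j)
          - w j * (R i i / r - w i * w i) - w i * w i * w j)
    = S + (\<Sum>i\<in>UNIV. 1/2 * RR i j) - ((\<Sum>i\<in>UNIV. R i j * w i - 1/2 * (w i * w i) * m j) + P * V)"
proof -
  have "1/2 * r * (\<Sum>i\<in>UNIV. R i i / r - w i * w i) * w j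
      + 1/2 * r * (\<Sum>i\<in>UNIV. RR i j / r - w i * (R i j / r - w i * w j) - w i * (R i j / r - w i * w j)
          - w j * (R i i / r - w i * w i) - w i * w i * w j)
    = (\<Sum>i\<in>UNIV. 1/2 * RR i j) - (\<Sum>i\<in>UNIV. R i j * w i - 1/2 * (w i * w i) * m j)"
    unfolding sum_distrib_left sum_distrib_right sum.distrib[symmetric] sum_subtractf[symmetric]
    using r by (intro sum.cong refl) (simp add: m field_simps)
  thus ?thesis by simp
qed

section \<open>Limits of space-time divergences\<close>

text \<open>E has to be a divergence in \<open>inner_dom\<close> only; at all other points the test
  function vanishes, so the values of E there do not enter.\<close>

lemma C1_periodic_balance_reg:
  fixes F :: "(real^'n) \<times> real \<Rightarrow> real" and \<Phi> :: "'n \<Rightarrow> (real^'n) \<times> real \<Rightarrow> real"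
  assumes F: "Ck_on (Suc 0) (inner_dom ts l) F" "periodic \<Omega> F"
    and \<Phi>: "\<And>j. Ck_on (Suc 0) (inner_dom ts l) (\<Phi> j)" "\<And>j. periodic \<Omega> (\<Phi> j)"
    and E: "\<And>z. z \<in> inner_dom ts l \<Longrightarrow> E z = dt F z + (\<Sum>j\<in>UNIV. dx j (\<Phi> j) z)"
    and \<phi>: "smooth \<phi>" "periodic \<Omega> \<phi>"
    and K: "compact K" "K \<subseteq> UNIV \<times> time_interval ts" "K \<subseteq> inner_dom ts l" "supp_in \<Omega> K \<phi>"
  shows "reg \<Omega> ts E \<phi> = - reg \<Omega> ts F (dt \<phi>) + (\<Sum>j\<in>UNIV. - reg \<Omega> ts (\<Phi> j) (dx j \<phi>))"
    "integrable (Gam \<Omega> ts) (\<lambda>z. E z * \<phi> z)"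
proof -
  have out: "\<phi> z = 0" if "z \<notin> inner_dom ts l" for z
  proof (rule ccontr)
    assume "\<phi> z \<noteq> 0"
    then obtain k where "z + (k, 0) \<in> K" using K(4) unfolding supp_in_def by blast
    hence "z + (k, 0) \<in> inner_dom ts l" using K(3) by blast
    thus False using that unfolding inner_dom_def by simp
  qed
  have eq: "E z * \<phi> z = dt F z * \<phi> z + (\<Sum>j\<in>UNIV. dx j (\<Phi> j) z * \<phi> z)" for z
    using E[of z] out[of z] by (cases "z \<in> inner_dom ts l") (auto simp: distrib_right sum_distrib_right)
  have iF: "integrable (Gam \<Omega> ts) (\<lambda>z. dt F z * \<phi> z)" unfolding dt_def
    by (rule reg_continuous_integrable[OF Ck_on_1D(2)[OF F(1)] smooth_continuous[OF \<phi>(1)] K]) simp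
  have i\<Phi>: "integrable (Gam \<Omega> ts) (\<lambda>z. dx j (\<Phi> j) z * \<phi> z)" for j unfolding dx_def
    by (rule reg_continuous_integrable[OF Ck_on_1D(2)[OF \<Phi>(1)] smooth_continuous[OF \<phi>(1)] K]) simp
  show "integrable (Gam \<Omega> ts) (\<lambda>z. E z * \<phi> z)" unfolding eq by (intro Bochner_Integration.integrable_add Bochner_Integration.integrable_sum iF i\<Phi>)
  have "reg \<Omega> ts E \<phi> = reg \<Omega> ts (dt F) \<phi> + (\<Sum>j\<in>UNIV. reg \<Omega> ts (dx j (\<Phi> j)) \<phi>)"
    unfolding reg_def eq using iF i\<Phi>
    by (simp add: Bochner_Integration.integral_add Bochner_Integration.integral_sum)
  also have "\<dots> = - reg \<Omega> ts F (dt \<phi>) + (\<Sum>j\<in>UNIV. - reg \<Omega> ts (\<Phi> j) (dx j \<phi>))"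
    unfolding dt_def dx_def
    by (simp add: reg_pd[OF F \<phi> K] reg_pd[OF \<Phi> \<phi> K])
  finally show "reg \<Omega> ts E \<phi> = - reg \<Omega> ts F (dt \<phi>) + (\<Sum>j\<in>UNIV. - reg \<Omega> ts (\<Phi> j) (dx j \<phi>))" .
qed

text \<open>After integration by parts the derivatives rest on the fixed test function, and the
  undifferentiated fields converge. The limit depends on f and g alone, which is the source of
  independence of the mollifier.\<close>

lemma balance_limit:
  fixes F :: "real \<Rightarrow> (real^'n) \<times> real \<Rightarrow> real" and \<Phi> :: "real \<Rightarrow> 'n \<Rightarrow> (real^'n) \<times> real \<Rightarrow> real"
  assumes F: "\<And>l. 0 < l \<Longrightarrow> Ck_on (Suc 0) (inner_dom ts l) (F l)" "\<And>l. 0 < l \<Longrightarrow> periodic \<Omega> (F l)"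
    and \<Phi>: "\<And>l j. 0 < l \<Longrightarrow> Ck_on (Suc 0) (inner_dom ts l) (\<Phi> l j)" "\<And>l j. 0 < l \<Longrightarrow> periodic \<Omega> (\<Phi> l j)"
    and E: "\<And>l z. 0 < l \<Longrightarrow> z \<in> inner_dom ts l \<Longrightarrow> E l z = dt (F l) z + (\<Sum>j\<in>UNIV. dx j (\<Phi> l j) z)"
    and lim: "lconv ts F f" "\<And>j. lconv ts (\<lambda>l. \<Phi> l j) (\<lambda>z. g z $ j)"
    and \<phi>: "test_fun \<Omega> ts \<phi>"
  shows "((\<lambda>l. reg \<Omega> ts (E l) \<phi>) \<longlongrightarrow> ddt (reg \<Omega> ts f) \<phi> + ddiv \<Omega> ts g \<phi>) (at_right 0)"
    "\<forall>\<^sub>F l in at_right 0. integrable (Gam \<Omega> ts) (\<lambda>z. E l z * \<phi> z)"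
proof -
  obtain K where K: "smooth \<phi>" "periodic \<Omega> \<phi>" "compact K" "K \<subseteq> UNIV \<times> time_interval ts" "supp_in \<Omega> K \<phi>"
    using test_funE[OF \<phi>] .
  note ev = eventually_inner_dom[OF K(3,4)]
  note bal = C1_periodic_balance_reg[OF F \<Phi> E K(1-4) _ K(5)]
  show "\<forall>\<^sub>F l in at_right 0. integrable (Gam \<Omega> ts) (\<lambda>z. E l z * \<phi> z)"
    using ev by eventually_elim (use bal(2) in blast)
  have dt: "test_fun \<Omega> ts (dt \<phi>)" unfolding dt_def by (rule test_fun_pd[OF \<phi>]) simp
  have dx: "test_fun \<Omega> ts (dx j \<phi>)" for j unfolding dx_def by (rule test_fun_pd[OF \<phi>]) simp
  have "((\<lambda>l. - reg \<Omega> ts (F l) (dt \<phi>) + (\<Sum>j\<in>UNIV. - reg \<Omega> ts (\<Phi> l j) (dx j \<phi>)))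
     \<longlongrightarrow> - reg \<Omega> ts f (dt \<phi>) + (\<Sum>j\<in>UNIV. - reg \<Omega> ts (\<lambda>z. g z $ j) (dx j \<phi>))) (at_right 0)"
    by (intro tendsto_intros lconv_reg[OF lim(1) dt] lconv_reg[OF lim(2) dx])
  hence "((\<lambda>l. reg \<Omega> ts (E l) \<phi>) \<longlongrightarrow> - reg \<Omega> ts f (dt \<phi>) + (\<Sum>j\<in>UNIV. - reg \<Omega> ts (\<lambda>z. g z $ j) (dx j \<phi>))) (at_right 0)"
  proof (rule Lim_transform_eventually)
    show "\<forall>\<^sub>F l in at_right 0. - reg \<Omega> ts (F l) (dt \<phi>) + (\<Sum>j\<in>UNIV. - reg \<Omega> ts (\<Phi> l j) (dx j \<phi>)) = reg \<Omega> ts (E l) \<phi>"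
      using ev by eventually_elim (use bal(1) in \<open>auto intro: sym\<close>)
  qed
  thus "((\<lambda>l. reg \<Omega> ts (E l) \<phi>) \<longlongrightarrow> ddt (reg \<Omega> ts f) \<phi> + ddiv \<Omega> ts g \<phi>) (at_right 0)"
    unfolding ddt_def ddiv_def ddx_def .
qed

section \<open>The averaged Euler flow\<close>

text \<open>C is a compact convex set of states inside the domain U of the thermodynamic functions;
  the closed convex hull of the essential range will be taken. The mollifier is not among the
  parameters but is fixed in inner contexts, so that limits for different mollifiers can be
  compared.\<close>

locale euler_flow =
  fixes \<Omega> :: space_kind and ts :: ereal
    and u \<rho> :: "(real^'n) \<times> real \<Rightarrow> real" and v :: "(real^'n) \<times> real \<Rightarrow> real^'n"
    and s T \<mu> p :: "real \<times> real \<Rightarrow> real" and U C :: "(real \<times> real) set" and \<rho>0 :: real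
  assumes Lu: "Linf \<Omega> ts u" and Lr: "Linf \<Omega> ts \<rho>" and Lv: "Linf \<Omega> ts v"
    and \<rho>0: "\<rho>0 > 0" and \<rho>_ge: "AE z in Gam \<Omega> ts. \<rho> z \<ge> \<rho>0"
    and C: "compact C" "convex C" "C \<subseteq> U" and in_C: "AE z in Gam \<Omega> ts. (u z, \<rho> z) \<in> C"
    and C1: "Ck_on (Suc 0) U p" "Ck_on (Suc 0) U T" "Ck_on (Suc 0) U \<mu>" "Ck_on (Suc 0) U s"
    and thermo: "thermo U s T \<mu> p"
    and euler: "euler_weak \<Omega> ts p u \<rho> v"
begin

abbreviation "vc i \<equiv> (\<lambda>z. v z $ i)"
abbreviation "pf \<equiv> thermo_field p u \<rho>"
abbreviation "kin \<equiv> kinetic \<rho> v"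
abbreviation "mom i \<equiv> (\<lambda>z. \<rho> z * v z $ i)"
text \<open>Bracketed as in the numerator of the Favre average of a product of two velocity
  components, so that unfolding \<open>favre_def\<close> produces this very term.\<close>

abbreviation "stress i j \<equiv> (\<lambda>z. \<rho> z * (v z $ i * v z $ j))"

lemma Lthermo: "Ck_on (Suc 0) U h \<Longrightarrow> Linf \<Omega> ts (thermo_field h u \<rho>)"
  using Linf_thermo_field[OF Lu Lr C(1) _ in_C] continuous_on_subset[OF Ck_on_1D(3) C(3)] by blast

lemma kin_eq: "kin z = (\<Sum>i\<in>UNIV. 1/2 * (\<rho> z * (v z $ i * v z $ i)))"
  unfolding kinetic_def power2_norm_eq_inner inner_vec_def by (simp add: sum_distrib_left)

lemma Lvc: "Linf \<Omega> ts (vc i)" by (rule Linf_component[OF Lv])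
lemma Lp: "Linf \<Omega> ts pf" by (rule Lthermo[OF C1(1)])
lemma Lkin: "Linf \<Omega> ts kin"
  unfolding kin_eq[abs_def] by (intro Linf_sum Linf_mult Linf_const Lr Lvc)
lemma Lmom: "Linf \<Omega> ts (mom i)" by (intro Linf_mult Lr Lvc)
lemma Lstress: "Linf \<Omega> ts (stress i j)" by (intro Linf_mult Lr Lvc)

lemma \<rho>_ge': "AE z in lebesgue. snd z \<in> time_interval ts \<longrightarrow> \<rho>0 \<le> \<rho> z"
  using Lr by (intro AE_periodic[OF \<rho>_ge]) (auto simp: Linf_def periodic_def)

lemma in_C': "AE z in lebesgue. snd z \<in> time_interval ts \<longrightarrow> (u z, \<rho> z) \<in> C"
  using Lu Lr by (intro AE_periodic[OF in_C]) (auto simp: Linf_def periodic_def)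

lemma T_pos: "y \<in> U \<Longrightarrow> T y > 0"
  using thermo unfolding thermo_def by blast

lemma beta_C1: "Ck_on (Suc 0) U (beta T)"
  unfolding beta_def[abs_def] using T_pos by (intro C1_inverse C1(2)) force

lemma lam_C1: "Ck_on (Suc 0) U (lam T \<mu>)"
  unfolding lam_def[abs_def] using T_pos by (intro C1_divide C1) force

lemma gibbs: "y \<in> U \<Longrightarrow> s y = beta T y * (fst y + p y) - lam T \<mu> y * snd y"
proof -
  assume y: "y \<in> U"
  have "T y * s y = fst y + p y - \<mu> y * snd y" using thermo y unfolding thermo_def by blast
  hence "s y = (fst y + p y - \<mu> y * snd y) / T y" using T_pos[OF y] by (simp add: field_simps)
  thus ?thesis unfolding beta_def lam_def by (simp add: diff_divide_distrib)
qed

text \<open>Division by T: the inverse temperature and minus \<open>lam\<close> are the partial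
  derivatives of s, which removes derivatives of s from all later formulas.\<close>

lemma first_law: "y \<in> U \<Longrightarrow> (s has_derivative (\<lambda>h. beta T y * fst h - lam T \<mu> y * snd h)) (at y)"
proof -
  assume y: "y \<in> U"
  obtain ds where ds: "(s has_derivative ds) (at y)" "\<And>h. T y * ds h = fst h - \<mu> y * snd h"
    using thermo y unfolding thermo_def by blast
  have "ds h = beta T y * fst h - lam T \<mu> y * snd h" for h
    using ds(2)[of h] T_pos[OF y] unfolding beta_def lam_def by (simp add: field_simps)
  hence "ds = (\<lambda>h. beta T y * fst h - lam T \<mu> y * snd h)" by blast
  with ds(1) show ?thesis by simp
qed

text \<open>The internal energy of the coarse-grained flow does not contain the subscale kinetic energy.
  Adding the latter, weighted with the inverse temperature, to the resolved entropy turns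
  \<^const>\<open>Sinert_star\<close> into a space-time divergence.\<close>

definition resolved_kinetic :: "((real^'n) \<times> real \<Rightarrow> real) \<Rightarrow> real \<Rightarrow> (real^'n) \<times> real \<Rightarrow> real"
  where "resolved_kinetic G l z = (\<Sum>i\<in>UNIV. 1/2 * (avg G l (mom i) z * favre G l \<rho> (vc i) z))"

text \<open>In terms of cumulants this is the transport of resolved kinetic energy by the Favre
  velocity, the work of the subscale stress, and mean pressure times mean velocity. Writing it with
  averages of the stress avoids cumulants and makes the limit evident.\<close>

definition resolved_kinetic_flux :: "((real^'n) \<times> real \<Rightarrow> real) \<Rightarrow> real \<Rightarrow> 'n \<Rightarrow> (real^'n) \<times> real \<Rightarrow> real"
  where "resolved_kinetic_flux G l j z = (\<Sum>i\<in>UNIV. avg G l (stress i j) z * favre G l \<rho> (vc i) z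
      - 1/2 * (favre G l \<rho> (vc i) z * favre G l \<rho> (vc i) z) * avg G l (mom j) z)
    + avg G l pf z * avg G l (vc j) z"

text \<open>Mean flux of pressure work and kinetic energy minus its resolved part;
  \<open>Jk_eq\<close> identifies it with \<open>Jk\<close>.\<close>

definition subscale_flux :: "((real^'n) \<times> real \<Rightarrow> real) \<Rightarrow> real \<Rightarrow> 'n \<Rightarrow> (real^'n) \<times> real \<Rightarrow> real"
  where "subscale_flux G l j z = avg G l (\<lambda>w. pf w * v w $ j) z + avg G l (\<lambda>w. kin w * v w $ j) z - resolved_kinetic_flux G l j z"

definition corrected_entropy :: "((real^'n) \<times> real \<Rightarrow> real) \<Rightarrow> real \<Rightarrow> (real^'n) \<times> real \<Rightarrow> real"
  where "corrected_entropy G l z = resolved G l s u \<rho> z + resolved G l (beta T) u \<rho> z * (avg G l kin z - resolved_kinetic G l z)"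

text \<open>The last two brackets are the covariances \<open>tau\<close> of internal energy and of
  density with velocity, weighted as in the first law.\<close>

definition corrected_entropy_flux :: "((real^'n) \<times> real \<Rightarrow> real) \<Rightarrow> real \<Rightarrow> 'n \<Rightarrow> (real^'n) \<times> real \<Rightarrow> real"
  where "corrected_entropy_flux G l j z = resolved G l s u \<rho> z * avg G l (vc j) z
    + resolved G l (beta T) u \<rho> z * subscale_flux G l j z
    + resolved G l (beta T) u \<rho> z * (avg G l (\<lambda>w. u w * v w $ j) z - avg G l u z * avg G l (vc j) z)
    - resolved G l (lam T \<mu>) u \<rho> z * (avg G l (mom j) z - avg G l \<rho> z * avg G l (vc j) z)"

section \<open>Bounds and regularity of the averaged quantities\<close>

context
  fixes G :: "(real^'n) \<times> real \<Rightarrow> real" and l :: real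
  assumes G: "mollifier G" and l: "0 < l"
begin

lemma avg_in_C: assumes z: "z \<in> inner_dom ts l" shows "(avg G l u z, avg G l \<rho> z) \<in> C"
  unfolding avg_eq_mavg[OF G l Lu z] avg_eq_mavg[OF G l Lr z]
proof (rule mavg_in_closed_convex[OF smoothing_kernel_scaled[OF G l] rep(1)[OF Lu] rep(1)[OF Lr] C(2) compact_imp_closed[OF C(1)]])
  have "AE w in lebesgue. w \<in> cball z l \<longrightarrow> (rep ts u w, rep ts \<rho> w) \<in> C"
    using rep(2)[OF Lu] rep(2)[OF Lr] in_C'
    by eventually_elim (use inner_dom_cball[OF z] in \<open>auto simp: zext_def\<close>)
  thus "AE w in lborel. w \<in> cball z l \<longrightarrow> (rep ts u w, rep ts \<rho> w) \<in> C" by (simp only: AE_completion_iff)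
qed

text \<open>The convexity lemma for pairs is reused with the density in both components and a
  half-plane as the convex set.\<close>

lemma avg_\<rho>_ge: assumes z: "z \<in> inner_dom ts l" shows "\<rho>0 \<le> avg G l \<rho> z"
proof -
  have "(avg G l \<rho> z, avg G l \<rho> z) \<in> {\<rho>0..} \<times> UNIV"
    unfolding avg_eq_mavg[OF G l Lr z]
  proof (rule mavg_in_closed_convex[OF smoothing_kernel_scaled[OF G l] rep(1)[OF Lr] rep(1)[OF Lr]])
    have "AE w in lebesgue. w \<in> cball z l \<longrightarrow> (rep ts \<rho> w, rep ts \<rho> w) \<in> {\<rho>0..} \<times> UNIV"
      using rep(2)[OF Lr] \<rho>_ge'
      by eventually_elim (use inner_dom_cball[OF z] in \<open>auto simp: zext_def\<close>)
    thus "AE w in lborel. w \<in> cball z l \<longrightarrow> (rep ts \<rho> w, rep ts \<rho> w) \<in> {\<rho>0..} \<times> UNIV" by (simp only: AE_completion_iff)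
  qed (auto intro: convex_Times closed_Times)
  thus ?thesis by simp
qed

lemma avg_\<rho>_pos: "z \<in> inner_dom ts l \<Longrightarrow> avg G l \<rho> z > 0"
  using avg_\<rho>_ge \<rho>0 by fastforce

lemmas avgC1 = avg_C1[OF G l]

lemma favre_C1: "Ck_on (Suc 0) (inner_dom ts l) (favre G l \<rho> (vc i))"
  unfolding favre_def[abs_def] using avg_\<rho>_pos by (intro C1_divide avgC1[OF Lmom] avgC1[OF Lr]) force

lemma resolved_C1: "Ck_on (Suc 0) U h \<Longrightarrow> Ck_on (Suc 0) (inner_dom ts l) (resolved G l h u \<rho>)"
  unfolding resolved_def[abs_def] using avg_in_C C(3) by (intro C1_compose_pair[OF _ avgC1[OF Lu] avgC1[OF Lr]]) blast+

lemma resolved_kinetic_C1: "Ck_on (Suc 0) (inner_dom ts l) (resolved_kinetic G l)"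
  unfolding resolved_kinetic_def[abs_def] by (intro C1_sum C1_mult C1_const favre_C1 avgC1[OF Lmom])

lemma resolved_kinetic_flux_C1: "Ck_on (Suc 0) (inner_dom ts l) (resolved_kinetic_flux G l j)"
  unfolding resolved_kinetic_flux_def[abs_def]
  by (intro C1_add C1_sum C1_diff C1_mult C1_const favre_C1 avgC1[OF Lmom] avgC1[OF Lstress] avgC1[OF Lp] avgC1[OF Lvc])

lemma subscale_flux_C1: "Ck_on (Suc 0) (inner_dom ts l) (subscale_flux G l j)"
  unfolding subscale_flux_def[abs_def]
  by (intro C1_add C1_diff resolved_kinetic_flux_C1 avgC1[OF Linf_mult[OF Lp Lvc]] avgC1[OF Linf_mult[OF Lkin Lvc]])

lemma corrected_entropy_C1: "Ck_on (Suc 0) (inner_dom ts l) (corrected_entropy G l)"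
  unfolding corrected_entropy_def[abs_def]
  by (intro C1_add C1_diff C1_mult resolved_C1 C1(4) beta_C1 resolved_kinetic_C1 avgC1[OF Lkin])

lemma corrected_entropy_flux_C1: "Ck_on (Suc 0) (inner_dom ts l) (corrected_entropy_flux G l j)"
  unfolding corrected_entropy_flux_def[abs_def]
  by (intro C1_add C1_diff C1_mult resolved_C1 C1(4) beta_C1 lam_C1 subscale_flux_C1 avgC1[OF Lvc] avgC1[OF Lu] avgC1[OF Lr]
      avgC1[OF Lmom] avgC1[OF Linf_mult[OF Lu Lvc]])

lemma periodic_avg: "Linf \<Omega> ts f \<Longrightarrow> periodic \<Omega> (avg G l f)"
  by (rule avg_periodic) (simp add: Linf_def)

lemma periodics: "periodic \<Omega> (resolved_kinetic G l)" "periodic \<Omega> (resolved_kinetic_flux G l j)" "periodic \<Omega> (corrected_entropy G l)" "periodic \<Omega> (corrected_entropy_flux G l j)"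
proof -
  note q = periodic_avg[OF Lu] periodic_avg[OF Lr] periodic_avg[OF Lvc] periodic_avg[OF Lp] periodic_avg[OF Lkin]
    periodic_avg[OF Lmom] periodic_avg[OF Lstress] periodic_avg[OF Linf_mult[OF Lu Lvc]]
    periodic_avg[OF Linf_mult[OF Lp Lvc]] periodic_avg[OF Linf_mult[OF Lkin Lvc]]
  show "periodic \<Omega> (resolved_kinetic G l)" "periodic \<Omega> (resolved_kinetic_flux G l j)" "periodic \<Omega> (corrected_entropy G l)" "periodic \<Omega> (corrected_entropy_flux G l j)"
    using q unfolding periodic_def corrected_entropy_def corrected_entropy_flux_def subscale_flux_def resolved_kinetic_def resolved_kinetic_flux_def favre_def resolved_def by simp_all
qed

section \<open>Pointwise balance equations\<close>

context
  fixes z :: "(real^'n) \<times> real"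
  assumes z: "z \<in> inner_dom ts l"
begin

lemma r_nz: "avg G l \<rho> z \<noteq> 0" using avg_\<rho>_pos[OF z] by simp

lemma diffs: "Linf \<Omega> ts f \<Longrightarrow> avg G l f differentiable (at z)"
  using Ck_on_1D(1)[OF avgC1 z] .

lemma diff_favre: "favre G l \<rho> (vc i) differentiable (at z)"
  using Ck_on_1D(1)[OF favre_C1 z] .

lemma diff_resolved: "Ck_on (Suc 0) U h \<Longrightarrow> resolved G l h u \<rho> differentiable (at z)"
  using Ck_on_1D(1)[OF resolved_C1 z] .

lemma weak: "test_fun \<Omega> ts (perker \<Omega> (scaled G l) z)"
  by (rule test_fun_perker[OF smoothing_kernel_scaled[OF G l] z])

lemma mass_avg: "dt (avg G l \<rho>) z + (\<Sum>j\<in>UNIV. dx j (avg G l (mom j)) z) = 0"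
proof -
  have "ddt (reg \<Omega> ts \<rho>) (perker \<Omega> (scaled G l) z) + ddiv \<Omega> ts (\<lambda>z. \<rho> z *\<^sub>R v z) (perker \<Omega> (scaled G l) z) = 0"
    using euler weak unfolding euler_weak_def Let_def by blast
  thus ?thesis unfolding ddiv_def by (simp add: ddt_perker[OF Lr G l z] ddx_perker[OF Lmom G l z])
qed

text \<open>The flux splits into stress and, on the diagonal, pressure. Additivity of averages is
  available in \<open>inner_dom\<close> only; since that set is open, it still carries over to
  derivatives at z.\<close>

lemma momentum_avg: "dt (avg G l (mom i)) z + (\<Sum>j\<in>UNIV. dx j (avg G l (stress i j)) z) + dx i (avg G l pf) z = 0"
proof -
  have L: "Linf \<Omega> ts (\<lambda>z. if i = j then pf z else 0)" for j by (cases "i = j") (auto intro: Lp Linf_const)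
  have L': "Linf \<Omega> ts (\<lambda>z. \<rho> z * v z $ i * v z $ j + (if i = j then pf z else 0))" for j
    by (intro Linf_add Linf_mult Lr Lvc L)
  have "ddt (reg \<Omega> ts (mom i)) (perker \<Omega> (scaled G l) z) + (\<Sum>j\<in>UNIV. ddx j (reg \<Omega> ts
       (\<lambda>z. \<rho> z * v z $ i * v z $ j + (if i = j then pf z else 0))) (perker \<Omega> (scaled G l) z)) = 0"
    using euler weak unfolding euler_weak_def Let_def by blast
  hence eq: "dt (avg G l (mom i)) z + (\<Sum>j\<in>UNIV. dx j (avg G l (\<lambda>z. \<rho> z * v z $ i * v z $ j + (if i = j then pf z else 0))) z) = 0"
    by (simp add: ddt_perker[OF Lmom G l z] ddx_perker[OF L' G l z])
  have "dx j (avg G l (\<lambda>z. \<rho> z * v z $ i * v z $ j + (if i = j then pf z else 0))) z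
     = dx j (avg G l (stress i j)) z + (if i = j then dx j (avg G l pf) z else 0)" for j
  proof -
    have "dx j (avg G l (\<lambda>z. \<rho> z * v z $ i * v z $ j + (if i = j then pf z else 0))) z
      = dx j (\<lambda>z. avg G l (stress i j) z + avg G l (\<lambda>z. if i = j then pf z else 0) z) z"
      unfolding dx_def using avg_add[OF G l Lstress L, of _ i j j]
      by (intro pd_cong_open[OF open_inner_dom z]) (simp add: mult.assoc)
    also have "\<dots> = dx j (avg G l (stress i j)) z + dx j (avg G l (\<lambda>z. if i = j then pf z else 0)) z"
      unfolding dx_def by (intro pd_add diffs Lstress L)
    also have "dx j (avg G l (\<lambda>z. if i = j then pf z else 0)) z = (if i = j then dx j (avg G l pf) z else 0)"
      by (simp add: avg_zero[abs_def] dx_def)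
    finally show ?thesis .
  qed
  with eq show ?thesis by (simp add: sum.distrib)
qed

lemma energy_avg: "dt (avg G l kin) z + dt (avg G l u) z + (\<Sum>j\<in>UNIV. dx j (avg G l (\<lambda>w. pf w * v w $ j)) z
    + dx j (avg G l (\<lambda>w. kin w * v w $ j)) z + dx j (avg G l (\<lambda>w. u w * v w $ j)) z) = 0"
proof -
  let ?E = "\<lambda>z. kin z + u z"
  have LE: "Linf \<Omega> ts ?E" by (intro Linf_add Lkin Lu)
  note L = Linf_mult[OF Lp Lvc] Linf_mult[OF Lkin Lvc] Linf_mult[OF Lu Lvc]
  have LF: "Linf \<Omega> ts (\<lambda>z. (pf z + ?E z) * v z $ j)" for j by (intro Linf_add Linf_mult Lkin Lu Lp Lvc)
  have "ddt (reg \<Omega> ts ?E) (perker \<Omega> (scaled G l) z) + ddiv \<Omega> ts (\<lambda>z. (pf z + ?E z) *\<^sub>R v z) (perker \<Omega> (scaled G l) z) = 0"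
    using euler weak unfolding euler_weak_def Let_def by blast
  hence eq: "dt (avg G l ?E) z + (\<Sum>j\<in>UNIV. dx j (avg G l (\<lambda>z. (pf z + ?E z) * v z $ j)) z) = 0"
    unfolding ddiv_def by (simp add: ddt_perker[OF LE G l z] ddx_perker[OF LF G l z])
  have "dt (avg G l ?E) z = dt (\<lambda>z. avg G l kin z + avg G l u z) z"
    unfolding dt_def using avg_add[OF G l Lkin Lu] by (intro pd_cong_open[OF open_inner_dom z])
  also have "\<dots> = dt (avg G l kin) z + dt (avg G l u) z"
    unfolding dt_def by (intro pd_add diffs Lkin Lu)
  finally have 1: "dt (avg G l ?E) z = dt (avg G l kin) z + dt (avg G l u) z" .
  have 2: "dx j (avg G l (\<lambda>z. (pf z + ?E z) * v z $ j)) z = dx j (avg G l (\<lambda>w. pf w * v w $ j)) z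
    + dx j (avg G l (\<lambda>w. kin w * v w $ j)) z + dx j (avg G l (\<lambda>w. u w * v w $ j)) z" for j
  proof -
    have f: "(\<lambda>z. (pf z + ?E z) * v z $ j) = (\<lambda>z. (pf z * v z $ j + kin z * v z $ j) + u z * v z $ j)"
      by (simp add: fun_eq_iff algebra_simps)
    have "dx j (avg G l (\<lambda>z. (pf z + ?E z) * v z $ j)) z = dx j (\<lambda>z. (avg G l (\<lambda>w. pf w * v w $ j) z
       + avg G l (\<lambda>w. kin w * v w $ j) z) + avg G l (\<lambda>w. u w * v w $ j) z) z"
      unfolding dx_def f using avg_add[OF G l Linf_add[OF L(1,2)] L(3)] avg_add[OF G l L(1,2)]
      by (intro pd_cong_open[OF open_inner_dom z]) simp
    also have "\<dots> = dx j (avg G l (\<lambda>w. pf w * v w $ j)) z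
      + dx j (avg G l (\<lambda>w. kin w * v w $ j)) z + dx j (avg G l (\<lambda>w. u w * v w $ j)) z"
      unfolding dx_def using diffs[OF L(1)] diffs[OF L(2)] diffs[OF L(3)] by (simp add: pd_add)
    finally show ?thesis .
  qed
  show ?thesis using eq unfolding 1 2 .
qed

lemma mom_favre: "avg G l (mom i) z = avg G l \<rho> z * favre G l \<rho> (vc i) z"
  unfolding favre_def using r_nz by simp

lemma pd_mom: "pd b (avg G l (mom i)) z = avg G l \<rho> z * pd b (favre G l \<rho> (vc i)) z + pd b (avg G l \<rho>) z * favre G l \<rho> (vc i) z"
proof -
  have "pd b (avg G l (mom i)) z = pd b (\<lambda>z. avg G l \<rho> z * favre G l \<rho> (vc i) z) z"
    unfolding favre_def using avg_\<rho>_pos by (intro pd_cong_open[OF open_inner_dom z]) fastforce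
  thus ?thesis by (simp add: pd_mult diffs[OF Lr] diff_favre)
qed

lemma pd_resolved_kinetic: "pd b (resolved_kinetic G l) z = (\<Sum>i\<in>UNIV. 1/2 * (avg G l (mom i) z * pd b (favre G l \<rho> (vc i)) z
    + pd b (avg G l (mom i)) z * favre G l \<rho> (vc i) z))"
  unfolding resolved_kinetic_def[abs_def] using diffs[OF Lmom] diff_favre
  by (simp only: pd_sum[OF finite] pd_cmult pd_mult differentiable_mult differentiable_const)

lemma pd_resolved_kinetic_flux: "pd b (resolved_kinetic_flux G l j) z = (\<Sum>i\<in>UNIV. avg G l (stress i j) z * pd b (favre G l \<rho> (vc i)) z
       + pd b (avg G l (stress i j)) z * favre G l \<rho> (vc i) z
       - (1/2 * (favre G l \<rho> (vc i) z * favre G l \<rho> (vc i) z) * pd b (avg G l (mom j)) z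
         + 1/2 * (favre G l \<rho> (vc i) z * pd b (favre G l \<rho> (vc i)) z + pd b (favre G l \<rho> (vc i)) z * favre G l \<rho> (vc i) z) * avg G l (mom j) z))
     + (avg G l pf z * pd b (avg G l (vc j)) z + pd b (avg G l pf) z * avg G l (vc j) z)"
proof -
  note d = diffs[OF Lmom] diffs[OF Lstress] diffs[OF Lp] diffs[OF Lvc] diff_favre
  define f where "f i z = avg G l (stress i j) z * favre G l \<rho> (vc i) z
      - 1/2 * (favre G l \<rho> (vc i) z * favre G l \<rho> (vc i) z) * avg G l (mom j) z" for i z
  have df: "f i differentiable (at z)" for i unfolding f_def[abs_def]
    by (intro differentiable_diff differentiable_mult differentiable_const d)
  have pf: "pd b (f i) z = avg G l (stress i j) z * pd b (favre G l \<rho> (vc i)) z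
       + pd b (avg G l (stress i j)) z * favre G l \<rho> (vc i) z
       - (1/2 * (favre G l \<rho> (vc i) z * favre G l \<rho> (vc i) z) * pd b (avg G l (mom j)) z
         + 1/2 * (favre G l \<rho> (vc i) z * pd b (favre G l \<rho> (vc i)) z + pd b (favre G l \<rho> (vc i)) z * favre G l \<rho> (vc i) z) * avg G l (mom j) z)" for i
    unfolding f_def[abs_def] using d
    by (simp only: pd_diff pd_cmult pd_mult differentiable_mult differentiable_const)
  have "resolved_kinetic_flux G l j = (\<lambda>z. (\<Sum>i\<in>UNIV. f i z) + avg G l pf z * avg G l (vc j) z)"
    unfolding resolved_kinetic_flux_def[abs_def] f_def ..
  hence "pd b (resolved_kinetic_flux G l j) z = pd b (\<lambda>z. \<Sum>i\<in>UNIV. f i z) z + pd b (\<lambda>z. avg G l pf z * avg G l (vc j) z) z"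
    using d df by (simp only:) (intro pd_add differentiable_sum differentiable_mult; simp)
  also have "pd b (\<lambda>z. \<Sum>i\<in>UNIV. f i z) z = (\<Sum>i\<in>UNIV. pd b (f i) z)" by (intro pd_sum df) simp
  also have "pd b (\<lambda>z. avg G l pf z * avg G l (vc j) z) z
    = avg G l pf z * pd b (avg G l (vc j)) z + pd b (avg G l pf) z * avg G l (vc j) z"
    by (intro pd_mult d)
  finally show ?thesis unfolding pf .
qed

text \<open>The flux carries mean pressure times the plain mean velocity, while the momentum
  equation yields the pressure gradient times the Favre velocity. The mismatch of the two velocities
  is the first term of \<open>Qflux\<close>; the second is the work of the subscale stress.\<close>

lemma resolved_kinetic_balance:
  "dt (resolved_kinetic G l) z + (\<Sum>j\<in>UNIV. dx j (resolved_kinetic_flux G l j) z)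
    = avg G l pf z * (\<Sum>j\<in>UNIV. dx j (avg G l (vc j)) z) - Qflux G l p u \<rho> v z"
proof -
  have st: "stress i j = stress j i" for i j by (simp add: mult.commute)
  show ?thesis
    unfolding Qflux_def tau_def ftau2_def dt_def dx_def pd_resolved_kinetic pd_resolved_kinetic_flux
    using kinetic_energy_algebra[where r = "avg G l \<rho> z" and m = "\<lambda>i. avg G l (mom i) z"
        and w = "\<lambda>i. favre G l \<rho> (vc i) z" and dtm = "\<lambda>i. pd (0, 1) (avg G l (mom i)) z"
        and dtw = "\<lambda>i. pd (0, 1) (favre G l \<rho> (vc i)) z" and dtr = "pd (0, 1) (avg G l \<rho>) z"
        and dm = "\<lambda>i j. pd (axis j 1, 0) (avg G l (mom i)) z" and dR = "\<lambda>i j. pd (axis j 1, 0) (avg G l (stress i j)) z"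
        and dP = "\<lambda>i. pd (axis i 1, 0) (avg G l pf) z" and R = "\<lambda>i j. avg G l (stress i j) z"
        and dw = "\<lambda>i j. pd (axis j 1, 0) (favre G l \<rho> (vc i)) z" and V = "\<lambda>j. avg G l (vc j) z"
        and dV = "\<lambda>j. pd (axis j 1, 0) (avg G l (vc j)) z" and P = "avg G l pf z",
        OF r_nz mom_favre pd_mom mass_avg[unfolded dt_def dx_def] momentum_avg[unfolded dt_def dx_def]] st
    unfolding favre_def by simp
qed

text \<open>The density in front of the Favre variance cancels its denominators, so the subscale
  kinetic energy is exactly the mean kinetic energy minus the resolved one.\<close>

lemma kflux_eq: "kflux G l \<rho> v z = avg G l kin z - resolved_kinetic G l z"
proof -
  have "avg G l kin z = (\<Sum>i\<in>UNIV. avg G l (\<lambda>z. 1/2 * (\<rho> z * (v z $ i * v z $ i))) z)"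
    unfolding kin_eq[abs_def] by (rule avg_sum[where \<Omega> = \<Omega>, OF G l _ z]) (intro Linf_mult Linf_const Lr Lvc)
  also have "\<dots> = (\<Sum>i\<in>UNIV. 1/2 * avg G l (stress i i) z)" by (simp only: avg_cmult)
  finally have K: "avg G l kin z = (\<Sum>i\<in>UNIV. 1/2 * avg G l (stress i i) z)" .
  have "kflux G l \<rho> v z = 1/2 * avg G l \<rho> z * (\<Sum>i\<in>UNIV. avg G l (stress i i) z / avg G l \<rho> z
      - favre G l \<rho> (vc i) z * favre G l \<rho> (vc i) z)"
    unfolding kflux_def ftau2_def by (simp add: favre_def[of _ _ _ "\<lambda>w. v w $ _ * v w $ _"])
  also have "\<dots> = avg G l kin z - resolved_kinetic G l z"
    unfolding K resolved_kinetic_def mom_favre sum_distrib_left sum_subtractf[symmetric]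
    using r_nz by (intro sum.cong refl) (simp add: field_simps)
  finally show ?thesis .
qed

text \<open>The linear expansion of kinetic energy over components yields the cubic means that occur
  in the third cumulant; the rest is \<open>energy_flux_algebra\<close>.\<close>

lemma Jk_eq: "Jk G l p u \<rho> v z $ j = subscale_flux G l j z"
proof -
  have "avg G l (\<lambda>w. kin w * v w $ j) z = (\<Sum>i\<in>UNIV. avg G l (\<lambda>z. 1/2 * (\<rho> z * (v z $ i * v z $ i * v z $ j))) z)"
    unfolding kin_eq[abs_def] sum_distrib_right mult.assoc
    by (rule avg_sum[where \<Omega> = \<Omega>, OF G l _ z]) (intro Linf_mult Linf_const Lr Lvc)
  also have "\<dots> = (\<Sum>i\<in>UNIV. 1/2 * avg G l (\<lambda>z. \<rho> z * (v z $ i * v z $ i * v z $ j)) z)" by (simp only: avg_cmult)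
  finally have X: "avg G l (\<lambda>w. kin w * v w $ j) z = (\<Sum>i\<in>UNIV. 1/2 * avg G l (\<lambda>z. \<rho> z * (v z $ i * v z $ i * v z $ j)) z)" .
  show ?thesis
    unfolding Jk_def subscale_flux_def resolved_kinetic_flux_def ftau3_def ftau2_def tau_def X
    using energy_flux_algebra[where r = "avg G l \<rho> z" and m = "\<lambda>i. avg G l (mom i) z"
        and w = "\<lambda>i. favre G l \<rho> (vc i) z" and R = "\<lambda>i j. avg G l (stress i j) z" and j = j
        and S = "avg G l (\<lambda>w. pf w * v w $ j) z" and P = "avg G l pf z" and V = "avg G l (vc j) z"
        and RR = "\<lambda>i j. avg G l (\<lambda>z. \<rho> z * (v z $ i * v z $ i * v z $ j)) z", OF r_nz mom_favre]
    by (simp add: favre_def[of _ _ _ "\<lambda>w. v w $ _ * v w $ _"] favre_def[of _ _ _ "\<lambda>w. v w $ _ * v w $ _ * v w $ _"])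
qed

text \<open>The first law at the averaged state, which lies in C and hence in U.\<close>

lemma pd_resolved_s: "pd b (resolved G l s u \<rho>) z
    = resolved G l (beta T) u \<rho> z * pd b (avg G l u) z - resolved G l (lam T \<mu>) u \<rho> z * pd b (avg G l \<rho>) z"
proof -
  have "(avg G l u z, avg G l \<rho> z) \<in> U" using avg_in_C[OF z] C(3) by blast
  from has_derivative_compose_pair[OF diffs[OF Lu] diffs[OF Lr] first_law[OF this]]
  show ?thesis unfolding resolved_def[abs_def] by (auto intro!: pd_eqI[THEN trans])
qed

lemma pd_corrected_entropy: "pd b (corrected_entropy G l) z = resolved G l (beta T) u \<rho> z * pd b (avg G l u) z
      - resolved G l (lam T \<mu>) u \<rho> z * pd b (avg G l \<rho>) z
    + (resolved G l (beta T) u \<rho> z * (pd b (avg G l kin) z - pd b (resolved_kinetic G l) z)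
      + pd b (resolved G l (beta T) u \<rho>) z * (avg G l kin z - resolved_kinetic G l z))"
  unfolding corrected_entropy_def[abs_def]
  using diffs[OF Lkin] Ck_on_1D(1)[OF resolved_kinetic_C1 z] diff_resolved[OF beta_C1] diff_resolved[OF C1(4)]
  by (simp add: pd_add pd_diff pd_mult differentiable_mult differentiable_diff pd_resolved_s)

lemma pd_subscale_flux: "pd b (subscale_flux G l j) z = pd b (avg G l (\<lambda>w. pf w * v w $ j)) z + pd b (avg G l (\<lambda>w. kin w * v w $ j)) z - pd b (resolved_kinetic_flux G l j) z"
  unfolding subscale_flux_def[abs_def]
  using diffs[OF Linf_mult[OF Lp Lvc]] diffs[OF Linf_mult[OF Lkin Lvc]] Ck_on_1D(1)[OF resolved_kinetic_flux_C1 z]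
  by (simp add: pd_add pd_diff differentiable_add)

lemma pd_corrected_entropy_flux: "pd b (corrected_entropy_flux G l j) z = resolved G l s u \<rho> z * pd b (avg G l (vc j)) z
      + (resolved G l (beta T) u \<rho> z * pd b (avg G l u) z - resolved G l (lam T \<mu>) u \<rho> z * pd b (avg G l \<rho>) z) * avg G l (vc j) z
    + (resolved G l (beta T) u \<rho> z * pd b (subscale_flux G l j) z + pd b (resolved G l (beta T) u \<rho>) z * subscale_flux G l j z)
    + (resolved G l (beta T) u \<rho> z * (pd b (avg G l (\<lambda>w. u w * v w $ j)) z - (avg G l u z * pd b (avg G l (vc j)) z + pd b (avg G l u) z * avg G l (vc j) z))
      + pd b (resolved G l (beta T) u \<rho>) z * (avg G l (\<lambda>w. u w * v w $ j) z - avg G l u z * avg G l (vc j) z))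
    - (resolved G l (lam T \<mu>) u \<rho> z * (pd b (avg G l (mom j)) z - (avg G l \<rho> z * pd b (avg G l (vc j)) z + pd b (avg G l \<rho>) z * avg G l (vc j) z))
      + pd b (resolved G l (lam T \<mu>) u \<rho>) z * (avg G l (mom j) z - avg G l \<rho> z * avg G l (vc j) z))"
  unfolding corrected_entropy_flux_def[abs_def]
  using diffs[OF Lvc] diffs[OF Lu] diffs[OF Lr] diffs[OF Lmom] diffs[OF Linf_mult[OF Lu Lvc]] Ck_on_1D(1)[OF subscale_flux_C1 z]
    diff_resolved[OF beta_C1] diff_resolved[OF lam_C1] diff_resolved[OF C1(4)]
  by (simp only: pd_add pd_diff pd_mult differentiable_add differentiable_diff differentiable_mult pd_resolved_s)

text \<open>Conservation of mean total energy minus the balance of resolved kinetic energy, with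
  internal energy moved to the right. In this form it supplies the assumption
  \<open>internal\<close> of \<open>entropy_algebra\<close>.\<close>

lemma subscale_energy_balance:
  "(dt (avg G l kin) z - dt (resolved_kinetic G l) z) + (\<Sum>j\<in>UNIV. dx j (subscale_flux G l j) z)
    = - dt (avg G l u) z - (\<Sum>j\<in>UNIV. dx j (avg G l (\<lambda>w. u w * v w $ j)) z)
      - (avg G l pf z * (\<Sum>j\<in>UNIV. dx j (avg G l (vc j)) z) - Qflux G l p u \<rho> v z)"
proof -
  have "dx j (subscale_flux G l j) z = dx j (avg G l (\<lambda>w. pf w * v w $ j)) z + dx j (avg G l (\<lambda>w. kin w * v w $ j)) z
      - dx j (resolved_kinetic_flux G l j) z" for j
    unfolding dx_def by (rule pd_subscale_flux)
  thus ?thesis using energy_avg resolved_kinetic_balance by (simp add: sum.distrib sum_subtractf)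
qed

text \<open>The Gibbs relation is applied at the averaged state, so it brings in the resolved
  pressure p(u,\<rho>) of averages and not the mean pressure; the difference of the two is what
  \<open>Iflux\<close> contains.\<close>

lemma entropy_balance:
  "Sinert_star \<Omega> ts G l T \<mu> p u \<rho> v z = dt (corrected_entropy G l) z + (\<Sum>j\<in>UNIV. dx j (corrected_entropy_flux G l j) z)"
proof -
  have "(avg G l u z, avg G l \<rho> z) \<in> U" using avg_in_C[OF z] C(3) by blast
  hence g: "resolved G l s u \<rho> z = resolved G l (beta T) u \<rho> z * (avg G l u z + resolved G l p u \<rho> z)
      - resolved G l (lam T \<mu>) u \<rho> z * avg G l \<rho> z"
    unfolding resolved_def using gibbs by simp
  show ?thesis
    unfolding Sinert_star_def Iflux_def Sflux_star_def Sflux_def tau_def kflux_eq Jk_eq distr_avg_ddiv[OF Lv G l z]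
      dt_def dx_def pd_corrected_entropy pd_corrected_entropy_flux
    using entropy_algebra[where dtr = "dt (avg G l \<rho>) z" and dm = "\<lambda>j. dx j (avg G l (mom j)) z"
      and dtk = "dt (avg G l kin) z - dt (resolved_kinetic G l) z" and dJ = "\<lambda>j. dx j (subscale_flux G l j) z" and dtu = "dt (avg G l u) z"
      and dW = "\<lambda>j. dx j (avg G l (\<lambda>w. u w * v w $ j)) z" and P = "avg G l pf z" and dV = "\<lambda>j. dx j (avg G l (vc j)) z"
      and Q = "Qflux G l p u \<rho> v z" and s = "resolved G l s u \<rho> z" and \<beta> = "resolved G l (beta T) u \<rho> z"
      and u = "avg G l u z" and pp = "resolved G l p u \<rho> z" and la = "resolved G l (lam T \<mu>) u \<rho> z" and r = "avg G l \<rho> z"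
      and d\<beta> = "\<lambda>j. dx j (resolved G l (beta T) u \<rho>) z" and dla = "\<lambda>j. dx j (resolved G l (lam T \<mu>) u \<rho>) z"
      and dt\<beta> = "dt (resolved G l (beta T) u \<rho>) z" and k = "avg G l kin z - resolved_kinetic G l z" and J = "\<lambda>j. subscale_flux G l j z"
      and W = "\<lambda>j. avg G l (\<lambda>w. u w * v w $ j) z" and V = "\<lambda>j. avg G l (vc j) z" and m = "\<lambda>j. avg G l (mom j) z"
      and du = "\<lambda>j. dx j (avg G l u) z" and dr = "\<lambda>j. dx j (avg G l \<rho>) z",
      OF mass_avg subscale_energy_balance g]
    unfolding dt_def dx_def by simp
qed

end

end

section \<open>Limits for a given mollifier\<close>

context
  fixes G :: "(real^'n) \<times> real \<Rightarrow> real"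
  assumes G: "mollifier G"
begin

lemma ev_inner:
  assumes "compact K" "K \<subseteq> UNIV \<times> time_interval ts" "\<And>l z. 0 < l \<Longrightarrow> z \<in> inner_dom ts l \<Longrightarrow> P l z"
  shows "\<forall>\<^sub>F l in at_right 0. \<forall>z\<in>K. P l z"
  using eventually_inner_dom[OF assms(1,2)] by eventually_elim (use assms(3) in blast)

text \<open>Mean momentum and mean density converge to \<rho> v and \<rho>, and the lower bound on
  the density, shared by its averages, permits division.\<close>

lemma lconv_favre: "lconv ts (\<lambda>l. favre G l \<rho> (vc i)) (vc i)"
proof (rule lconv_cong)
  show "lconv ts (\<lambda>l z. avg G l (mom i) z / avg G l \<rho> z) (\<lambda>z. mom i z / \<rho> z)"
    by (rule lconv_divide[OF lconv_avg[OF G Lmom] lconv_avg[OF G Lr] \<rho>0 \<rho>_ge']) (rule ev_inner, assumption+, rule avg_\<rho>_ge[OF G])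
  show "AE z in lebesgue. snd z \<in> time_interval ts \<longrightarrow> vc i z = mom i z / \<rho> z"
    using \<rho>_ge' by eventually_elim (use \<rho>0 in auto)
qed (simp add: favre_def)

lemma lconv_resolved: "Ck_on (Suc 0) U h \<Longrightarrow> lconv ts (\<lambda>l. resolved G l h u \<rho>) (thermo_field h u \<rho>)"
  unfolding resolved_def[abs_def] thermo_field_def[abs_def]
  by (rule lconv_C1[OF lconv_avg[OF G Lu] lconv_avg[OF G Lr] _ C in_C']) (assumption, rule ev_inner, assumption+, rule avg_in_C[OF G])

lemma lconv_resolved_kinetic: "lconv ts (resolved_kinetic G) kin"
  unfolding resolved_kinetic_def[abs_def] kin_eq[abs_def] mult.assoc[symmetric, of "\<rho> _"]
  by (intro lconv_sum lconv_mult lconv_const lconv_favre lconv_avg[OF G Lmom])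

lemma lconv_resolved_kinetic_flux: "lconv ts (\<lambda>l. resolved_kinetic_flux G l j) (\<lambda>z. ((pf z + kin z) *\<^sub>R v z) $ j)"
proof -
  have "((pf z + kin z) *\<^sub>R v z) $ j = (\<Sum>i\<in>UNIV. stress i j z * v z $ i - 1/2 * (v z $ i * v z $ i) * mom j z) + pf z * v z $ j" for z
  proof -
    have "kin z * v z $ j = (\<Sum>i\<in>UNIV. stress i j z * v z $ i - 1/2 * (v z $ i * v z $ i) * mom j z)"
      unfolding kin_eq sum_distrib_right by (intro sum.cong refl) (simp add: algebra_simps)
    thus ?thesis by (simp add: distrib_right)
  qed
  thus ?thesis unfolding resolved_kinetic_flux_def[abs_def]
    by (simp only:) (intro lconv_add lconv_diff lconv_sum lconv_mult lconv_const lconv_favre lconv_avg[OF G Lmom]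
      lconv_avg[OF G Lstress] lconv_avg[OF G Lp] lconv_avg[OF G Lvc])
qed

text \<open>The mean flux and the resolved flux have the same limit, because averages converge
  strongly and all expressions are locally Lipschitz in them. The other subscale terms vanish for
  the same reason.\<close>

lemma lconv_subscale_flux: "lconv ts (\<lambda>l. subscale_flux G l j) (\<lambda>z. 0)"
proof -
  have "lconv ts (\<lambda>l. subscale_flux G l j) (\<lambda>z. pf z * v z $ j + kin z * v z $ j - ((pf z + kin z) *\<^sub>R v z) $ j)"
    unfolding subscale_flux_def[abs_def]
    by (intro lconv_diff lconv_add lconv_resolved_kinetic_flux lconv_avg[OF G Linf_mult[OF Lp Lvc]] lconv_avg[OF G Linf_mult[OF Lkin Lvc]])
  thus ?thesis by (simp add: distrib_right)
qed

lemma lconv_corrected_entropy: "lconv ts (corrected_entropy G) (thermo_field s u \<rho>)"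
proof -
  have "lconv ts (corrected_entropy G) (\<lambda>z. thermo_field s u \<rho> z + thermo_field (beta T) u \<rho> z * (kin z - kin z))"
    unfolding corrected_entropy_def[abs_def]
    by (intro lconv_diff lconv_add lconv_mult lconv_resolved C1(4) beta_C1 lconv_avg[OF G Lkin] lconv_resolved_kinetic)
  thus ?thesis by simp
qed

lemma lconv_corrected_entropy_flux: "lconv ts (\<lambda>l. corrected_entropy_flux G l j) (\<lambda>z. (thermo_field s u \<rho> z *\<^sub>R v z) $ j)"
proof -
  have "lconv ts (\<lambda>l. corrected_entropy_flux G l j) (\<lambda>z. thermo_field s u \<rho> z * v z $ j + thermo_field (beta T) u \<rho> z * 0
    + thermo_field (beta T) u \<rho> z * (u z * v z $ j - u z * v z $ j)
    - thermo_field (lam T \<mu>) u \<rho> z * (mom j z - \<rho> z * v z $ j))"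
    unfolding corrected_entropy_flux_def[abs_def]
    by (intro lconv_diff lconv_add lconv_mult lconv_resolved C1(4) beta_C1 lam_C1 lconv_subscale_flux lconv_avg[OF G Lvc]
        lconv_avg[OF G Lu] lconv_avg[OF G Lr] lconv_avg[OF G Lmom] lconv_avg[OF G Linf_mult[OF Lu Lvc]])
  thus ?thesis by simp
qed

text \<open>The kinetic energy correction and the covariances disappear in the limit, so only the
  entropy and its transport by v remain.\<close>

lemma entropy_production_limit:
  "dlim \<Omega> ts (\<lambda>l. Sinert_star \<Omega> ts G l T \<mu> p u \<rho> v)
    (\<lambda>\<phi>. ddt (reg \<Omega> ts (thermo_field s u \<rho>)) \<phi> + ddiv \<Omega> ts (\<lambda>z. thermo_field s u \<rho> z *\<^sub>R v z) \<phi>)"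
  unfolding dlim_def
  by (intro allI impI balance_limit(1)[where F = "corrected_entropy G" and \<Phi> = "corrected_entropy_flux G"] corrected_entropy_C1[OF G] corrected_entropy_flux_C1[OF G]
      periodics[OF G] entropy_balance[OF G] lconv_corrected_entropy lconv_corrected_entropy_flux)

text \<open>Mean pressure work is a divergence plus \<open>Qflux\<close>. The divergence converges
  by \<open>balance_limit\<close>, and \<open>Qflux\<close> by assumption.\<close>

lemma pressure_work_limit:
  assumes Q: "dlim \<Omega> ts (\<lambda>l. Qflux G l p u \<rho> v) Q"
  shows "dlim \<Omega> ts (\<lambda>l z. avg G l pf z * distr_avg \<Omega> G l (ddiv \<Omega> ts v) z)
    (\<lambda>\<phi>. ddt (reg \<Omega> ts kin) \<phi> + ddiv \<Omega> ts (\<lambda>z. (pf z + kin z) *\<^sub>R v z) \<phi> + Q \<phi>)"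
  unfolding dlim_def
proof (intro allI impI)
  fix \<phi> :: "(real^'n) \<times> real \<Rightarrow> real" assume \<phi>: "test_fun \<Omega> ts \<phi>"
  obtain K where K: "smooth \<phi>" "periodic \<Omega> \<phi>" "compact K" "K \<subseteq> UNIV \<times> time_interval ts" "supp_in \<Omega> K \<phi>"
    using test_funE[OF \<phi>] .
  define W where "W l z = avg G l pf z * distr_avg \<Omega> G l (ddiv \<Omega> ts v) z" for l z
  define E where "E l z = W l z - Qflux G l p u \<rho> v z" for l z
  have E: "E l z = dt (resolved_kinetic G l) z + (\<Sum>j\<in>UNIV. dx j (resolved_kinetic_flux G l j) z)" if "0 < l" "z \<in> inner_dom ts l" for l z
    unfolding E_def W_def distr_avg_ddiv[OF Lv G that] using resolved_kinetic_balance[OF G that] by simp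
  have lim1: "((\<lambda>l. reg \<Omega> ts (E l) \<phi>) \<longlongrightarrow> ddt (reg \<Omega> ts kin) \<phi> + ddiv \<Omega> ts (\<lambda>z. (pf z + kin z) *\<^sub>R v z) \<phi>) (at_right 0)"
    by (intro balance_limit(1)[where F = "resolved_kinetic G" and \<Phi> = "resolved_kinetic_flux G"] resolved_kinetic_C1[OF G] resolved_kinetic_flux_C1[OF G] periodics[OF G] E
        lconv_resolved_kinetic lconv_resolved_kinetic_flux \<phi>)
  have lim2: "\<forall>\<^sub>F l in at_right 0. integrable (Gam \<Omega> ts) (\<lambda>z. E l z * \<phi> z)"
    by (intro balance_limit(2)[where F = "resolved_kinetic G" and \<Phi> = "resolved_kinetic_flux G" and f = kin and g = "\<lambda>z. (pf z + kin z) *\<^sub>R v z"]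
        resolved_kinetic_C1[OF G] resolved_kinetic_flux_C1[OF G] periodics[OF G] E lconv_resolved_kinetic lconv_resolved_kinetic_flux \<phi>)
  have "\<forall>\<^sub>F l in at_right 0. reg \<Omega> ts (E l) \<phi> + reg \<Omega> ts (Qflux G l p u \<rho> v) \<phi> = reg \<Omega> ts (W l) \<phi>"
    using lim2 eventually_inner_dom[OF K(3,4)]
  proof eventually_elim
    case (elim l)
    hence l: "0 < l" "K \<subseteq> inner_dom ts l" and iE: "integrable (Gam \<Omega> ts) (\<lambda>z. E l z * \<phi> z)" by auto
    have "continuous_on (inner_dom ts l) (\<lambda>z. avg G l pf z * (\<Sum>i\<in>UNIV. dx i (avg G l (vc i)) z))"
      unfolding dx_def by (intro continuous_on_mult continuous_on_sum Ck_on_1D(3)[OF avg_C1[OF G l(1) Lp]]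
          Ck_on_1D(2)[OF avg_C1[OF G l(1) Lvc]]) simp
    hence c: "continuous_on (inner_dom ts l) (W l)"
      by (rule continuous_on_eq) (simp add: W_def distr_avg_ddiv[OF Lv G l(1)])
    have iW: "integrable (Gam \<Omega> ts) (\<lambda>z. W l z * \<phi> z)"
      by (rule reg_continuous_integrable[OF c smooth_continuous[OF K(1)] K(3,4) l(2) K(5)])
    \<comment> \<open>Splitting the integral requires integrability. That of \<open>Qflux\<close>
      against the test function is inherited from W and E, so no regularity of its cumulants has to
      be examined.\<close>
    have eq: "Qflux G l p u \<rho> v z * \<phi> z = W l z * \<phi> z - E l z * \<phi> z" for z
      unfolding E_def by (simp add: algebra_simps)
    have "reg \<Omega> ts (Qflux G l p u \<rho> v) \<phi> = reg \<Omega> ts (W l) \<phi> - reg \<Omega> ts (E l) \<phi>"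
      unfolding reg_def eq by (rule Bochner_Integration.integral_diff[OF iW iE])
    thus ?case by simp
  qed
  moreover have "((\<lambda>l. reg \<Omega> ts (E l) \<phi> + reg \<Omega> ts (Qflux G l p u \<rho> v) \<phi>)
     \<longlongrightarrow> ddt (reg \<Omega> ts kin) \<phi> + ddiv \<Omega> ts (\<lambda>z. (pf z + kin z) *\<^sub>R v z) \<phi> + Q \<phi>) (at_right 0)"
    using Q \<phi> unfolding dlim_def by (intro tendsto_add lim1) blast
  ultimately show "((\<lambda>l. reg \<Omega> ts (\<lambda>z. avg G l pf z * distr_avg \<Omega> G l (ddiv \<Omega> ts v) z) \<phi>)
     \<longlongrightarrow> ddt (reg \<Omega> ts kin) \<phi> + ddiv \<Omega> ts (\<lambda>z. (pf z + kin z) *\<^sub>R v z) \<phi> + Q \<phi>) (at_right 0)"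
    unfolding W_def[symmetric] by (rule Lim_transform_eventually[rotated])
qed

end

text \<open>The weak energy equation, separated into kinetic and internal parts: the internal energy
  balance is the negative of the kinetic one.\<close>

lemma total_energy_split:
  assumes \<phi>: "test_fun \<Omega> ts \<phi>"
  shows "(ddt (reg \<Omega> ts kin) \<phi> + ddiv \<Omega> ts (\<lambda>z. (pf z + kin z) *\<^sub>R v z) \<phi>)
    + (ddt (reg \<Omega> ts u) \<phi> + ddiv \<Omega> ts (\<lambda>z. u z *\<^sub>R v z) \<phi>) = 0"
proof -
  have dt: "test_fun \<Omega> ts (dt \<phi>)" unfolding dt_def by (rule test_fun_pd[OF \<phi>]) simp
  have dx: "test_fun \<Omega> ts (dx j \<phi>)" for j unfolding dx_def by (rule test_fun_pd[OF \<phi>]) simp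
  have L: "Linf \<Omega> ts (\<lambda>z. (pf z + kin z) * v z $ j)" "Linf \<Omega> ts (\<lambda>z. u z * v z $ j)" for j
    by (intro Linf_add Linf_mult Lp Lkin Lu Lvc)+
  have "ddt (reg \<Omega> ts (\<lambda>z. kin z + u z)) \<phi> + ddiv \<Omega> ts (\<lambda>z. (pf z + (kin z + u z)) *\<^sub>R v z) \<phi> = 0"
    using euler \<phi> unfolding euler_weak_def Let_def by blast
  moreover have "ddt (reg \<Omega> ts (\<lambda>z. kin z + u z)) \<phi> = ddt (reg \<Omega> ts kin) \<phi> + ddt (reg \<Omega> ts u) \<phi>"
    unfolding ddt_def using reg_add_left[OF Lkin Lu dt] by simp
  moreover have "ddx j (reg \<Omega> ts (\<lambda>z. ((pf z + (kin z + u z)) *\<^sub>R v z) $ j)) \<phi>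
    = ddx j (reg \<Omega> ts (\<lambda>z. ((pf z + kin z) *\<^sub>R v z) $ j)) \<phi> + ddx j (reg \<Omega> ts (\<lambda>z. (u z *\<^sub>R v z) $ j)) \<phi>" for j
  proof -
    have f: "(\<lambda>z. ((pf z + (kin z + u z)) *\<^sub>R v z) $ j) = (\<lambda>z. (pf z + kin z) * v z $ j + u z * v z $ j)"
      by (simp add: fun_eq_iff algebra_simps)
    show ?thesis unfolding ddx_def f reg_add_left[OF L dx] by simp
  qed
  ultimately show ?thesis unfolding ddiv_def by (simp add: sum.distrib)
qed

end

theorem theorem1:
  fixes \<Omega> :: space_kind and ts :: ereal
    and u \<rho> :: "(real^'n) \<times> real \<Rightarrow> real" and v :: "(real^'n) \<times> real \<Rightarrow> real^'n"
    and s T \<mu> p :: "real \<times> real \<Rightarrow> real"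
    and S U K :: "(real \<times> real) set" and M :: nat and \<rho>0 :: real
    and Q :: "'n functional"
  assumes "0 < ts"
    and "Linf \<Omega> ts u" and "Linf \<Omega> ts \<rho>" and "Linf \<Omega> ts v"
    and "\<rho>0 > 0" and "AE z in Gam \<Omega> ts. \<rho> z \<ge> \<rho>0"
    and "concave_on S s" and "U \<subseteq> S"
    and "open U" and "compact K"
    and "closure (convex hull (ess_range (Gam \<Omega> ts) (\<lambda>z. (u z, \<rho> z)))) \<subseteq> K" and "K \<subseteq> U"
    and "M \<ge> 2" and "Ck_on M U p" and "Ck_on M U T" and "Ck_on M U \<mu>" and "Ck_on M U s"
    and "thermo U s T \<mu> p"
    and "euler_weak \<Omega> ts p u \<rho> v"
    and "distribution \<Omega> ts Q"
    and "\<And>G. mollifier G \<Longrightarrow> dlim \<Omega> ts (\<lambda>l. Qflux G l p u \<rho> v) Q"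
  shows "\<exists>\<Sigma> p\<Theta>. distribution \<Omega> ts \<Sigma> \<and> distribution \<Omega> ts p\<Theta> \<and>
    (\<forall>G. mollifier G \<longrightarrow>
      dlim \<Omega> ts (\<lambda>l. Sinert_star \<Omega> ts G l T \<mu> p u \<rho> v) \<Sigma> \<and>
      dlim \<Omega> ts (\<lambda>l z. avg G l (thermo_field p u \<rho>) z * distr_avg \<Omega> G l (ddiv \<Omega> ts v) z) p\<Theta>) \<and>
    (\<forall>\<phi>. test_fun \<Omega> ts \<phi> \<longrightarrow>
      ddt (reg \<Omega> ts (kinetic \<rho> v)) \<phi>
        + ddiv \<Omega> ts (\<lambda>z. (thermo_field p u \<rho> z + kinetic \<rho> v z) *\<^sub>R v z) \<phi> = p\<Theta> \<phi> - Q \<phi> \<and>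
      ddt (reg \<Omega> ts u) \<phi> + ddiv \<Omega> ts (\<lambda>z. u z *\<^sub>R v z) \<phi> = Q \<phi> - p\<Theta> \<phi> \<and>
      ddt (reg \<Omega> ts (thermo_field s u \<rho>)) \<phi>
        + ddiv \<Omega> ts (\<lambda>z. thermo_field s u \<rho> z *\<^sub>R v z) \<phi> = \<Sigma> \<phi>)"
proof -
  \<comment> \<open>Closed inside the compact K, hence compact; being the closure of a hull it is
    convex; and the state lies in it almost everywhere because it lies in its essential
    range.\<close>
  define C where "C = closure (convex hull (ess_range (Gam \<Omega> ts) (\<lambda>z. (u z, \<rho> z))))"
  have CK: "C \<subseteq> K" "closed C" unfolding C_def using assms(11) by auto
  have "compact C" using CK \<open>compact K\<close> closed_Int_compact[of C K] by (simp add: Int_absorb2)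
  moreover have "convex C" unfolding C_def by (intro convex_closure convex_convex_hull)
  moreover have "C \<subseteq> U" using CK(1) \<open>K \<subseteq> U\<close> by blast
  moreover have "AE z in Gam \<Omega> ts. (u z, \<rho> z) \<in> C"
  proof -
    have "(\<lambda>z. (u z, \<rho> z)) \<in> borel_measurable (Gam \<Omega> ts)"
      using assms(2,3) unfolding Linf_def by (intro borel_measurable_Pair) auto
    from AE_ess_range[OF this] show ?thesis
    proof eventually_elim
      case (elim z)
      thus ?case unfolding C_def using hull_subset closure_subset by (metis subsetD)
    qed
  qed
  moreover have "Ck_on (Suc 0) U p" "Ck_on (Suc 0) U T" "Ck_on (Suc 0) U \<mu>" "Ck_on (Suc 0) U s"
    using assms(13-17) by (auto intro: Ck_on_le)
  ultimately interpret euler_flow \<Omega> ts u \<rho> v s T \<mu> p U C \<rho>0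
    using assms by unfold_locales auto
  define \<Sigma> where "\<Sigma> = (\<lambda>\<phi>. ddt (reg \<Omega> ts (thermo_field s u \<rho>)) \<phi> + ddiv \<Omega> ts (\<lambda>z. thermo_field s u \<rho> z *\<^sub>R v z) \<phi>)"
  \<comment> \<open>Chosen so that the kinetic balance holds by definition; the content lies in the
    convergence statement and, for the internal balance, in conservation of total energy.\<close>
  define p\<Theta> where "p\<Theta> = (\<lambda>\<phi>. ddt (reg \<Omega> ts kin) \<phi> + ddiv \<Omega> ts (\<lambda>z. (pf z + kin z) *\<^sub>R v z) \<phi> + Q \<phi>)"
  have "distribution \<Omega> ts \<Sigma>" unfolding \<Sigma>_def
    by (intro distribution_add distribution_ddt distribution_ddiv) (auto intro!: Lthermo C1(4) Linf_mult Lvc)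
  moreover have "distribution \<Omega> ts p\<Theta>" unfolding p\<Theta>_def
    by (intro distribution_add distribution_ddt distribution_ddiv Lkin assms(20)) (auto intro!: Linf_add Linf_mult Lvc Lp Lkin)
  moreover have "\<forall>G. mollifier G \<longrightarrow>
      dlim \<Omega> ts (\<lambda>l. Sinert_star \<Omega> ts G l T \<mu> p u \<rho> v) \<Sigma> \<and>
      dlim \<Omega> ts (\<lambda>l z. avg G l (thermo_field p u \<rho>) z * distr_avg \<Omega> G l (ddiv \<Omega> ts v) z) p\<Theta>"
    unfolding \<Sigma>_def p\<Theta>_def using entropy_production_limit pressure_work_limit assms(21) by blast
  moreover have "\<forall>\<phi>. test_fun \<Omega> ts \<phi> \<longrightarrow>
      ddt (reg \<Omega> ts (kinetic \<rho> v)) \<phi>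
        + ddiv \<Omega> ts (\<lambda>z. (thermo_field p u \<rho> z + kinetic \<rho> v z) *\<^sub>R v z) \<phi> = p\<Theta> \<phi> - Q \<phi> \<and>
      ddt (reg \<Omega> ts u) \<phi> + ddiv \<Omega> ts (\<lambda>z. u z *\<^sub>R v z) \<phi> = Q \<phi> - p\<Theta> \<phi> \<and>
      ddt (reg \<Omega> ts (thermo_field s u \<rho>)) \<phi>
        + ddiv \<Omega> ts (\<lambda>z. thermo_field s u \<rho> z *\<^sub>R v z) \<phi> = \<Sigma> \<phi>"
  proof (intro allI impI conjI)
    fix \<phi> :: "(real^'n) \<times> real \<Rightarrow> real" assume "test_fun \<Omega> ts \<phi>"
    from total_energy_split[OF this]
    show "ddt (reg \<Omega> ts u) \<phi> + ddiv \<Omega> ts (\<lambda>z. u z *\<^sub>R v z) \<phi> = Q \<phi> - p\<Theta> \<phi>"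
      unfolding p\<Theta>_def by simp
  qed (simp_all add: \<Sigma>_def p\<Theta>_def)
  ultimately show ?thesis by blast
qed

end
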